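(* Let $j,k\in\mathbb{N}$ with $1\le j<k$, let $P,Q,R\in(1,\infty)$ and $p,q,r\in[1,\infty]$ satisfy $$\frac{1}{P}=\frac{j/k}{R}+\frac{1-j/k}{Q},\qquad \frac{1}{p}=\frac{j/k}{r}+\frac{1-j/k}{q}$$ (with $1/\infty=0$). Then there is a constant $C>0$, independent of $u$, such that $$\|\nabla^j u\|_{P,p}\le C\,\|\nabla^k u\|_{R,r}^{\frac{j}{k}}\,\|u\|_{Q,q}^{1-\frac{j}{k}}$$ holds for all $k$-times weakly differentiable functions $u$ on $\mathbb{R}^n$.
   Context: For measurable (scalar or vector-valued) $u$ on $\mathbb{R}^n$ with Lebesgue measure, the non-increasing rearrangement is $u^*(t):=\inf\{s\in(0,\infty):|\{|u|>s\}|\le t\}$, $t>0$ (with $\inf\emptyset=+\infty$), where $|\cdot|$ is the Euclidean norm for vector-valued $u$. The Lorentz functional is $\|u\|_{p,q}:=\|t^{\frac1p-\frac1q}u^*(t)\|_{L^q(0,\infty)}$ with $1/\infty=0$; its value may be $+\infty$. A function $u$ is $k$-times weakly differentiable if $u\in L^1_{\mathrm{loc}}(\mathbb{R}^n)$ has all weak partial derivatives up to order $k$ in $L^1_{\mathrm{loc}}(\mathbb{R}^n)$. $\nabla^j u$ is the vector of all weak partial derivatives of order $j$. On the right-hand side a product $0\cdot\infty$ is read as $\infty$ (i.e. the inequality is then void). *)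

theory Defs
  imports "HOL-Analysis.Analysis" "HOL-Probability.Essential_Supremum"
begin

section \<open>Smooth test functions\<close>

definition partial_deriv :: "'n \<Rightarrow> (real ^ 'n \<Rightarrow> real) \<Rightarrow> (real ^ 'n::finite \<Rightarrow> real)" where
  "partial_deriv i f = (\<lambda>x. deriv (\<lambda>t. f (x + t *\<^sub>R axis i 1)) 0)"

text \<open>Higher partial derivatives are indexed by words of coordinate directions:
  the word \<open>[i\<^sub>1, \<dots>, i\<^sub>m]\<close> stands for \<open>\<partial>\<^bsub>i\<^sub>1\<^esub> \<dots> \<partial>\<^bsub>i\<^sub>m\<^esub>\<close>, of order \<open>m\<close>.\<close>

definition partials :: "'n list \<Rightarrow> (real ^ 'n \<Rightarrow> real) \<Rightarrow> (real ^ 'n::finite \<Rightarrow> real)" where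
  "partials w f = foldr partial_deriv w f"

text \<open>Total differentiability of every iterated partial derivative makes all of them continuous,
  so this is \<open>C\<^sup>\<infinity>\<close>.\<close>

definition smooth :: "(real ^ 'n::finite \<Rightarrow> real) \<Rightarrow> bool" where
  "smooth f \<longleftrightarrow> (\<forall>w. partials w f differentiable_on UNIV)"

definition test_function :: "(real ^ 'n::finite \<Rightarrow> real) \<Rightarrow> bool" where
  "test_function \<phi> \<longleftrightarrow> smooth \<phi> \<and> compact (closure {x. \<phi> x \<noteq> 0})"

section \<open>Weak derivatives\<close>

definition locally_integrable :: "(real ^ 'n::finite \<Rightarrow> real) \<Rightarrow> bool" where
  "locally_integrable u \<longleftrightarrow> (\<forall>K. compact K \<longrightarrow> set_integrable lebesgue K u)"

definition has_weak_partial ::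
    "(real ^ 'n::finite \<Rightarrow> real) \<Rightarrow> 'n list \<Rightarrow> (real ^ 'n \<Rightarrow> real) \<Rightarrow> bool" where
  "has_weak_partial u w g \<longleftrightarrow>
     locally_integrable g \<and>
     (\<forall>\<phi>. test_function \<phi> \<longrightarrow>
        (LINT x|lebesgue. u x * partials w \<phi> x) = (-1) ^ length w * (LINT x|lebesgue. g x * \<phi> x))"

definition weakly_differentiable :: "nat \<Rightarrow> (real ^ 'n::finite \<Rightarrow> real) \<Rightarrow> bool" where
  "weakly_differentiable k u \<longleftrightarrow>
     locally_integrable u \<and> (\<forall>w. length w \<le> k \<longrightarrow> (\<exists>g. has_weak_partial u w g))"

text \<open>Weak partial derivatives are unique up to null sets; a representative is chosen.\<close>

definition weak_partial :: "'n list \<Rightarrow> (real ^ 'n::finite \<Rightarrow> real) \<Rightarrow> (real ^ 'n \<Rightarrow> real)" where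
  "weak_partial w u = (SOME g. has_weak_partial u w g)"

text \<open>The Euclidean norm of the vector of all weak partial derivatives of order \<open>j\<close>. As the length of
  that vector depends on \<open>j\<close>, it is not an element of a fixed type; only its norm enters the
  rearrangement.\<close>

definition weak_grad_norm :: "nat \<Rightarrow> (real ^ 'n::finite \<Rightarrow> real) \<Rightarrow> (real ^ 'n \<Rightarrow> real)" where
  "weak_grad_norm j u = (\<lambda>x. L2_set (\<lambda>w. weak_partial w u x) {w. length w = j})"

section \<open>Rearrangement and Lorentz functional\<close>

text \<open>\<open>Inf {} = \<infinity>\<close> in \<^typ>\<open>ennreal\<close>.\<close>

definition rearrangement :: "(real ^ 'n::finite \<Rightarrow> real) \<Rightarrow> real \<Rightarrow> ennreal" where
  "rearrangement u t =
     Inf {ennreal s | s. 0 < s \<and> emeasure lebesgue {x. s < norm (u x)} \<le> ennreal t}"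

text \<open>Powers of extended non-negative numbers, for exponents \<open>a > 0\<close>.\<close>

definition ennpowr :: "ennreal \<Rightarrow> real \<Rightarrow> ennreal" where
  "ennpowr x a = (if x = \<infinity> then \<infinity> else ennreal (enn2real x powr a))"

definition Lq_norm :: "ennreal \<Rightarrow> (real \<Rightarrow> ennreal) \<Rightarrow> ennreal" where
  "Lq_norm q f =
     (if q = \<infinity> then esssup (restrict_space lborel {0<..}) f
      else ennpowr (\<integral>\<^sup>+ t\<in>{0<..}. ennpowr (f t) (enn2real q) \<partial>lborel) (1 / enn2real q))"

text \<open>The first index is finite; the second lies in \<open>[1,\<infinity>]\<close>, where \<open>1 / \<infinity> = 0\<close> in \<^typ>\<open>ennreal\<close>.\<close>

definition lorentz :: "real \<Rightarrow> ennreal \<Rightarrow> (real ^ 'n::finite \<Rightarrow> real) \<Rightarrow> ennreal" where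
  "lorentz p q u =
     Lq_norm q (\<lambda>t. ennreal (t powr (1 / p - enn2real (1 / q))) * rearrangement u t)"

text \<open>The product in which \<open>0 \<cdot> \<infinity> = \<infinity>\<close>, in contrast to \<open>0 * \<infinity> = 0\<close> in \<^typ>\<open>ennreal\<close>.\<close>

definition mult_top :: "ennreal \<Rightarrow> ennreal \<Rightarrow> ennreal" where
  "mult_top a b = (if a = \<infinity> \<or> b = \<infinity> then \<infinity> else a * b)"

end

theory Submission
  imports Defs
begin

text \<open>At almost every point, a mollification of \<open>\<partial>\<^sup>w u\<close> with \<open>length w = j\<close> at scale \<open>\<tau>\<close> is a function
  of \<open>\<tau>\<close> that tends to \<open>\<partial>\<^sup>w u(x)\<close> as \<open>\<tau> \<rightarrow> 0\<close>. Moving the derivatives onto the mollifier bounds it by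
  \<open>\<tau>\<^bsup>-j\<^esup>\<close> times the maximal function of \<open>u\<close>, while its derivative of order \<open>k - j\<close> in \<open>\<tau>\<close> is bounded by
  the maximal function of \<open>\<nabla>\<^sup>k u\<close>. A forward difference of order \<open>k - j\<close> with step \<open>\<rho>\<close> therefore gives
  \<open>\<bar>\<nabla>\<^sup>j u\<bar> \<le> C (\<rho>\<^bsup>k-j\<^esup> M(\<nabla>\<^sup>k u) + \<rho>\<^bsup>-j\<^esup> M u)\<close> for all \<open>\<rho> > 0\<close>. By the weak type estimate,
  the rearrangement of \<open>M f\<close> is bounded by the averages of that of \<open>f\<close>. Optimising in \<open>\<rho>\<close>, the claim
  follows from Hoelder's inequality and from Hardy's inequality, which needs \<open>Q, R > 1\<close>.\<close>

section \<open>Smooth functions\<close>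

text \<open>The scale is a good variable because one derivative in \<tau> of a mollification costs
  exactly one weak derivative and no power of \<tau>: it is a sum of mollifications of first
  derivatives, with the mollifier multiplied by a coordinate. In the forward difference only the
  smallest scale can lie below \<rho>; sending it to 0 at a Lebesgue point isolates the derivative,
  while all other scales obey the bound by the maximal function of \<open>u\<close>. The mollifier
  is not normalised: its mass is bounded below uniformly in scale and point.

  Maximal functions enter only through superlevel sets with positive levels \<alpha> and \<beta>, so
  that no quotient or power of 0 or infinity arises. The functions need not be integrable, hence the
  weak type estimate is applied to the excess of |f| over f*(t), whose integral is at most that of
  f* over (0, t). Two exceptional sets share the measure t, half each; the halving costs a factor 2.
  Averages that vanish are reached as limits of positive levels, for which both exponents j/k and 1
  - j/k must be positive.\<close>

lemma partials_Nil [simp]: "partials [] f = f"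
  and partials_Cons [simp]: "partials (i # w) f = partial_deriv i (partials w f)"
  and partials_snoc: "partials (w @ [i]) f = partials w (partial_deriv i f)"
  by (simp_all add: partials_def)

text \<open>All iterated derivatives of \<open>f\<close> stay in the class \<open>X\<close>, so one
  stable class of differentiable functions replaces a separate induction over words for each
  concrete function.\<close>

lemma smooth_coinduct:
  assumes "f \<in> X"
    and "\<And>g. g \<in> X \<Longrightarrow> g differentiable_on UNIV"
    and "\<And>g i. g \<in> X \<Longrightarrow> partial_deriv i g \<in> X"
  shows "smooth f"
proof -
  have "partials w f \<in> X" for w
    by (induction w) (use assms in auto)
  then show ?thesis
    using assms(2) by (auto simp: smooth_def)
qed

lemma smooth_differentiable: "smooth f \<Longrightarrow> f differentiable at x"
  using partials_Nil by (metis UNIV_I smooth_def differentiable_on_def)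

lemma smooth_partial_deriv: "smooth f \<Longrightarrow> smooth (partial_deriv i f)"
  by (simp add: smooth_def flip: partials_snoc)

lemma smooth_partials: "smooth f \<Longrightarrow> smooth (partials w f)"
  by (induction w) (auto intro: smooth_partial_deriv)

lemma smooth_continuous_on: "smooth f \<Longrightarrow> continuous_on A f"
  by (meson continuous_at_imp_continuous_on differentiable_imp_continuous_within smooth_differentiable)

lemma has_derivative_imp_partial_deriv:
  assumes "(f has_derivative f') (at x)"
  shows "partial_deriv i f x = f' (axis i 1)"
proof -
  have "((\<lambda>t. x + t *\<^sub>R axis i 1) has_derivative (\<lambda>t. t *\<^sub>R axis i 1)) (at (0::real))"
    by (auto intro!: derivative_eq_intros)
  then have "((\<lambda>t. f (x + t *\<^sub>R axis i 1)) has_derivative (\<lambda>t. f' (t *\<^sub>R axis i 1))) (at 0)"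
    using has_derivative_compose[of "\<lambda>t. x + t *\<^sub>R axis i 1" _ 0 UNIV f f'] assms by simp
  moreover have "(\<lambda>t. f' (t *\<^sub>R axis i 1)) = (*) (f' (axis i 1))"
    using assms by (simp add: fun_eq_iff has_derivative_def bounded_linear.linear linear_cmul)
  ultimately show ?thesis
    unfolding partial_deriv_def by (intro DERIV_imp_deriv) (simp add: has_field_derivative_def)
qed

lemma has_derivative_partials:
  fixes f :: "real ^ 'n::finite \<Rightarrow> real"
  assumes "f differentiable at x"
  shows "(f has_derivative (\<lambda>h. \<Sum>i\<in>UNIV. h $ i * partial_deriv i f x)) (at x)"
proof -
  obtain f' where f': "(f has_derivative f') (at x)"
    using assms by (auto simp: differentiable_def)
  have "f' h = (\<Sum>i\<in>UNIV. h $ i * partial_deriv i f x)" for h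
  proof -
    have "f' h = f' (\<Sum>i\<in>UNIV. h $ i *\<^sub>R axis i 1)"
      by (metis basis_expansion scalar_mult_eq_scaleR)
    also have "\<dots> = (\<Sum>i\<in>UNIV. h $ i * f' (axis i 1))"
      using f' by (simp add: has_derivative_def bounded_linear.linear linear_sum linear_cmul)
    finally show ?thesis
      by (simp add: has_derivative_imp_partial_deriv[OF f'])
  qed
  then show ?thesis using f' by presburger
qed

lemma partial_deriv_add:
  assumes "f differentiable at x" "g differentiable at x"
  shows "partial_deriv i (\<lambda>x. f x + g x) x = partial_deriv i f x + partial_deriv i g x"
  using assms by (auto simp: differentiable_def has_derivative_imp_partial_deriv[OF has_derivative_add]
      has_derivative_imp_partial_deriv)

lemma partial_deriv_mult:
  assumes "f differentiable at x" "g differentiable at x"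
  shows "partial_deriv i (\<lambda>x. f x * g x) x = f x * partial_deriv i g x + partial_deriv i f x * g x"
  using assms by (auto simp: differentiable_def has_derivative_imp_partial_deriv[OF has_derivative_mult]
      has_derivative_imp_partial_deriv)

lemma partial_deriv_nth: "partial_deriv i (\<lambda>x. x $ j) x = axis i 1 $ j"
  by (rule has_derivative_imp_partial_deriv) (rule bounded_linear_imp_has_derivative[OF bounded_linear_vec_nth])

lemma partial_deriv_const: "partial_deriv i (\<lambda>x. c) x = 0"
  by (rule has_derivative_imp_partial_deriv) (auto intro!: derivative_eq_intros)

section \<open>Algebras of smooth functions\<close>

text \<open>The algebra generated by \<open>A\<close>, the constants and the coordinates.
  Coordinates are included because derivatives of a radial bump carry such factors.\<close>

inductive_set alg_hull :: "(real ^ 'n::finite \<Rightarrow> real) set \<Rightarrow> (real ^ 'n \<Rightarrow> real) set" for A where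
  base: "f \<in> A \<Longrightarrow> f \<in> alg_hull A"
| const: "(\<lambda>x. c) \<in> alg_hull A"
| coord: "(\<lambda>x. x $ i) \<in> alg_hull A"
| add: "f \<in> alg_hull A \<Longrightarrow> g \<in> alg_hull A \<Longrightarrow> (\<lambda>x. f x + g x) \<in> alg_hull A"
| mult: "f \<in> alg_hull A \<Longrightarrow> g \<in> alg_hull A \<Longrightarrow> (\<lambda>x. f x * g x) \<in> alg_hull A"

text \<open>By the sum and product rules the hull is stable under \<open>partial_deriv\<close> once
  the derivatives of the generators lie in it, so the coinduction principle applies to the
  hull.\<close>

lemma smooth_alg_hull:
  fixes A :: "(real ^ 'n::finite \<Rightarrow> real) set"
  assumes A: "\<And>f x. f \<in> A \<Longrightarrow> f differentiable at x"
    and A': "\<And>f i. f \<in> A \<Longrightarrow> partial_deriv i f \<in> alg_hull A"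
    and f: "f \<in> alg_hull A"
  shows "smooth f"
proof (rule smooth_coinduct[OF f])
  have diff: "g differentiable at x" if "g \<in> alg_hull A" for g x
    using that
  proof induction
    case (coord i)
    show ?case
      using bounded_linear_imp_differentiable bounded_linear_vec_nth by blast
  qed (auto intro: A)
  then show "g differentiable_on UNIV" if "g \<in> alg_hull A" for g
    using that by (simp add: differentiable_on_def)
  show "partial_deriv i g \<in> alg_hull A" if "g \<in> alg_hull A" for g i
    using that
  proof induction
    case (coord j)
    show ?case unfolding partial_deriv_nth[abs_def] by (rule alg_hull.const)
  next
    case (const c)
    show ?case unfolding partial_deriv_const[abs_def] by (rule alg_hull.const)
  next
    case (add f g)
    then have "partial_deriv i (\<lambda>x. f x + g x) = (\<lambda>x. partial_deriv i f x + partial_deriv i g x)"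
      by (simp add: fun_eq_iff partial_deriv_add diff)
    then show ?case using add by (auto intro: alg_hull.add)
  next
    case (mult f g)
    then have "partial_deriv i (\<lambda>x. f x * g x)
        = (\<lambda>x. f x * partial_deriv i g x + partial_deriv i f x * g x)"
      by (simp add: fun_eq_iff partial_deriv_mult diff)
    then show ?case using mult by (auto intro: alg_hull.add alg_hull.mult)
  qed (use A' in auto)
qed

lemma smooth_mult_coord:
  assumes "smooth f" shows "smooth (\<lambda>x. x $ i * f x)"
proof (rule smooth_alg_hull[where A = "Collect smooth"])
  show "(\<lambda>x. x $ i * f x) \<in> alg_hull (Collect smooth)"
    using assms by (intro alg_hull.intros) auto
qed (auto intro: alg_hull.base smooth_differentiable smooth_partial_deriv)

lemma partial_deriv_affine:
  fixes f :: "real ^ 'n::finite \<Rightarrow> real"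
  assumes "f differentiable at (c *\<^sub>R x + d)"
  shows "partial_deriv i (\<lambda>x. a * f (c *\<^sub>R x + d)) x = a * c * partial_deriv i f (c *\<^sub>R x + d)"
proof -
  have "((\<lambda>x. c *\<^sub>R x + d) has_derivative (\<lambda>h. c *\<^sub>R h)) (at x)"
    by (auto intro!: derivative_eq_intros)
  from has_derivative_compose[OF this has_derivative_partials[OF assms]]
  have *: "((\<lambda>x. a * f (c *\<^sub>R x + d)) has_derivative
      (\<lambda>h. a * (\<Sum>i\<in>UNIV. (c *\<^sub>R h) $ i * partial_deriv i f (c *\<^sub>R x + d)))) (at x)"
    by (rule has_derivative_mult_right)
  show ?thesis
    unfolding has_derivative_imp_partial_deriv[OF *] by (simp add: axis_def if_distrib if_distribR cong: if_cong)
qed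

lemma partials_affine:
  fixes f :: "real ^ 'n::finite \<Rightarrow> real"
  assumes "smooth f"
  shows "partials w (\<lambda>x. a * f (c *\<^sub>R x + d)) = (\<lambda>x. a * c ^ length w * partials w f (c *\<^sub>R x + d))"
proof (induction w)
  case (Cons i w)
  show ?case
    unfolding partials_Cons Cons
    by (simp add: fun_eq_iff mult_ac
        partial_deriv_affine[OF smooth_differentiable[OF smooth_partials[OF assms]],
          where a = "a * c ^ length w", simplified mult_ac])
qed simp

lemma smooth_affine:
  fixes f :: "real ^ 'n::finite \<Rightarrow> real"
  assumes "smooth f"
  shows "smooth (\<lambda>x. a * f (c *\<^sub>R x + d))"
  unfolding smooth_def
proof
  fix w
  show "partials w (\<lambda>x. a * f (c *\<^sub>R x + d)) differentiable_on UNIV"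
    unfolding partials_affine[OF assms] differentiable_on_def
  proof
    fix x :: "real ^ 'n"
    have "(\<lambda>x. c *\<^sub>R x + d) differentiable at x" by simp
    from differentiable_chain_at[OF this smooth_differentiable[OF smooth_partials[OF assms]], of w]
    show "(\<lambda>x. a * c ^ length w * partials w f (c *\<^sub>R x + d)) differentiable at x"
      by (simp add: o_def)
  qed
qed


section \<open>A smooth bump supported in the unit ball\<close>

text \<open>The classical flat function \<open>exp (- 1 / t)\<close>, extended by 0 to the left. The
  polynomial factor in \<open>1 / t\<close> enlarges it to a family that is closed under
  differentiation.\<close>

definition flat :: "real poly \<Rightarrow> real \<Rightarrow> real" where
  "flat p t = (if 0 < t then poly p (1 / t) * exp (- (1 / t)) else 0)"

lemma tendsto_poly_div_exp_0: "((\<lambda>s::real. poly p s / exp s) \<longlongrightarrow> 0) at_top"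
proof -
  have "((\<lambda>s. \<Sum>i\<le>degree p. coeff p i * (s ^ i / exp s)) \<longlongrightarrow> (\<Sum>i\<le>degree p. coeff p i * 0)) at_top"
    by (intro tendsto_intros tendsto_power_div_exp_0)
  then show ?thesis
    by (simp add: poly_altdef sum_divide_distrib)
qed

text \<open>With \<open>s = 1 / t\<close>, the chain rule turns \<open>p(s) exp(-s)\<close> into
  \<open>s^2 (p - p')(s) exp(-s)\<close>, whence the factor \<open>[:0, 0, 1:]\<close>. At 0 the
  right difference quotient is \<open>s p(s) exp(-s)\<close>, which tends to 0 as \<open>s\<close>
  grows.\<close>

lemma DERIV_flat: "(flat p has_real_derivative flat ([:0, 0, 1:] * (p - pderiv p)) t) (at t)"
proof -
  consider "t < 0" | "t > 0" | "t = 0" by linarith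
  then show ?thesis
  proof cases
    case 1
    have "(flat p has_real_derivative 0) (at t)"
      by (rule has_field_derivative_transform_within_open[of "\<lambda>_. 0" _ _ "{..<0}"])
        (use 1 in \<open>auto simp: flat_def\<close>)
    then show ?thesis using 1 by (simp add: flat_def)
  next
    case 2
    have "((\<lambda>t. poly p (1 / t) * exp (- (1 / t))) has_real_derivative
        flat ([:0, 0, 1:] * (p - pderiv p)) t) (at t)"
      using 2 by (auto intro!: derivative_eq_intros DERIV_chain2[OF poly_DERIV]
          simp: flat_def field_simps power2_eq_square)
    then show ?thesis
      by (rule has_field_derivative_transform_within_open[where S = "{0<..}"])
        (use 2 in \<open>auto simp: flat_def\<close>)
  next
    case 3
    have "((\<lambda>t. flat p t / t) \<longlongrightarrow> 0) (at_left 0)"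
      by (rule tendsto_eventually) (auto simp: flat_def eventually_at_filter)
    moreover have "((\<lambda>t. flat p t / t) \<longlongrightarrow> 0) (at_right 0)"
    proof -
      have "((\<lambda>t. poly (pCons 0 p) (inverse t) / exp (inverse t)) \<longlongrightarrow> 0) (at_right (0::real))"
        using filterlim_compose[OF tendsto_poly_div_exp_0 filterlim_inverse_at_top_right] .
      then show ?thesis
        by (rule Lim_transform_eventually)
          (auto simp: eventually_at_filter flat_def exp_minus divide_simps)
    qed
    ultimately have "((\<lambda>t. flat p t / t) \<longlongrightarrow> 0) (at 0)"
      by (simp add: filterlim_at_split)
    then show ?thesis
      using 3 by (simp add: has_field_derivative_iff flat_def)
  qed
qed

text \<open>For \<open>p = 1\<close> this is the standard mollifier
  \<open>exp (- 1 / (1 - |x|^2))\<close>, not normalised. Writing the squared norm in coordinates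
  makes each partial derivative a coordinate times another bump, up to a constant.\<close>

definition bump :: "real poly \<Rightarrow> real ^ 'n::finite \<Rightarrow> real" where
  "bump p x = flat p (1 - (\<Sum>i\<in>UNIV. x $ i * x $ i))"

lemma bump_has_derivative:
  fixes x :: "real ^ 'n::finite"
  shows "(bump p has_derivative
     (\<lambda>h. flat ([:0, 0, 1:] * (p - pderiv p)) (1 - (\<Sum>i\<in>UNIV. x $ i * x $ i)) * (- (\<Sum>i\<in>UNIV. 2 * (x $ i * h $ i))))) (at x)"
proof -
  have "((\<lambda>x::real^'n. 1 - (\<Sum>i\<in>UNIV. x $ i * x $ i)) has_derivative (\<lambda>h. - (\<Sum>i\<in>UNIV. 2 * (x $ i * h $ i)))) (at x)"
    by (auto intro!: derivative_eq_intros bounded_linear_imp_has_derivative[OF bounded_linear_vec_nth] sum.cong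
        simp: sum_negf[symmetric] mult_ac)
  from has_derivative_compose[OF this DERIV_flat[unfolded has_field_derivative_def]]
  show ?thesis by (simp add: bump_def[abs_def])
qed

lemma smooth_bump: "smooth (bump p)"
proof (rule smooth_alg_hull[where A = "range bump"])
  fix f :: "real ^ 'n \<Rightarrow> real" and i :: 'n
  assume "f \<in> range bump"
  then obtain p where f: "f = bump p" by auto
  have "partial_deriv i f = (\<lambda>x. bump ([:0, 0, 1:] * (p - pderiv p)) x * (- 2 * x $ i))"
    unfolding f fun_eq_iff has_derivative_imp_partial_deriv[OF bump_has_derivative]
    by (auto simp: bump_def axis_def if_distrib sum.delta cong: if_cong)
  moreover have "\<dots> \<in> alg_hull (range bump)"
    by (intro alg_hull.mult alg_hull.const alg_hull.coord alg_hull.base rangeI)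
  ultimately show "partial_deriv i f \<in> alg_hull (range bump)"
    by simp
qed (use bump_has_derivative differentiableI in \<open>blast intro: alg_hull.base\<close>)+

lemma bump_eq_0:
  assumes "1 \<le> norm x" shows "bump p x = 0"
proof -
  have "1 \<le> (norm x)\<^sup>2" using assms by (simp add: one_le_power)
  then show ?thesis
    by (simp add: bump_def flat_def norm_vec_def L2_set_def power2_eq_square sum_nonneg)
qed

lemma bump_1_nonneg: "0 \<le> bump 1 x"
  by (simp add: bump_def flat_def)

lemma smooth_imp_test_function:
  fixes \<psi> :: "real ^ 'n::finite \<Rightarrow> real"
  assumes "smooth \<psi>" "\<And>x. r \<le> norm (x - a) \<Longrightarrow> \<psi> x = 0"
  shows "test_function \<psi>"
proof -
  have "{x. \<psi> x \<noteq> 0} \<subseteq> cball a r"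
    using assms(2) by (auto simp: dist_norm norm_minus_commute) (meson linear)
  then have "bounded {x. \<psi> x \<noteq> 0}" by (meson bounded_cball bounded_subset)
  then show ?thesis using assms(1) by (simp add: test_function_def)
qed

section \<open>Maximal function estimates and Lebesgue points\<close>

lemma ball_sets_lebesgue [measurable]: "ball (x::'a::euclidean_space) r \<in> sets lebesgue"
  by simp

lemma emeasure_lborel_ball:
  fixes x :: "'a::euclidean_space"
  assumes "0 \<le> r"
  shows "emeasure lborel (ball x r) = ennreal (r ^ DIM('a) * measure lborel (ball (0::'a) 1))"
proof -
  have "emeasure lborel (ball x r) = ennreal (measure lborel (ball x r))"
    using emeasure_lborel_ball_finite[of x r] by (subst emeasure_eq_ennreal_measure) auto
  then show ?thesis
    by (simp add: content_ball_conv_unit_ball[OF assms, of x])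
qed

text \<open>\<open>heavy c f\<close> is the set where the uncentred maximal function of \<open>f\<close> exceeds \<open>c\<close>.\<close>

definition heavy :: "real \<Rightarrow> ('a::euclidean_space \<Rightarrow> real) \<Rightarrow> 'a set" where
  "heavy c f = (\<Union>(x, r)\<in>{(x, r). 0 < r \<and>
     ennreal c * emeasure lborel (ball x r) < (\<integral>\<^sup>+y\<in>ball x r. ennreal \<bar>f y\<bar> \<partial>lebesgue)}. ball x r)"

text \<open>The balls need only contain the point, not be centred at it. The set is therefore a
  union of balls, and measurability comes with openness.\<close>

lemma open_heavy: "open (heavy c f)"
  by (auto simp: heavy_def)

lemma heavy_sets [measurable]: "heavy c f \<in> sets lebesgue"
  by (intro sets_completionI_sets) (simp add: open_heavy borel_open)

lemma not_heavyD:
  assumes "x \<notin> heavy c f" "0 < r"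
  shows "(\<integral>\<^sup>+y\<in>ball x r. ennreal \<bar>f y\<bar> \<partial>lebesgue) \<le> ennreal c * emeasure lborel (ball x r)"
proof (rule ccontr)
  assume "\<not> ?thesis"
  then have "(x, r) \<in> {(x, r). 0 < r \<and>
     ennreal c * emeasure lborel (ball x r) < (\<integral>\<^sup>+y\<in>ball x r. ennreal \<bar>f y\<bar> \<partial>lebesgue)}"
    using assms by (simp add: not_le)
  moreover have "x \<in> ball x r" using assms by simp
  ultimately show False using assms(1) unfolding heavy_def by blast
qed

text \<open>The weak type (1,1) bound. Vitali's lemma selects disjoint balls whose fivefold
  enlargements cover the set; on each selected ball the integral exceeds \<open>c\<close> times the
  volume, and by disjointness these integrals add up to at most the full one.\<close>

lemma emeasure_heavy_le:
  fixes f :: "'a::euclidean_space \<Rightarrow> real"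
  assumes f [measurable]: "f \<in> borel_measurable lebesgue" and c: "0 < c"
  shows "ennreal c * emeasure lebesgue (heavy c f) \<le> ennreal (5 ^ DIM('a)) * (\<integral>\<^sup>+y. ennreal \<bar>f y\<bar> \<partial>lebesgue)"
proof (cases "(\<integral>\<^sup>+y. ennreal \<bar>f y\<bar> \<partial>lebesgue) = \<infinity>")
  case True
  then show ?thesis by (simp add: ennreal_mult_top)
next
  case False
  then obtain I where I: "0 \<le> I" "(\<integral>\<^sup>+y. ennreal \<bar>f y\<bar> \<partial>lebesgue) = ennreal I"
    by (metis ennreal_cases infinity_ennreal_def)
  define K where "K = {(x::'a, r). 0 < r \<and>
     ennreal c * emeasure lborel (ball x r) < (\<integral>\<^sup>+y\<in>ball x r. ennreal \<bar>f y\<bar> \<partial>lebesgue)}"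
  define vol where "vol = measure lborel (ball (0::'a) 1)"
  have vol: "0 < vol" unfolding vol_def by (rule content_ball_pos) simp
  \<comment> \<open>Vitali's lemma needs bounded radii: a ball with average above \<open>c\<close>
    has volume at most \<open>I / c\<close>. The maximum with 1 avoids a root, since
    \<open>r \<le> r ^ DIM('a)\<close> for \<open>r \<ge> 1\<close>.\<close>
  have bound: "0 < snd i \<and> snd i \<le> max 1 (I / (c * vol))" if "i \<in> K" for i
  proof -
    obtain x r where i: "i = (x, r)" by force
    have r: "0 < r" using that by (simp add: K_def i)
    have "ennreal (c * (r ^ DIM('a) * vol)) = ennreal c * emeasure lborel (ball x r)"
      using r c by (simp add: emeasure_lborel_ball vol_def ennreal_mult)
    also have "\<dots> \<le> (\<integral>\<^sup>+y\<in>ball x r. ennreal \<bar>f y\<bar> \<partial>lebesgue)"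
      using that by (auto simp: K_def i intro: less_imp_le)
    also have "\<dots> \<le> ennreal I"
      unfolding I(2)[symmetric] by (intro nn_integral_mono) (auto simp: indicator_def)
    finally have "r ^ DIM('a) * (c * vol) \<le> I"
      using I(1) by (simp add: mult_ac)
    then have *: "r ^ DIM('a) \<le> I / (c * vol)"
      using c vol by (simp add: pos_le_divide_eq)
    have "r \<le> max 1 (I / (c * vol))"
    proof (cases "r \<le> 1")
      case False
      then have "r ^ 1 \<le> r ^ DIM('a)"
        by (intro power_increasing) (auto simp: DIM_positive Suc_leI)
      then show ?thesis using * by simp
    qed simp
    then show ?thesis using r by (simp add: i)
  qed
  have sub: "heavy c f \<subseteq> (\<Union>i\<in>K. ball (fst i) (snd i))"
    by (auto simp: heavy_def K_def)
  obtain C where C: "countable C" "C \<subseteq> K"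
     "pairwise (\<lambda>i j. disjnt (ball (fst i) (snd i)) (ball (fst j) (snd j))) C"
     "heavy c f \<subseteq> (\<Union>i\<in>C. ball (fst i) (5 * snd i))"
    using Vitali_covering_lemma_balls[OF sub bound] by blast
  define N where "N = to_nat_on C ` C"
  define e where "e = from_nat_into C"
  have e: "e n \<in> C" if "n \<in> N" for n
    using that by (auto simp: e_def N_def C(1))
  have inj: "m = n" if "m \<in> N" "n \<in> N" "e m = e n" for m n
    using that C(1) by (auto simp: e_def N_def)
  have eN: "\<exists>n\<in>N. e n = i" if "i \<in> C" for i
    using that C(1) by (auto simp: e_def N_def)
  \<comment> \<open>The selected family may be finite, so indices outside \<open>N\<close> receive
    the empty set, which contributes nothing to measures and integrals.\<close>
  define B where "B n = (if n \<in> N then ball (fst (e n)) (snd (e n)) else {})" for n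
  define B5 where "B5 n = (if n \<in> N then ball (fst (e n)) (5 * snd (e n)) else {})" for n
  have disj: "disjoint_family B"
    unfolding disjoint_family_on_def
  proof (intro ballI impI)
    fix m n :: nat assume "m \<noteq> n"
    then show "B m \<inter> B n = {}"
      using inj[of m n] e[of m] e[of n] C(3) unfolding B_def pairwise_def disjnt_def by auto
  qed
  have le: "ennreal c * emeasure lebesgue (B5 n)
      \<le> ennreal (5 ^ DIM('a)) * (\<integral>\<^sup>+y\<in>B n. ennreal \<bar>f y\<bar> \<partial>lebesgue)" for n
  proof (cases "n \<in> N")
    case True
    then have K: "e n \<in> K" using e C(2) by auto
    then have r: "0 < snd (e n)" by (auto simp: K_def)
    have "ennreal c * emeasure lebesgue (B5 n) = ennreal c * (ennreal (5 ^ DIM('a)) * emeasure lebesgue (B n))"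
      using True r by (simp add: B5_def B_def emeasure_lborel_ball power_mult_distrib flip: ennreal_mult)
        (simp add: mult_ac)
    also have "\<dots> = ennreal (5 ^ DIM('a)) * (ennreal c * emeasure lebesgue (B n))"
      by (simp add: mult_ac)
    also have "\<dots> \<le> ennreal (5 ^ DIM('a)) * (\<integral>\<^sup>+y\<in>B n. ennreal \<bar>f y\<bar> \<partial>lebesgue)"
      using K True by (intro mult_left_mono) (auto simp: K_def B_def split_beta)
    finally show ?thesis .
  qed (simp add: B5_def)
  have "heavy c f \<subseteq> (\<Union>n. B5 n)"
  proof
    fix x assume "x \<in> heavy c f"
    then obtain i where "i \<in> C" "x \<in> ball (fst i) (5 * snd i)" using C(4) by blast
    moreover then obtain n where "n \<in> N" "e n = i" using eN by blast
    ultimately have "x \<in> B5 n" by (simp add: B5_def)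
    then show "x \<in> (\<Union>n. B5 n)" by blast
  qed
  then have "emeasure lebesgue (heavy c f) \<le> emeasure lebesgue (\<Union>n. B5 n)"
    by (rule emeasure_mono) (auto simp: B5_def)
  also have "\<dots> \<le> (\<Sum>n. emeasure lebesgue (B5 n))"
    by (rule emeasure_subadditive_countably) (auto simp: B5_def)
  finally have "ennreal c * emeasure lebesgue (heavy c f) \<le> (\<Sum>n. ennreal c * emeasure lebesgue (B5 n))"
    by (simp add: mult_left_mono)
  also have "\<dots> \<le> (\<Sum>n. ennreal (5 ^ DIM('a)) * (\<integral>\<^sup>+y\<in>B n. ennreal \<bar>f y\<bar> \<partial>lebesgue))"
    by (intro suminf_le le summableI)
  also have "\<dots> = ennreal (5 ^ DIM('a)) * (\<integral>\<^sup>+y\<in>(\<Union>n. B n). ennreal \<bar>f y\<bar> \<partial>lebesgue)"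
    by (subst nn_integral_disjoint_family[OF _ _ disj]) (auto simp: B_def)
  also have "\<dots> \<le> ennreal (5 ^ DIM('a)) * (\<integral>\<^sup>+y. ennreal \<bar>f y\<bar> \<partial>lebesgue)"
    by (intro mult_left_mono nn_integral_mono) (auto simp: indicator_def)
  finally show ?thesis .
qed

section \<open>Approximation by continuous functions and Lebesgue differentiation\<close>

text \<open>Induction over integrable functions. For an indicator, Urysohn's lemma between a closed
  inner and an open outer approximation changes the function only on a set of small measure; limits
  are handled by dominated convergence.\<close>

lemma integrable_approx_continuous:
  fixes v :: "'a::euclidean_space \<Rightarrow> real"
  assumes "integrable lebesgue v" "0 < \<delta>"
  shows "\<exists>c. continuous_on UNIV c \<and> (\<integral>\<^sup>+x. ennreal \<bar>v x - c x\<bar> \<partial>lebesgue) < ennreal \<delta>"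
  using assms
proof (induction v arbitrary: \<delta> rule: integrable_induct)
  case (base A a)
  \<comment> \<open>Two sets of measure below \<epsilon> cost at most
    \<open>\<bar>a\<bar> * \<epsilon>\<close> each. The summand 1 keeps \<epsilon> positive when
    \<open>a = 0\<close>.\<close>
  define \<epsilon> where "\<epsilon> = \<delta> / (2 * (\<bar>a\<bar> + 1))"
  have \<epsilon>: "0 < \<epsilon>" using base by (simp add: \<epsilon>_def)
  obtain T where T: "closed T" "T \<subseteq> A" "A - T \<in> lmeasurable" "emeasure lebesgue (A - T) < ennreal \<epsilon>"
    using sets_lebesgue_inner_closed[OF base(1) \<epsilon>] .
  obtain U where U: "open U" "A \<subseteq> U" "U - A \<in> lmeasurable" "emeasure lebesgue (U - A) < ennreal \<epsilon>"
    using sets_lebesgue_outer_open[OF base(1) \<epsilon>] .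
  obtain \<phi> :: "'a \<Rightarrow> real" where \<phi>: "continuous_on UNIV \<phi>" "\<And>x. \<phi> x \<in> closed_segment 1 0"
    "\<And>x. x \<in> T \<Longrightarrow> \<phi> x = 1" "\<And>x. x \<in> - U \<Longrightarrow> \<phi> x = 0"
    by (rule Urysohn[of T "- U" 1 0]) (use T(1,2) U(1,2) in auto)
  have "ennreal \<bar>indicat_real A x *\<^sub>R a - a * \<phi> x\<bar> \<le> ennreal \<bar>a\<bar> * indicator ((A - T) \<union> (U - A)) x" for x
  proof -
    have \<phi>01: "0 \<le> \<phi> x" "\<phi> x \<le> 1" using \<phi>(2)[of x] by (auto simp: closed_segment_eq_real_ivl)
    show ?thesis
    proof (cases "x \<in> (A - T) \<union> (U - A)")
      case True
      have "\<bar>indicat_real A x *\<^sub>R a - a * \<phi> x\<bar> = \<bar>a\<bar> * \<bar>indicat_real A x - \<phi> x\<bar>"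
        by (simp add: algebra_simps flip: abs_mult)
      also have "\<dots> \<le> \<bar>a\<bar> * 1"
        using \<phi>01 by (intro mult_left_mono) (auto simp: indicator_def)
      finally show ?thesis using True by (simp add: ennreal_leI)
    next
      case False
      then show ?thesis using \<phi>(3,4)[of x] T(2) U(2) by (auto simp: indicator_def)
    qed
  qed
  then have "(\<integral>\<^sup>+x. ennreal \<bar>indicat_real A x *\<^sub>R a - a * \<phi> x\<bar> \<partial>lebesgue)
      \<le> (\<integral>\<^sup>+x. ennreal \<bar>a\<bar> * indicator ((A - T) \<union> (U - A)) x \<partial>lebesgue)"
    by (intro nn_integral_mono)
  also have "\<dots> = ennreal \<bar>a\<bar> * emeasure lebesgue ((A - T) \<union> (U - A))"
    using T U by (intro nn_integral_cmult_indicator) (auto intro: fmeasurableD)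
  also have "\<dots> \<le> ennreal \<bar>a\<bar> * (emeasure lebesgue (A - T) + emeasure lebesgue (U - A))"
    using T U by (intro mult_left_mono emeasure_subadditive) (auto intro: fmeasurableD)
  also have "\<dots> \<le> ennreal \<bar>a\<bar> * (ennreal \<epsilon> + ennreal \<epsilon>)"
    using T U by (intro mult_left_mono add_mono) auto
  also have "\<dots> = ennreal (\<bar>a\<bar> * (2 * \<epsilon>))"
    using \<epsilon> by (simp add: ennreal_mult flip: ennreal_plus)
  also have "\<dots> < ennreal \<delta>"
    using base(3) by (intro ennreal_lessI) (auto simp: \<epsilon>_def field_simps)
  finally show ?case
    using \<phi>(1) by (intro exI[of _ "\<lambda>x. a * \<phi> x"]) (auto intro: continuous_intros)
next
  case (add f g)
  obtain c where c: "continuous_on UNIV c" "(\<integral>\<^sup>+x. ennreal \<bar>f x - c x\<bar> \<partial>lebesgue) < ennreal (\<delta> / 2)"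
    using add(3)[of "\<delta> / 2"] add(5) by auto
  obtain d where d: "continuous_on UNIV d" "(\<integral>\<^sup>+x. ennreal \<bar>g x - d x\<bar> \<partial>lebesgue) < ennreal (\<delta> / 2)"
    using add(4)[of "\<delta> / 2"] add(5) by auto
  have [measurable]: "f \<in> borel_measurable lebesgue" "g \<in> borel_measurable lebesgue"
    "c \<in> borel_measurable lebesgue" "d \<in> borel_measurable lebesgue"
    using add(1,2) borel_measurable_continuous_onI[OF c(1)] borel_measurable_continuous_onI[OF d(1)]
    by (auto simp: borel_measurable_integrable measurable_completion)
  have "(\<integral>\<^sup>+x. ennreal \<bar>f x + g x - (c x + d x)\<bar> \<partial>lebesgue)
      \<le> (\<integral>\<^sup>+x. ennreal \<bar>f x - c x\<bar> + ennreal \<bar>g x - d x\<bar> \<partial>lebesgue)"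
    by (intro nn_integral_mono) (simp flip: ennreal_plus)
  also have "\<dots> = (\<integral>\<^sup>+x. ennreal \<bar>f x - c x\<bar> \<partial>lebesgue) + (\<integral>\<^sup>+x. ennreal \<bar>g x - d x\<bar> \<partial>lebesgue)"
    by (rule nn_integral_add) auto
  also have "\<dots> < ennreal (\<delta> / 2) + ennreal (\<delta> / 2)"
    by (rule add_strict_mono) (use c d in auto)
  also have "\<dots> = ennreal \<delta>"
    using add(5) by (simp flip: ennreal_plus)
  finally show ?case
    using c d by (intro exI[of _ "\<lambda>x. c x + d x"]) (auto intro: continuous_intros)
next
  case (lim f s)
  have [measurable]: "f \<in> borel_measurable lebesgue" "\<And>i. s i \<in> borel_measurable lebesgue"
    using lim by (auto simp: borel_measurable_integrable)
  have w: "(\<integral>\<^sup>+x. ennreal (2 * \<bar>f x\<bar>) \<partial>lebesgue) < top"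
    using \<open>integrable lebesgue f\<close> by (simp add: ennreal_mult nn_integral_cmult ennreal_mult_less_top integrable_iff_bounded)
  have "(\<lambda>i. \<integral>\<^sup>+x. norm (f x - s i x) \<partial>lebesgue) \<longlonglongrightarrow> 0"
    by (rule nn_integral_dominated_convergence_norm[where w = "\<lambda>x. 2 * norm (f x)"])
      (use lim w in \<open>auto simp: integrable_iff_bounded\<close>)
  then have "eventually (\<lambda>i. (\<integral>\<^sup>+x. norm (f x - s i x) \<partial>lebesgue) < ennreal (\<delta> / 2)) sequentially"
    using \<open>0 < \<delta>\<close> by (auto intro: order_tendstoD(2))
  then obtain i where i: "(\<integral>\<^sup>+x. ennreal \<bar>f x - s i x\<bar> \<partial>lebesgue) < ennreal (\<delta> / 2)"
    by (auto simp: eventually_sequentially)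
  obtain c where c: "continuous_on UNIV c" "(\<integral>\<^sup>+x. ennreal \<bar>s i x - c x\<bar> \<partial>lebesgue) < ennreal (\<delta> / 2)"
    using lim.IH[of "\<delta> / 2" i] \<open>0 < \<delta>\<close> by auto
  have [measurable]: "c \<in> borel_measurable lebesgue"
    using borel_measurable_continuous_onI[OF c(1)] by (auto simp: measurable_completion)
  have "(\<integral>\<^sup>+x. ennreal \<bar>f x - c x\<bar> \<partial>lebesgue)
      \<le> (\<integral>\<^sup>+x. ennreal \<bar>f x - s i x\<bar> + ennreal \<bar>s i x - c x\<bar> \<partial>lebesgue)"
    by (intro nn_integral_mono) (simp flip: ennreal_plus)
  also have "\<dots> = (\<integral>\<^sup>+x. ennreal \<bar>f x - s i x\<bar> \<partial>lebesgue) + (\<integral>\<^sup>+x. ennreal \<bar>s i x - c x\<bar> \<partial>lebesgue)"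
    by (rule nn_integral_add) auto
  also have "\<dots> < ennreal (\<delta> / 2) + ennreal (\<delta> / 2)"
    by (rule add_strict_mono) (use c i in auto)
  also have "\<dots> = ennreal \<delta>"
    using \<open>0 < \<delta>\<close> by (simp flip: ennreal_plus)
  finally show ?case using c by auto
qed


definition lebesgue_point :: "('a::euclidean_space \<Rightarrow> real) \<Rightarrow> 'a \<Rightarrow> bool" where
  "lebesgue_point v x \<longleftrightarrow> (\<forall>\<eta>>0. \<exists>\<delta>>0. \<forall>r. 0 < r \<and> r < \<delta> \<longrightarrow>
     (\<integral>\<^sup>+y\<in>ball x r. ennreal \<bar>v y - v x\<bar> \<partial>lebesgue) \<le> ennreal \<eta> * emeasure lborel (ball x r))"

text \<open>The difference \<open>v y - v x\<close> is split through \<open>c y\<close> and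
  \<open>c x\<close>. The three parts cost \<eta>/3 each: the first on average because
  \<open>x\<close> is not in the heavy set, the second by continuity of \<open>c\<close>, the third
  by assumption.\<close>

lemma mean_oscillation_le:
  fixes v :: "'a::euclidean_space \<Rightarrow> real"
  assumes v [measurable]: "v \<in> borel_measurable lebesgue" and c: "continuous_on UNIV c"
    and x: "x \<notin> heavy (\<eta> / 3) (\<lambda>x. v x - c x)" "\<bar>v x - c x\<bar> \<le> \<eta> / 3" and \<eta>: "0 < \<eta>"
  shows "\<exists>\<delta>>0. \<forall>r. 0 < r \<and> r < \<delta> \<longrightarrow>
     (\<integral>\<^sup>+y\<in>ball x r. ennreal \<bar>v y - v x\<bar> \<partial>lebesgue) \<le> ennreal \<eta> * emeasure lborel (ball x r)"
proof -
  have [measurable]: "c \<in> borel_measurable lebesgue"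
    using borel_measurable_continuous_onI[OF c] by (auto simp: measurable_completion)
  obtain \<delta> where \<delta>: "0 < \<delta>" "\<And>y. dist y x < \<delta> \<Longrightarrow> dist (c y) (c x) < \<eta> / 3"
    using c \<eta> unfolding continuous_on_iff by (metis UNIV_I zero_less_divide_iff zero_less_numeral)
  have "(\<integral>\<^sup>+y\<in>ball x r. ennreal \<bar>v y - v x\<bar> \<partial>lebesgue) \<le> ennreal \<eta> * emeasure lborel (ball x r)"
    if r: "0 < r" "r < \<delta>" for r
  proof -
    have "(\<integral>\<^sup>+y\<in>ball x r. ennreal \<bar>v y - v x\<bar> \<partial>lebesgue)
        \<le> (\<integral>\<^sup>+y. ennreal \<bar>v y - c y\<bar> * indicator (ball x r) y + ennreal (2 * \<eta> / 3) * indicator (ball x r) y \<partial>lebesgue)"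
    proof (rule nn_integral_mono)
      fix y
      show "ennreal \<bar>v y - v x\<bar> * indicator (ball x r) y
        \<le> ennreal \<bar>v y - c y\<bar> * indicator (ball x r) y + ennreal (2 * \<eta> / 3) * indicator (ball x r) y"
      proof (cases "y \<in> ball x r")
        case True
        then have "\<bar>c y - c x\<bar> < \<eta> / 3"
          using \<delta>(2)[of y] r by (simp add: dist_norm norm_minus_commute)
        then have "\<bar>v y - v x\<bar> \<le> \<bar>v y - c y\<bar> + 2 * \<eta> / 3"
          using x(2) by linarith
        then have "ennreal \<bar>v y - v x\<bar> \<le> ennreal (\<bar>v y - c y\<bar> + 2 * \<eta> / 3)"
          by (rule ennreal_leI)
        then show ?thesis
          using True \<eta> by (simp add: ennreal_plus)
      qed simp
    qed
    also have "\<dots> = (\<integral>\<^sup>+y\<in>ball x r. ennreal \<bar>v y - c y\<bar> \<partial>lebesgue) + ennreal (2 * \<eta> / 3) * emeasure lborel (ball x r)"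
      by (subst nn_integral_add) (auto simp: nn_integral_cmult_indicator)
    also have "\<dots> \<le> ennreal (\<eta> / 3) * emeasure lborel (ball x r) + ennreal (2 * \<eta> / 3) * emeasure lborel (ball x r)"
      by (intro add_mono not_heavyD x r order_refl)
    also have "\<dots> = (ennreal (\<eta> / 3) + ennreal (2 * \<eta> / 3)) * emeasure lborel (ball x r)"
      by (simp add: distrib_right)
    also have "ennreal (\<eta> / 3) + ennreal (2 * \<eta> / 3) = ennreal \<eta>"
      using \<eta> by (simp flip: ennreal_plus)
    finally show ?thesis .
  qed
  then show ?thesis using \<delta>(1) by blast
qed

text \<open>Where the oscillation exceeds \<eta>, either the maximal function or the value of
  \<open>v - c\<close> is large. The weak type bound and Chebyshev's inequality make both sets small
  when \<open>c\<close> is close to \<open>v\<close> in \<open>L^1\<close>. Countably many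
  tolerances suffice.\<close>

lemma AE_lebesgue_point_integrable:
  fixes v :: "'a::euclidean_space \<Rightarrow> real"
  assumes v: "integrable lebesgue v"
  shows "AE x in lebesgue. lebesgue_point v x"
proof -
  have [measurable]: "v \<in> borel_measurable lebesgue"
    using v by (simp add: borel_measurable_integrable)
  define good where "good \<eta> x \<longleftrightarrow> (\<exists>\<delta>>0. \<forall>r. 0 < r \<and> r < \<delta> \<longrightarrow>
     (\<integral>\<^sup>+y\<in>ball x r. ennreal \<bar>v y - v x\<bar> \<partial>lebesgue) \<le> ennreal \<eta> * emeasure lborel (ball x r))" for \<eta> x
  have "negligible {x. \<not> good \<eta> x}" if \<eta>: "0 < \<eta>" for \<eta>
    unfolding negligible_outer_le
  proof (intro allI impI)
    fix e :: real assume e: "0 < e"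
    \<comment> \<open>The term \<open>5 ^ DIM('a)\<close> comes from the weak type bound and 1 from
      Chebyshev's inequality; \<epsilon> is then solved from
      \<open>K * \<epsilon> = (\<eta> / 3) * e\<close>.\<close>
    define K where "K = 5 ^ DIM('a) + (1::real)"
    have K: "0 < K" by (simp add: K_def add_pos_pos)
    define \<epsilon> where "\<epsilon> = e * (\<eta> / 3) / K"
    have \<epsilon>: "0 < \<epsilon>" using e \<eta> K by (simp add: \<epsilon>_def)
    obtain c where c: "continuous_on UNIV c" "(\<integral>\<^sup>+x. ennreal \<bar>v x - c x\<bar> \<partial>lebesgue) < ennreal \<epsilon>"
      using integrable_approx_continuous[OF v \<epsilon>] by blast
    have [measurable]: "c \<in> borel_measurable lebesgue"
      using borel_measurable_continuous_onI[OF c(1)] by (auto simp: measurable_completion)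
    let ?H = "heavy (\<eta> / 3) (\<lambda>x. v x - c x)" and ?M = "{x. \<eta> / 3 < \<bar>v x - c x\<bar>}"
    have "{x \<in> space lebesgue. \<eta> / 3 < \<bar>v x - c x\<bar>} \<in> sets lebesgue" by measurable
    then have M: "?M \<in> sets lebesgue" by simp
    have "ennreal (\<eta> / 3) * emeasure lebesgue ?M = (\<integral>\<^sup>+x. ennreal (\<eta> / 3) * indicator ?M x \<partial>lebesgue)"
      using M by (simp add: nn_integral_cmult_indicator)
    also have "\<dots> \<le> (\<integral>\<^sup>+x. ennreal \<bar>v x - c x\<bar> \<partial>lebesgue)"
      by (intro nn_integral_mono) (auto simp: indicator_def intro: ennreal_leI)
    finally have 1: "ennreal (\<eta> / 3) * emeasure lebesgue ?M \<le> ennreal \<epsilon>"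
      using c(2) by simp
    have "ennreal (\<eta> / 3) * emeasure lebesgue ?H \<le> ennreal (5 ^ DIM('a)) * ennreal \<epsilon>"
      using emeasure_heavy_le[of "\<lambda>x. v x - c x" "\<eta> / 3"] \<eta> c(2)
      by (auto elim!: order_trans intro!: mult_left_mono)
    then have "ennreal (\<eta> / 3) * (emeasure lebesgue ?H + emeasure lebesgue ?M)
        \<le> ennreal (5 ^ DIM('a)) * ennreal \<epsilon> + ennreal \<epsilon>"
      using 1 by (simp add: distrib_left add_mono)
    also have "\<dots> = ennreal (K * \<epsilon>)"
      using \<epsilon> by (simp add: K_def distrib_right ennreal_mult ennreal_plus)
    also have "K * \<epsilon> = (\<eta> / 3) * e"
      using K by (simp add: \<epsilon>_def)
    finally have "ennreal (\<eta> / 3) * (emeasure lebesgue ?H + emeasure lebesgue ?M) \<le> ennreal (\<eta> / 3) * ennreal e"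
      using \<eta> e by (simp only: ennreal_mult')
    then have le: "emeasure lebesgue ?H + emeasure lebesgue ?M \<le> ennreal e"
      using \<eta> by (subst (asm) ennreal_mult_le_mult_iff) auto
    have "emeasure lebesgue (?H \<union> ?M) \<le> ennreal e"
      using le M by (meson emeasure_subadditive heavy_sets order_trans)
    moreover have "{x. \<not> good \<eta> x} \<subseteq> ?H \<union> ?M"
    proof
      fix x assume "x \<in> {x. \<not> good \<eta> x}"
      moreover have "good \<eta> x" if "x \<notin> ?H" "\<bar>v x - c x\<bar> \<le> \<eta> / 3"
        unfolding good_def by (rule mean_oscillation_le[OF _ c(1) that \<eta>]) simp
      ultimately show "x \<in> ?H \<union> ?M" by force
    qed
    moreover have "?H \<union> ?M \<in> sets lebesgue" using M by auto
    ultimately show "\<exists>T. {x. \<not> good \<eta> x} \<subseteq> T \<and> T \<in> lmeasurable \<and> measure lebesgue T \<le> e"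
      using e by (intro exI[of _ "?H \<union> ?M"])
        (auto simp: fmeasurable_def measure_def enn2real_leI less_top[symmetric] top_unique intro: le_less_trans)
  qed
  then have "AE x in lebesgue. good (1 / real (Suc m)) x" for m
    by (intro AE_I'[of "{x. \<not> good (1 / real (Suc m)) x}"]) (auto simp: negligible_iff_null_sets)
  then have "AE x in lebesgue. \<forall>m. good (1 / real (Suc m)) x"
    by (simp add: AE_all_countable)
  then show ?thesis
  proof eventually_elim
    case (elim x)
    show ?case
      unfolding lebesgue_point_def
    proof (intro allI impI)
      fix \<eta> :: real assume "0 < \<eta>"
      then obtain m where m: "1 / real (Suc m) < \<eta>"
        using nat_approx_posE by blast
      obtain \<delta> where \<delta>: "0 < \<delta>" "\<And>r. 0 < r \<Longrightarrow> r < \<delta> \<Longrightarrow>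
        (\<integral>\<^sup>+y\<in>ball x r. ennreal \<bar>v y - v x\<bar> \<partial>lebesgue) \<le> ennreal (1 / real (Suc m)) * emeasure lborel (ball x r)"
        using elim[rule_format, of m] unfolding good_def by blast
      have "ennreal (1 / real (Suc m)) * emeasure lborel (ball x r) \<le> ennreal \<eta> * emeasure lborel (ball x r)" for r
        using m by (intro mult_right_mono ennreal_leI) auto
      then show "\<exists>\<delta>>0. \<forall>r. 0 < r \<and> r < \<delta> \<longrightarrow>
        (\<integral>\<^sup>+y\<in>ball x r. ennreal \<bar>v y - v x\<bar> \<partial>lebesgue) \<le> ennreal \<eta> * emeasure lborel (ball x r)"
        using \<delta> by (meson order_trans)
    qed
  qed
qed

text \<open>Only values near \<open>x\<close> matter, so \<open>v\<close> is cut off to a ball of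
  integer radius beyond \<open>norm x\<close>; balls around \<open>x\<close> inside it do not see
  the cut.\<close>

lemma AE_lebesgue_point:
  fixes v :: "'a::euclidean_space \<Rightarrow> real"
  assumes v: "\<And>R. set_integrable lebesgue (cball 0 R) v"
  shows "AE x in lebesgue. lebesgue_point v x"
proof -
  have "AE x in lebesgue. \<forall>m. lebesgue_point (\<lambda>x. indicator (cball 0 (real m)) x * v x) x"
    using v by (auto simp: AE_all_countable set_integrable_def intro!: AE_lebesgue_point_integrable)
  then show ?thesis
  proof eventually_elim
    case (elim x)
    obtain m where m: "norm x < real m" using reals_Archimedean2 by blast
    show ?case
      unfolding lebesgue_point_def
    proof (intro allI impI)
      fix \<eta> :: real assume \<eta>: "0 < \<eta>"
      define w where "w x = indicator (cball 0 (real m)) x * v x" for x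
      obtain \<delta> where \<delta>: "0 < \<delta>" "\<And>r. 0 < r \<Longrightarrow> r < \<delta> \<Longrightarrow>
        (\<integral>\<^sup>+y\<in>ball x r. ennreal \<bar>w y - w x\<bar> \<partial>lebesgue) \<le> ennreal \<eta> * emeasure lborel (ball x r)"
        using elim[rule_format, of m] \<eta> unfolding lebesgue_point_def w_def by blast
      have "(\<integral>\<^sup>+y\<in>ball x r. ennreal \<bar>v y - v x\<bar> \<partial>lebesgue) \<le> ennreal \<eta> * emeasure lborel (ball x r)"
        if r: "0 < r" "r < min \<delta> (real m - norm x)" for r
      proof -
        have "y \<in> cball 0 (real m)" if "y \<in> ball x r" for y
          using that r norm_triangle_ineq2[of y x] by (simp add: dist_norm norm_minus_commute)
        then have "(\<integral>\<^sup>+y\<in>ball x r. ennreal \<bar>v y - v x\<bar> \<partial>lebesgue) = (\<integral>\<^sup>+y\<in>ball x r. ennreal \<bar>w y - w x\<bar> \<partial>lebesgue)"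
          using m by (intro nn_integral_cong) (auto simp: indicator_def w_def)
        then show ?thesis using \<delta>(2)[of r] r by simp
      qed
      then show "\<exists>\<delta>>0. \<forall>r. 0 < r \<and> r < \<delta> \<longrightarrow>
        (\<integral>\<^sup>+y\<in>ball x r. ennreal \<bar>v y - v x\<bar> \<partial>lebesgue) \<le> ennreal \<eta> * emeasure lborel (ball x r)"
        using \<delta>(1) m by (intro exI[of _ "min \<delta> (real m - norm x)"]) auto
    qed
  qed
qed

section \<open>Mollified weak derivatives\<close>

lemma locally_integrable_cball: "locally_integrable v \<Longrightarrow> set_integrable lebesgue (cball a r) v"
  by (simp add: locally_integrable_def)

lemma locally_integrable_measurable:
  fixes v :: "real ^ 'n::finite \<Rightarrow> real"
  assumes "locally_integrable v" shows "v \<in> borel_measurable lebesgue"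
proof (rule borel_measurable_LIMSEQ_real)
  show "(\<lambda>x. indicator (cball 0 (real m)) x *\<^sub>R v x) \<in> borel_measurable lebesgue" for m
    using locally_integrable_cball[OF assms] by (auto simp: set_integrable_def intro: borel_measurable_integrable)
  fix x :: "real ^ 'n"
  obtain N where N: "norm x < real N" using reals_Archimedean2 by blast
  have "eventually (\<lambda>m. indicator (cball 0 (real m)) x *\<^sub>R v x = v x) sequentially"
    using eventually_ge_at_top[of N] by eventually_elim (use N in auto)
  then show "(\<lambda>m. indicator (cball 0 (real m)) x *\<^sub>R v x) \<longlonglongrightarrow> v x"
    by (rule tendsto_eventually)
qed

lemma integrable_mult_compact_support:
  fixes v :: "real ^ 'n::finite \<Rightarrow> real"
  assumes v: "locally_integrable v" and k: "k \<in> borel_measurable lebesgue"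
    and b: "\<And>z. \<bar>k z\<bar> \<le> L" "\<And>z. z \<notin> cball a r \<Longrightarrow> k z = 0"
  shows "integrable lebesgue (\<lambda>z. v z * k z)"
proof (rule Bochner_Integration.integrable_bound)
  show "integrable lebesgue (\<lambda>z. (indicator (cball a r) z *\<^sub>R v z) * L)"
    using locally_integrable_cball[OF v, of a r] by (auto simp: set_integrable_def)
  show "(\<lambda>z. v z * k z) \<in> borel_measurable lebesgue"
    using k locally_integrable_measurable[OF v] by measurable
  have "0 \<le> L" using b(1)[of a] by linarith
  show "AE z in lebesgue. norm (v z * k z) \<le> norm ((indicator (cball a r) z *\<^sub>R v z) * L)"
  proof (rule AE_I2)
    fix z
    show "norm (v z * k z) \<le> norm ((indicator (cball a r) z *\<^sub>R v z) * L)"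
    proof (cases "z \<in> cball a r")
      case True
      then show ?thesis using b(1)[of z] \<open>0 \<le> L\<close> by (auto simp: abs_mult intro!: mult_left_mono)
    qed (simp add: b(2))
  qed
qed

text \<open>Differentiation under the integral by dominated convergence: the mean value theorem
  bounds the difference quotients of the kernel by \<open>L\<close>, and the common support confines
  everything to a ball on which \<open>v\<close> is integrable.\<close>

lemma DERIV_integral_mult:
  fixes v :: "real ^ 'n::finite \<Rightarrow> real" and K :: "real \<Rightarrow> real ^ 'n \<Rightarrow> real"
  assumes v: "locally_integrable v" and t: "a < t" "t < b"
    and K: "\<And>s. a < s \<Longrightarrow> s < b \<Longrightarrow> K s \<in> borel_measurable lebesgue"
    and K': "K' t \<in> borel_measurable lebesgue"
    and D: "\<And>s z. a < s \<Longrightarrow> s < b \<Longrightarrow> ((\<lambda>s. K s z) has_real_derivative K' s z) (at s)"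
    and L: "\<And>s z. a < s \<Longrightarrow> s < b \<Longrightarrow> \<bar>K s z\<bar> \<le> L" "\<And>s z. a < s \<Longrightarrow> s < b \<Longrightarrow> \<bar>K' s z\<bar> \<le> L"
    and supp: "\<And>s z. a < s \<Longrightarrow> s < b \<Longrightarrow> z \<notin> cball x r \<Longrightarrow> K s z = 0"
  shows "((\<lambda>s. LINT z|lebesgue. v z * K s z) has_real_derivative (LINT z|lebesgue. v z * K' t z)) (at t)"
proof -
  note [measurable] = locally_integrable_measurable[OF v]
  have int: "integrable lebesgue (\<lambda>z. v z * K s z)" if "a < s" "s < b" for s
    by (rule integrable_mult_compact_support[OF v]) (use that K L supp in auto)
  have "((\<lambda>s. ((LINT z|lebesgue. v z * K s z) - (LINT z|lebesgue. v z * K t z)) / (s - t))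
      \<longlongrightarrow> (LINT z|lebesgue. v z * K' t z)) (at t within {a<..<b})"
    unfolding tendsto_at_iff_sequentially
  proof (intro allI impI)
    fix X :: "nat \<Rightarrow> real" assume X: "\<forall>i. X i \<in> {a<..<b} - {t}" "X \<longlonglongrightarrow> t"
    have "(\<lambda>i. LINT z|lebesgue. v z * ((K (X i) z - K t z) / (X i - t))) \<longlonglongrightarrow> (LINT z|lebesgue. v z * K' t z)"
    proof (rule integral_dominated_convergence[where w = "\<lambda>z. \<bar>indicator (cball x r) z *\<^sub>R v z\<bar> * L"])
      show "integrable lebesgue (\<lambda>z. \<bar>indicator (cball x r) z *\<^sub>R v z\<bar> * L)"
        using locally_integrable_cball[OF v, of x r] by (auto simp: set_integrable_def)
      show "(\<lambda>z. v z * K' t z) \<in> borel_measurable lebesgue" using K' by measurable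
      show "(\<lambda>z. v z * ((K (X i) z - K t z) / (X i - t))) \<in> borel_measurable lebesgue" for i
        using K[of "X i"] K[OF t] X(1) by auto
      show "AE z in lebesgue. (\<lambda>i. v z * ((K (X i) z - K t z) / (X i - t))) \<longlonglongrightarrow> v z * K' t z"
      proof (intro AE_I2 tendsto_mult_left)
        fix z
        have "((\<lambda>s. (K s z - K t z) / (s - t)) \<longlongrightarrow> K' t z) (at t within {a<..<b})"
          using D[OF t, of z] unfolding has_field_derivative_iff by (rule tendsto_within_subset) simp
        then show "(\<lambda>i. (K (X i) z - K t z) / (X i - t)) \<longlonglongrightarrow> K' t z"
          using X unfolding tendsto_at_iff_sequentially by (auto simp: o_def)
      qed
      show "AE z in lebesgue. norm (v z * ((K (X i) z - K t z) / (X i - t))) \<le> \<bar>indicator (cball x r) z *\<^sub>R v z\<bar> * L" for i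
      proof (rule AE_I2)
        fix z
        have Xi: "a < X i" "X i < b" "X i \<noteq> t" using X(1) by auto
        have "norm (K (X i) z - K t z) \<le> L * norm (X i - t)"
        proof (rule field_differentiable_bound[where S = "{a<..<b}" and f' = "\<lambda>s. K' s z"])
          show "((\<lambda>s. K s z) has_real_derivative K' s z) (at s within {a<..<b})" if "s \<in> {a<..<b}" for s
            using D[of s z] that by (auto intro: has_field_derivative_at_within)
        qed (use L(2) t Xi in auto)
        then have "\<bar>(K (X i) z - K t z) / (X i - t)\<bar> \<le> L"
          using Xi by (simp add: pos_divide_le_eq)
        then show "norm (v z * ((K (X i) z - K t z) / (X i - t))) \<le> \<bar>indicator (cball x r) z *\<^sub>R v z\<bar> * L"
          using supp[OF Xi(1,2), of z] supp[OF t, of z]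
          by (cases "z \<in> cball x r")
            (auto simp: abs_mult simp del: abs_divide times_divide_eq_right intro!: mult_left_mono)
      qed
    qed
    moreover have "(LINT z|lebesgue. v z * ((K (X i) z - K t z) / (X i - t)))
        = ((LINT z|lebesgue. v z * K (X i) z) - (LINT z|lebesgue. v z * K t z)) / (X i - t)" for i
    proof -
      have "integrable lebesgue (\<lambda>z. v z * K (X i) z)" using int X(1) by auto
      then have "(LINT z|lebesgue. v z * K (X i) z) - (LINT z|lebesgue. v z * K t z)
          = (LINT z|lebesgue. v z * K (X i) z - v z * K t z)"
        using int[OF t] by simp
      also have "\<dots> / (X i - t) = (LINT z|lebesgue. (v z * K (X i) z - v z * K t z) / (X i - t))"
        by simp
      finally show ?thesis by (simp only: right_diff_distrib times_divide_eq_right)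
    qed
    ultimately show "((\<lambda>s. ((LINT z|lebesgue. v z * K s z) - (LINT z|lebesgue. v z * K t z)) / (s - t)) \<circ> X)
        \<longlonglongrightarrow> (LINT z|lebesgue. v z * K' t z)"
      by (simp only: o_def)
  qed
  then show ?thesis
    unfolding has_field_derivative_iff using t by (simp add: at_within_open[of t "{a<..<b}"])
qed

section \<open>Mollification and its derivative in the scale\<close>

text \<open>The function has to vanish only where \<open>1 < norm y\<close>; as this set is open,
  the condition passes to partial derivatives.\<close>

definition bump_function :: "(real ^ 'n::finite \<Rightarrow> real) \<Rightarrow> bool" where
  "bump_function \<psi> \<longleftrightarrow> smooth \<psi> \<and> (\<forall>y. 1 < norm y \<longrightarrow> \<psi> y = 0)"

text \<open>This is \<psi>((z - x)/\<tau>)/\<tau>^n, with the argument written as a dilation plus a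
  constant to fit \<open>partials_affine\<close>.\<close>

definition mol_kernel :: "(real ^ 'n::finite \<Rightarrow> real) \<Rightarrow> real ^ 'n \<Rightarrow> real \<Rightarrow> real ^ 'n \<Rightarrow> real" where
  "mol_kernel \<psi> x \<tau> z = inverse \<tau> ^ CARD('n) * \<psi> (inverse \<tau> *\<^sub>R z + - (inverse \<tau> *\<^sub>R x))"

text \<open>The substitution z = x + \<tau> y shows this to be the integral of v(x + \<tau> y)
  \<psi>(y) over y, which explains the form of its derivatives in \<tau>.\<close>

definition mollify :: "(real ^ 'n::finite \<Rightarrow> real) \<Rightarrow> (real ^ 'n \<Rightarrow> real) \<Rightarrow> real ^ 'n \<Rightarrow> real \<Rightarrow> real" where
  "mollify v \<psi> x \<tau> = (LINT z|lebesgue. v z * mol_kernel \<psi> x \<tau> z)"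

lemma bump_function_partial_deriv:
  assumes "bump_function \<psi>" shows "bump_function (partial_deriv i \<psi>)"
  unfolding bump_function_def
proof (intro conjI allI impI)
  show "smooth (partial_deriv i \<psi>)"
    using assms by (simp add: bump_function_def smooth_partial_deriv)
  fix y :: "real ^ 'a" assume y: "1 < norm y"
  have "(\<psi> has_derivative (\<lambda>h. 0)) (at y)"
    by (rule has_derivative_transform_within_open[of "\<lambda>_. 0" _ _ _ "{y. 1 < norm y}"])
      (use y assms in \<open>auto simp: bump_function_def open_Collect_less continuous_on_norm_id\<close>)
  then show "partial_deriv i \<psi> y = 0"
    by (simp add: has_derivative_imp_partial_deriv)
qed

lemma bump_function_partials: "bump_function \<psi> \<Longrightarrow> bump_function (partials w \<psi>)"
  by (induction w) (auto intro: bump_function_partial_deriv)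

lemma bump_function_mult_coord: "bump_function \<psi> \<Longrightarrow> bump_function (\<lambda>y. y $ i * \<psi> y)"
  by (simp add: bump_function_def smooth_mult_coord)

lemma bump_function_bounded:
  assumes "bump_function \<psi>"
  obtains L where "0 < L" "\<And>y. \<bar>\<psi> y\<bar> \<le> L"
proof -
  have "compact (\<psi> ` cball 0 1)"
    using assms by (intro compact_continuous_image) (auto simp: bump_function_def smooth_continuous_on)
  then obtain L where L: "0 < L" "\<And>y. y \<in> cball 0 1 \<Longrightarrow> \<bar>\<psi> y\<bar> \<le> L"
    by (auto dest!: compact_imp_bounded simp: bounded_pos)
  have "\<bar>\<psi> y\<bar> \<le> L" for y
    using L assms by (cases "norm y \<le> 1") (auto simp: bump_function_def)
  then show ?thesis using L(1) that by blast
qed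

lemma mol_kernel_measurable: "bump_function \<psi> \<Longrightarrow> mol_kernel \<psi> x \<tau> \<in> borel_measurable lebesgue"
proof -
  assume "bump_function \<psi>"
  then have "continuous_on UNIV (mol_kernel \<psi> x \<tau>)"
    unfolding mol_kernel_def[abs_def] bump_function_def
    by (intro continuous_intros continuous_on_compose2[OF smooth_continuous_on[of \<psi> UNIV]]) auto
  from borel_measurable_continuous_onI[OF this] show ?thesis
    by (auto simp: measurable_completion)
qed

lemma mol_kernel_support:
  assumes "bump_function \<psi>" "0 < \<tau>" "z \<notin> cball x \<tau>"
  shows "mol_kernel \<psi> x \<tau> z = 0"
proof -
  have "norm (inverse \<tau> *\<^sub>R z + - (inverse \<tau> *\<^sub>R x)) = inverse \<tau> * norm (z - x)"
    using assms(2) by (simp flip: scaleR_diff_right)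
  also have "\<dots> > 1"
    using assms(2,3) by (simp add: dist_norm norm_minus_commute field_simps)
  finally show ?thesis
    using assms(1) by (simp add: mol_kernel_def bump_function_def)
qed

lemma mol_kernel_test_function:
  assumes "bump_function \<psi>" "0 < \<tau>"
  shows "test_function (mol_kernel \<psi> x \<tau>)"
\<comment> \<open>The kernel vanishes strictly outside the closed ball of radius \<tau>, whereas the
  rule wants a non-strict bound; radius \<open>2 * \<tau>\<close> provides it.\<close>
proof (rule smooth_imp_test_function[of _ "2 * \<tau>" x])
  show "smooth (mol_kernel \<psi> x \<tau>)"
    unfolding mol_kernel_def[abs_def] using assms by (intro smooth_affine) (simp add: bump_function_def)
  show "mol_kernel \<psi> x \<tau> z = 0" if "2 * \<tau> \<le> norm (z - x)" for z
    using that assms by (intro mol_kernel_support) (auto simp: dist_norm norm_minus_commute)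
qed

lemma partials_mol_kernel:
  assumes "bump_function \<psi>"
  shows "partials w (mol_kernel \<psi> x \<tau>) = (\<lambda>z. inverse \<tau> ^ length w * mol_kernel (partials w \<psi>) x \<tau> z)"
  using partials_affine[of \<psi> w "inverse \<tau> ^ CARD('a)" "inverse \<tau>" "- (inverse \<tau> *\<^sub>R x)"] assms
  by (simp add: mol_kernel_def[abs_def] bump_function_def mult_ac fun_eq_iff)

text \<open>The kernel itself serves as test function, and each derivative of it produces one factor
  1/\<tau>. This is how derivatives move between function and mollifier in both directions.\<close>

lemma mollify_weak_partial:
  assumes "has_weak_partial u w g" "bump_function \<psi>" "0 < \<tau>"
  shows "mollify g \<psi> x \<tau> = (-1) ^ length w * inverse \<tau> ^ length w * mollify u (partials w \<psi>) x \<tau>"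
proof -
  have "(LINT z|lebesgue. u z * partials w (mol_kernel \<psi> x \<tau>) z) = (-1) ^ length w * mollify g \<psi> x \<tau>"
    using assms mol_kernel_test_function unfolding has_weak_partial_def mollify_def by blast
  also have "(LINT z|lebesgue. u z * partials w (mol_kernel \<psi> x \<tau>) z) = inverse \<tau> ^ length w * mollify u (partials w \<psi>) x \<tau>"
    unfolding partials_mol_kernel[OF assms(2)] mollify_def integral_mult_right_zero[symmetric]
    by (rule Bochner_Integration.integral_cong) auto
  finally have "inverse \<tau> ^ length w * mollify u (partials w \<psi>) x \<tau> = (-1) ^ length w * mollify g \<psi> x \<tau>" .
  then have "(-1) ^ length w * (inverse \<tau> ^ length w * mollify u (partials w \<psi>) x \<tau>)
      = ((-1) ^ length w * (-1) ^ length w) * mollify g \<psi> x \<tau>"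
    by (simp only: mult.assoc)
  moreover have "(-1) ^ length w * (-1) ^ length w = (1::real)"
    by (simp flip: power_mult_distrib)
  ultimately show ?thesis
    by (simp only: mult.assoc mult_1)
qed

text \<open>The letter appended on the right is the derivative that hits the test function first,
  and the result is again a test function because supports do not grow. This links the
  representatives chosen separately for different words.\<close>

lemma has_weak_partial_snoc:
  assumes "has_weak_partial u w v" "has_weak_partial u (w @ [i]) g"
  shows "has_weak_partial v [i] g"
  unfolding has_weak_partial_def
proof (intro conjI allI impI)
  show "locally_integrable g" using assms(2) by (simp add: has_weak_partial_def)
  fix \<phi> :: "real ^ 'a \<Rightarrow> real" assume \<phi>: "test_function \<phi>"
  have "{x. partial_deriv i \<phi> x \<noteq> 0} \<subseteq> closure {x. \<phi> x \<noteq> 0}"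
  proof
    fix x assume "x \<in> {x. partial_deriv i \<phi> x \<noteq> 0}"
    then have x: "partial_deriv i \<phi> x \<noteq> 0" by simp
    show "x \<in> closure {x. \<phi> x \<noteq> 0}"
    proof (rule ccontr)
      assume "x \<notin> closure {x. \<phi> x \<noteq> 0}"
      moreover have "y \<in> closure {x. \<phi> x \<noteq> 0}" if "\<phi> y \<noteq> 0" for y
        using closure_subset[of "{x. \<phi> x \<noteq> 0}"] that by blast
      ultimately have "(\<phi> has_derivative (\<lambda>h. 0)) (at x)"
        by (intro has_derivative_transform_within_open[where f = "\<lambda>_. 0" and s = "- closure {x. \<phi> x \<noteq> 0}", OF has_derivative_const]) auto
      then show False using x by (simp add: has_derivative_imp_partial_deriv)
    qed
  qed
  moreover have "bounded (closure {x. \<phi> x \<noteq> 0})"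
    using \<phi> by (simp add: test_function_def bounded_closure)
  ultimately have "test_function (partial_deriv i \<phi>)"
    using \<phi> by (auto simp: test_function_def smooth_partial_deriv intro: bounded_subset)
  then have "(LINT x|lebesgue. u x * partials (w @ [i]) \<phi> x)
      = (-1) ^ length w * (LINT x|lebesgue. v x * partial_deriv i \<phi> x)"
    using assms(1) by (simp add: has_weak_partial_def partials_snoc)
  moreover have "(LINT x|lebesgue. u x * partials (w @ [i]) \<phi> x)
      = (-1) ^ length w * (- (LINT x|lebesgue. g x * \<phi> x))"
    using assms(2) \<phi> by (simp add: has_weak_partial_def)
  ultimately have "(-1) ^ length w * (LINT x|lebesgue. v x * partial_deriv i \<phi> x)
      = (-1) ^ length w * (- (LINT x|lebesgue. g x * \<phi> x))"
    by (rule trans[OF sym])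
  then show "(LINT x|lebesgue. v x * partials [i] \<phi> x) = (-1) ^ length [i] * (LINT x|lebesgue. g x * \<phi> x)"
    by (subst (asm) mult_cancel_left) simp
qed

text \<open>The scale derivative of the kernel is a divergence. In the sum of \<partial>_i (y_i
  \<psi>) the product rule yields n copies of \<psi>, matching the derivative of \<tau>^(-n), and
  the terms y_i \<partial>_i \<psi>, matching the derivative of the argument.\<close>

lemma DERIV_mol_kernel:
  fixes \<psi> :: "real ^ 'n::finite \<Rightarrow> real"
  assumes "bump_function \<psi>" "0 < \<tau>"
  shows "((\<lambda>\<tau>. mol_kernel \<psi> x \<tau> z) has_real_derivative
    - (\<Sum>i\<in>UNIV. inverse \<tau> * mol_kernel (partial_deriv i (\<lambda>y. y $ i * \<psi> y)) x \<tau> z)) (at \<tau>)"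
proof -
  define y where "y \<tau> = inverse \<tau> *\<^sub>R z + - (inverse \<tau> *\<^sub>R x)" for \<tau> :: real
  have sm: "smooth \<psi>" using assms by (simp add: bump_function_def)
  have dy: "(y has_derivative (\<lambda>h. h *\<^sub>R (- inverse \<tau> *\<^sub>R y \<tau>))) (at \<tau>)"
    unfolding y_def[abs_def] using assms(2)
    by (auto intro!: derivative_eq_intros simp: fun_eq_iff field_simps scaleR_diff_right)
  have "((\<lambda>\<tau>. \<psi> (y \<tau>)) has_derivative
      (\<lambda>h. \<Sum>i\<in>UNIV. (h *\<^sub>R (- inverse \<tau> *\<^sub>R y \<tau>)) $ i * partial_deriv i \<psi> (y \<tau>))) (at \<tau>)"
    by (rule has_derivative_compose[OF dy has_derivative_partials[OF smooth_differentiable[OF sm]]])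
  then have d\<psi>: "((\<lambda>\<tau>. \<psi> (y \<tau>)) has_real_derivative
      - inverse \<tau> * (\<Sum>i\<in>UNIV. y \<tau> $ i * partial_deriv i \<psi> (y \<tau>))) (at \<tau>)"
    unfolding has_field_derivative_def
    by (rule has_derivative_eq_rhs) (auto simp: fun_eq_iff sum_distrib_left sum_distrib_right sum_negf[symmetric] mult_ac)
  have dp: "((\<lambda>\<tau>. inverse \<tau> ^ CARD('n)) has_real_derivative
      - inverse \<tau> * (real CARD('n) * inverse \<tau> ^ CARD('n))) (at \<tau>)"
  proof -
    have "((\<lambda>\<tau>. inverse \<tau> ^ CARD('n)) has_real_derivative
      real CARD('n) * inverse \<tau> ^ (CARD('n) - 1) * - (inverse \<tau> * inverse \<tau>)) (at \<tau>)"
      using assms(2) by (auto intro!: derivative_eq_intros simp: power2_eq_square)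
    moreover have "inverse \<tau> ^ CARD('n) = inverse \<tau> ^ (CARD('n) - 1) * inverse \<tau>"
      by (metis One_nat_def Suc_pred power_Suc2 zero_less_card_finite)
    ultimately show ?thesis by (simp add: mult_ac)
  qed
  have pm: "partial_deriv i (\<lambda>y. y $ i * \<psi> y) y = \<psi> y + y $ i * partial_deriv i \<psi> y" for i y
  proof -
    have "(\<lambda>y::real^'n. y $ i) differentiable at y"
      using bounded_linear_imp_differentiable bounded_linear_vec_nth by blast
    then show ?thesis
      by (subst partial_deriv_mult[OF _ smooth_differentiable[OF sm]]) (auto simp: partial_deriv_nth)
  qed
  have k: "mol_kernel f x \<tau> z = inverse \<tau> ^ CARD('n) * f (y \<tau>)" for f \<tau>
    by (simp add: mol_kernel_def y_def)
  show ?thesis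
    unfolding k pm
    by (rule DERIV_cong[OF DERIV_mult[OF dp d\<psi>]])
      (simp add: sum.distrib sum_distrib_left distrib_left sum_negf mult_ac)
qed

text \<open>Since the scale derivative of the kernel is a divergence, it can be moved onto
  \<open>v\<close> by the definition of the weak derivative, and the factor 1/\<tau> cancels. Hence
  the rule can be iterated without negative powers of \<tau>.\<close>

lemma DERIV_mollify:
  fixes \<psi> :: "real ^ 'n::finite \<Rightarrow> real"
  assumes \<psi>: "bump_function \<psi>" and v: "locally_integrable v" and \<tau>: "0 < \<tau>"
    and g: "\<And>i. has_weak_partial v [i] (g i)"
  shows "((\<lambda>\<tau>. mollify v \<psi> x \<tau>) has_real_derivative
    (\<Sum>i\<in>UNIV. mollify (g i) (\<lambda>y. y $ i * \<psi> y) x \<tau>)) (at \<tau>)"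
proof -
  define \<psi>' where "\<psi>' i = (\<lambda>y. y $ i * \<psi> y)" for i
  have \<psi>': "bump_function (\<psi>' i)" for i
    unfolding \<psi>'_def by (rule bump_function_mult_coord[OF \<psi>])
  have d\<psi>': "bump_function (partial_deriv i (\<psi>' i))" for i
    by (rule bump_function_partial_deriv[OF \<psi>'])
  define K' where "K' s z = - (\<Sum>i\<in>UNIV. inverse s * mol_kernel (partial_deriv i (\<psi>' i)) x s z)" for s z
  obtain L0 where L0: "0 < L0" "\<And>y. \<bar>\<psi> y\<bar> \<le> L0" using bump_function_bounded[OF \<psi>] by blast
  have "\<exists>L. 0 < L \<and> (\<forall>y. \<bar>partial_deriv i (\<psi>' i) y\<bar> \<le> L)" for i
    using bump_function_bounded[OF d\<psi>'] by metis
  then obtain L1 where L1: "\<And>i. 0 < L1 i" "\<And>i y. \<bar>partial_deriv i (\<psi>' i) y\<bar> \<le> L1 i" by metis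
  \<comment> \<open>Staying above half the scale bounds the kernels and their scale derivatives
    uniformly near \<tau>.\<close>
  define a where "a = \<tau> / 2"
  have a: "0 < a" "a < \<tau>" using \<tau> by (auto simp: a_def)
  have pw: "\<bar>inverse s ^ m\<bar> \<le> inverse a ^ m" if "a < s" for s m
    using that a by (simp add: power_mono le_imp_inverse_le)
  have kb: "\<bar>mol_kernel f x s z\<bar> \<le> inverse a ^ CARD('n) * L" if "a < s" "\<And>y. \<bar>f y\<bar> \<le> L" for f s z L
    unfolding mol_kernel_def abs_mult using that pw a by (intro mult_mono) auto
  define L where "L = inverse a ^ CARD('n) * L0 + (\<Sum>i\<in>UNIV. inverse a * (inverse a ^ CARD('n) * L1 i))"
  have Lpos: "0 \<le> inverse a ^ CARD('n) * L0" "0 \<le> (\<Sum>i\<in>UNIV. inverse a * (inverse a ^ CARD('n) * L1 i))"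
    using a L0 L1 by (auto intro!: sum_nonneg mult_nonneg_nonneg simp: less_imp_le)
  have "((\<lambda>s. LINT z|lebesgue. v z * mol_kernel \<psi> x s z) has_real_derivative (LINT z|lebesgue. v z * K' \<tau> z)) (at \<tau>)"
  proof (rule DERIV_integral_mult[OF v, where a = a and b = "\<tau> + 1" and L = L and x = x and r = "\<tau> + 1"])
    show "mol_kernel \<psi> x s \<in> borel_measurable lebesgue" for s by (rule mol_kernel_measurable[OF \<psi>])
    show "K' \<tau> \<in> borel_measurable lebesgue"
      unfolding K'_def[abs_def]
      by (intro borel_measurable_uminus borel_measurable_sum borel_measurable_times borel_measurable_const mol_kernel_measurable d\<psi>')
    show "((\<lambda>s. mol_kernel \<psi> x s z) has_real_derivative K' s z) (at s)" if "a < s" for s z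
      using DERIV_mol_kernel[OF \<psi>, of s x z] that a by (simp add: K'_def \<psi>'_def)
    show "\<bar>mol_kernel \<psi> x s z\<bar> \<le> L" if "a < s" for s z
      using kb[OF that, of \<psi> L0 z] L0 Lpos by (simp add: L_def)
    show "\<bar>K' s z\<bar> \<le> L" if "a < s" for s z
    proof -
      have "\<bar>K' s z\<bar> \<le> (\<Sum>i\<in>UNIV. \<bar>inverse s * mol_kernel (partial_deriv i (\<psi>' i)) x s z\<bar>)"
        unfolding K'_def abs_minus_cancel by (rule sum_abs)
      also have "\<dots> \<le> (\<Sum>i\<in>UNIV. inverse a * (inverse a ^ CARD('n) * L1 i))"
        unfolding abs_mult using kb[OF that] pw[OF that, of 1] a L1 by (intro sum_mono mult_mono) auto
      finally show ?thesis using Lpos by (simp add: L_def)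
    qed
    show "mol_kernel \<psi> x s z = 0" if "a < s" "s < \<tau> + 1" "z \<notin> cball x (\<tau> + 1)" for s z
      using that a by (intro mol_kernel_support[OF \<psi>]) auto
  qed (use a in auto)
  also have "(LINT z|lebesgue. v z * K' \<tau> z) = (\<Sum>i\<in>UNIV. mollify (g i) (\<psi>' i) x \<tau>)"
  proof -
    have "integrable lebesgue (\<lambda>z. v z * mol_kernel (partial_deriv i (\<psi>' i)) x \<tau> z)" for i
      by (rule integrable_mult_compact_support[OF v mol_kernel_measurable[OF d\<psi>'] kb[OF _ L1(2)] mol_kernel_support[OF d\<psi>']])
        (use a \<tau> in auto)
    then have "(LINT z|lebesgue. v z * K' \<tau> z)
        = - (\<Sum>i\<in>UNIV. inverse \<tau> * mollify v (partial_deriv i (\<psi>' i)) x \<tau>)"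
      by (simp add: K'_def mollify_def sum_distrib_left mult.left_commute)
    also have "\<dots> = (\<Sum>i\<in>UNIV. mollify (g i) (\<psi>' i) x \<tau>)"
      using mollify_weak_partial[OF g \<psi>' \<tau>] by (simp add: sum_negf)
    finally show ?thesis .
  qed
  finally show ?thesis by (simp add: mollify_def \<psi>'_def)
qed

text \<open>The kernel is at most \<open>c\<close> times \<tau>^(-n) and lives on the closed ball of
  radius \<tau>. The doubled open ball contains it, and the ratio of volumes gives the factor
  \<open>2 ^ CARD('n)\<close>.\<close>

lemma abs_mollify_le:
  fixes \<psi> :: "real ^ 'n::finite \<Rightarrow> real"
  assumes \<psi>: "bump_function \<psi>" "\<And>y. \<bar>\<psi> y\<bar> \<le> c" and \<tau>: "0 < \<tau>" and B: "0 \<le> B"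
    and vm: "v \<in> borel_measurable lebesgue"
    and v: "(\<integral>\<^sup>+z\<in>ball x (2 * \<tau>). ennreal \<bar>v z\<bar> \<partial>lebesgue) \<le> ennreal B * emeasure lborel (ball x (2 * \<tau>))"
  shows "\<bar>mollify v \<psi> x \<tau>\<bar> \<le> 2 ^ CARD('n) * measure lborel (ball (0::real^'n) 1) * c * B"
proof -
  have c: "0 \<le> c" using \<psi>(2)[of 0] by linarith
  let ?vol = "measure lborel (ball (0::real^'n) 1)"
  have "ennreal \<bar>mollify v \<psi> x \<tau>\<bar> \<le> (\<integral>\<^sup>+z. ennreal (norm (v z * mol_kernel \<psi> x \<tau> z)) \<partial>lebesgue)"
  proof (cases "integrable lebesgue (\<lambda>z. v z * mol_kernel \<psi> x \<tau> z)")
    case True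
    from integral_norm_bound_ennreal[OF this] show ?thesis by (simp add: mollify_def)
  qed (simp add: mollify_def not_integrable_integral_eq)
  also have "\<dots> \<le> (\<integral>\<^sup>+z. ennreal (inverse \<tau> ^ CARD('n) * c) * (ennreal \<bar>v z\<bar> * indicator (ball x (2 * \<tau>)) z) \<partial>lebesgue)"
  proof (rule nn_integral_mono)
    fix z
    show "ennreal (norm (v z * mol_kernel \<psi> x \<tau> z))
      \<le> ennreal (inverse \<tau> ^ CARD('n) * c) * (ennreal \<bar>v z\<bar> * indicator (ball x (2 * \<tau>)) z)"
    proof (cases "z \<in> ball x (2 * \<tau>)")
      case True
      have "\<bar>mol_kernel \<psi> x \<tau> z\<bar> \<le> inverse \<tau> ^ CARD('n) * c"
        unfolding mol_kernel_def abs_mult using \<tau> \<psi>(2) by (intro mult_mono) auto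
      then have "norm (v z * mol_kernel \<psi> x \<tau> z) \<le> inverse \<tau> ^ CARD('n) * c * \<bar>v z\<bar>"
        by (simp add: abs_mult mult.commute mult_left_mono)
      then show ?thesis
        using True c \<tau> by (simp add: ennreal_leI flip: ennreal_mult)
    next
      case False
      then have "mol_kernel \<psi> x \<tau> z = 0" using \<tau> by (intro mol_kernel_support[OF \<psi>(1)]) auto
      then show ?thesis by simp
    qed
  qed
  also have "\<dots> = ennreal (inverse \<tau> ^ CARD('n) * c) * (\<integral>\<^sup>+z\<in>ball x (2 * \<tau>). ennreal \<bar>v z\<bar> \<partial>lebesgue)"
    using vm by (intro nn_integral_cmult) auto
  also have "\<dots> \<le> ennreal (inverse \<tau> ^ CARD('n) * c) * (ennreal B * emeasure lborel (ball x (2 * \<tau>)))"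
    using v by (rule mult_left_mono) simp
  also have "\<dots> = ennreal (inverse \<tau> ^ CARD('n) * c * (B * ((2 * \<tau>) ^ CARD('n) * ?vol)))"
    using \<tau> c B by (simp add: emeasure_lborel_ball ennreal_mult)
  also have "inverse \<tau> ^ CARD('n) * c * (B * ((2 * \<tau>) ^ CARD('n) * ?vol)) = 2 ^ CARD('n) * ?vol * c * B"
    using \<tau> by (simp add: power_mult_distrib field_simps)
  finally show ?thesis
    using c B by (simp add: mult_nonneg_nonneg)
qed

section \<open>Forward differences\<close>

text \<open>An \<open>m\<close>-fold application of the mean value theorem. The functions
  \<open>F i\<close> are the successive derivatives of \<open>F 0\<close>.\<close>

lemma abs_forward_differences_le:
  fixes F :: "nat \<Rightarrow> real \<Rightarrow> real"
  assumes "\<And>i t. i < m \<Longrightarrow> 0 < t \<Longrightarrow> (F i has_real_derivative F (Suc i) t) (at t)"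
    and "\<And>t. 0 < t \<Longrightarrow> \<bar>F m t\<bar> \<le> A" and "0 < \<rho>" and "0 < t"
  shows "\<bar>((\<lambda>f t. f (t + \<rho>) - f t) ^^ m) (F 0) t\<bar> \<le> \<rho> ^ m * A"
  using assms(1,2,4)
proof (induction m arbitrary: F A t)
  case (Suc m)
  \<comment> \<open>Differencing the whole chain gives again a chain of derivatives, one step
    shorter, whose last member is bounded by \<rho> A.\<close>
  let ?G = "\<lambda>i t. F i (t + \<rho>) - F i t"
  have "\<bar>((\<lambda>f t. f (t + \<rho>) - f t) ^^ m) (?G 0) t\<bar> \<le> \<rho> ^ m * (\<rho> * A)"
  proof (rule Suc.IH)
    fix i and t :: real assume i: "i < m" and t: "0 < t"
    have "((\<lambda>t. F i (t + \<rho>)) has_real_derivative F (Suc i) (t + \<rho>) * 1) (at t)"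
      by (rule DERIV_chain2[where g = "\<lambda>t. t + \<rho>"])
        (use Suc.prems(1)[of i "t + \<rho>"] i t assms(3) in \<open>auto intro!: derivative_eq_intros\<close>)
    moreover have "(F i has_real_derivative F (Suc i) t) (at t)"
      using Suc.prems(1)[of i t] i t by simp
    ultimately show "(?G i has_real_derivative ?G (Suc i) t) (at t)"
      by (auto intro: DERIV_diff)
  next
    fix t :: real assume t: "0 < t"
    have "norm (F m (t + \<rho>) - F m t) \<le> A * norm (t + \<rho> - t)"
      by (rule field_differentiable_bound[where S = "{0<..}" and f' = "F (Suc m)"])
        (use Suc.prems(1)[of m] Suc.prems(2) t assms(3) in \<open>auto intro: has_field_derivative_at_within\<close>)
    then show "\<bar>?G m t\<bar> \<le> \<rho> * A" using assms(3) by (simp add: mult.commute)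
  qed (use Suc.prems in auto)
  then show ?case by (simp add: funpow_Suc_right mult_ac del: funpow.simps)
qed simp

text \<open>The \<open>m\<close>-th difference at \<open>t\<close> is, up to sign,
  \<open>f t\<close> plus values at \<open>t + \<rho>\<close> or later. Inductively, passing from
  order \<open>m\<close> to \<open>m + 1\<close> adds the \<open>m\<close>-th difference at
  \<open>t + \<rho>\<close>, which costs \<open>2 ^ m * S\<close> and doubles the constant.\<close>

lemma abs_le_forward_differences:
  fixes f :: "real \<Rightarrow> real"
  assumes "0 < \<rho>" "\<And>s. t + \<rho> \<le> s \<Longrightarrow> \<bar>f s\<bar> \<le> S"
  shows "\<bar>f t\<bar> \<le> \<bar>((\<lambda>f t. f (t + \<rho>) - f t) ^^ m) f t\<bar> + 2 ^ m * S"
proof -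
  let ?D = "\<lambda>(f :: real \<Rightarrow> real) t. f (t + \<rho>) - f t"
  have far: "\<bar>(?D ^^ m) f s\<bar> \<le> 2 ^ m * S" if "t + \<rho> \<le> s" for m s
    using that
  proof (induction m arbitrary: s)
    case 0
    then show ?case using assms(2) by simp
  next
    case (Suc m)
    then have "\<bar>(?D ^^ m) f (s + \<rho>)\<bar> \<le> 2 ^ m * S" "\<bar>(?D ^^ m) f s\<bar> \<le> 2 ^ m * S"
      using assms(1) by auto
    then show ?case by simp
  qed
  have "0 \<le> S" using assms(2)[of "t + \<rho>"] by auto
  show ?thesis
  proof (induction m)
    case 0
    then show ?case using \<open>0 \<le> S\<close> by simp
  next
    case (Suc m)
    moreover have "\<bar>(?D ^^ m) f (t + \<rho>)\<bar> \<le> 2 ^ m * S" by (rule far) simp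
    ultimately show ?case by simp
  qed
qed

section \<open>Pointwise interpolation of derivatives\<close>

lemma has_weak_partial_weak_partial:
  assumes "weakly_differentiable k u" "length w \<le> k"
  shows "has_weak_partial u w (weak_partial w u)"
  using assms unfolding weakly_differentiable_def weak_partial_def by (metis someI_ex)

lemma finite_words: "finite {w :: 'n::finite list. length w = i}"
  using finite_lists_length_eq[of "UNIV :: 'n set" i] by simp

lemma card_words: "card {w :: 'n::finite list. length w = i} = CARD('n) ^ i"
  using card_lists_length_eq[of "UNIV :: 'n set" i] by simp

lemma words_Suc:
  "bij_betw (\<lambda>(w, i). w @ [i]) ({w. length w = m} \<times> UNIV) {w. length w = Suc m}"
  unfolding bij_betw_def
proof
  show "inj_on (\<lambda>(w, i). w @ [i]) ({w. length w = m} \<times> UNIV)"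
    by (auto simp: inj_on_def)
  show "(\<lambda>(w, i). w @ [i]) ` ({w. length w = m} \<times> UNIV) = {w. length w = Suc m}"
    by (force simp: image_iff length_Suc_conv_rev)
qed

text \<open>The product of \<psi> with the monomial of the word, which accumulates when the scale is
  differentiated repeatedly. With \<open>fold\<close>, an appended letter is multiplied last, in
  step with \<open>has_weak_partial_snoc\<close> and \<open>words_Suc\<close>.\<close>

definition monomial_mult :: "'n list \<Rightarrow> (real ^ 'n::finite \<Rightarrow> real) \<Rightarrow> real ^ 'n \<Rightarrow> real" where
  "monomial_mult w \<psi> = fold (\<lambda>i f y. y $ i * f y) w \<psi>"

lemma monomial_mult_Nil [simp]: "monomial_mult [] \<psi> = \<psi>"
  and monomial_mult_snoc: "monomial_mult (w @ [i]) \<psi> = (\<lambda>y. y $ i * monomial_mult w \<psi> y)"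
  by (simp_all add: monomial_mult_def)

lemma bump_function_monomial_mult: "bump_function \<psi> \<Longrightarrow> bump_function (monomial_mult w \<psi>)"
  by (induction w rule: rev_induct) (auto simp: monomial_mult_snoc intro: bump_function_mult_coord)

text \<open>On the unit ball every coordinate is at most 1 in absolute value, and outside it the
  product vanishes. So the bound is the same for all words.\<close>

lemma abs_monomial_mult_le:
  assumes "bump_function \<psi>" "\<And>y. \<bar>\<psi> y\<bar> \<le> c"
  shows "\<bar>monomial_mult w \<psi> y\<bar> \<le> c"
proof (cases "norm y \<le> 1")
  case True
  show ?thesis
  proof (induction w rule: rev_induct)
    case (snoc i w)
    have "\<bar>y $ i\<bar> * \<bar>monomial_mult w \<psi> y\<bar> \<le> 1 * c"
      using snoc True component_le_norm_cart[of y i] by (intro mult_mono) auto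
    then show ?case by (simp add: monomial_mult_snoc abs_mult)
  qed (simp add: assms)
next
  case False
  then have "monomial_mult w \<psi> y = 0"
    using bump_function_monomial_mult[OF assms(1)] by (simp add: bump_function_def)
  then show ?thesis using assms(2)[of y] by simp
qed

lemma abs_weak_partial_le: "length w = j \<Longrightarrow> \<bar>weak_partial w u x\<bar> \<le> weak_grad_norm j u x"
  using member_le_L2_set[OF finite_words, of w j "\<lambda>w. \<bar>weak_partial w u x\<bar>"]
  by (simp add: weak_grad_norm_def L2_set_def)

lemma locally_integrable_one: "locally_integrable (\<lambda>_. 1)"
  unfolding locally_integrable_def set_integrable_def
proof (intro allI impI)
  fix K :: "(real ^ 'n) set" assume "compact K"
  then have "K \<in> lmeasurable" by (rule lmeasurable_compact)
  then show "integrable lebesgue (\<lambda>x. indicat_real K x *\<^sub>R (1::real))"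
    by (simp add: lmeasurable_iff_integrable)
qed

lemma bump_function_bump: "bump_function (bump 1)"
  by (simp add: bump_function_def smooth_bump bump_eq_0)

text \<open>On the ball of half the radius, 1/(1 - |y|^2) is at most 2, so the bump is at least
  \<open>exp (- 2)\<close> there. This lower bound for the mass, free of \<tau> and
  \<open>x\<close>, stands in for normalisation.\<close>

lemma mollify_bump_ge:
  fixes x :: "real ^ 'n::finite"
  assumes "0 < \<tau>"
  shows "exp (- 2) * (1 / 2) ^ CARD('n) * measure lborel (ball (0::real^'n) 1) \<le> mollify (\<lambda>_. 1) (bump 1) x \<tau>"
proof -
  obtain L where L: "\<And>y. \<bar>bump 1 (y::real^'n)\<bar> \<le> L"
    using bump_function_bounded[OF bump_function_bump] by blast
  have int: "integrable lebesgue (\<lambda>z. 1 * mol_kernel (bump 1) x \<tau> z)"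
  proof (rule integrable_mult_compact_support)
    show "locally_integrable (\<lambda>_::real^'n. 1::real)"
      by (rule locally_integrable_one)
    show "mol_kernel (bump 1) x \<tau> z = 0" if "z \<notin> cball x \<tau>" for z
      using that by (rule mol_kernel_support[OF bump_function_bump assms])
    show "\<bar>mol_kernel (bump 1) x \<tau> z\<bar> \<le> inverse \<tau> ^ CARD('n) * L" for z
      unfolding mol_kernel_def abs_mult using L assms by (intro mult_mono) auto
  qed (rule mol_kernel_measurable[OF bump_function_bump])
  have ball: "measure lebesgue (ball x (\<tau> / 2)) = (\<tau> / 2) ^ CARD('n) * measure lborel (ball (0::real^'n) 1)"
    using content_ball_conv_unit_ball[of "\<tau> / 2" x] assms by simp
  have lower: "exp (- 2) \<le> bump 1 y" if "norm y < 1 / 2" for y :: "real ^ 'n"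
  proof -
    have "(norm y)\<^sup>2 \<le> (1 / 2)\<^sup>2" using that by (intro power_mono) auto
    then have s: "(\<Sum>i\<in>UNIV. y $ i * y $ i) \<le> 1 / 2"
      by (simp add: norm_vec_def L2_set_def power2_eq_square sum_nonneg)
    then have "1 / (1 - (\<Sum>i\<in>UNIV. y $ i * y $ i)) \<le> 2"
      by (simp add: pos_divide_le_eq)
    then show ?thesis using s by (simp add: bump_def flat_def)
  qed
  have "exp (- 2) * (1 / 2) ^ CARD('n) * measure lborel (ball (0::real^'n) 1)
      = (LINT z|lebesgue. inverse \<tau> ^ CARD('n) * exp (- 2) * indicator (ball x (\<tau> / 2)) z)"
    using assms ball by (simp add: field_simps power_mult_distrib power_divide)
  also have "\<dots> \<le> (LINT z|lebesgue. 1 * mol_kernel (bump 1) x \<tau> z)"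
  proof (rule integral_mono[OF _ int])
    show "integrable lebesgue (\<lambda>z. inverse \<tau> ^ CARD('n) * exp (- 2) * indicat_real (ball x (\<tau> / 2)) z)"
      by (intro integrable_mult_right integrable_real_indicator) (auto simp: emeasure_lborel_ball_finite simp flip: infinity_ennreal_def)
    fix z
    show "inverse \<tau> ^ CARD('n) * exp (- 2) * indicat_real (ball x (\<tau> / 2)) z \<le> 1 * mol_kernel (bump 1) x \<tau> z"
    proof (cases "z \<in> ball x (\<tau> / 2)")
      case True
      have "norm (inverse \<tau> *\<^sub>R z + - (inverse \<tau> *\<^sub>R x)) = inverse \<tau> * norm (z - x)"
        using assms by (simp flip: scaleR_diff_right)
      also have "\<dots> < 1 / 2"
        using True assms by (simp add: dist_norm norm_minus_commute field_simps)
      finally show ?thesis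
        using True lower assms by (simp add: mol_kernel_def)
    qed (use assms in \<open>simp add: mol_kernel_def bump_1_nonneg\<close>)
  qed
  finally show ?thesis by (simp add: mollify_def)
qed

text \<open>The two conditions on \<open>heavy\<close> say that \<alpha> and \<beta> dominate the
  maximal functions of the top gradient and of \<open>u\<close> at \<open>x\<close>. The constant is
  chosen before \<open>u\<close>, \<open>x\<close> and the levels.\<close>

lemma weak_partial_pointwise_le:
  fixes j k :: nat
  assumes "j < k"
  shows "\<exists>C>0. \<forall>(u :: real ^ 'n::finite \<Rightarrow> real) w x \<alpha> \<beta> \<rho>. weakly_differentiable k u \<longrightarrow> length w = j \<longrightarrow>
    lebesgue_point (weak_partial w u) x \<longrightarrow> 0 < \<alpha> \<longrightarrow> 0 < \<beta> \<longrightarrow> 0 < \<rho> \<longrightarrow>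
    x \<notin> heavy \<alpha> (weak_grad_norm k u) \<longrightarrow> x \<notin> heavy \<beta> u \<longrightarrow>
    \<bar>weak_partial w u x\<bar> \<le> C * (\<rho> ^ (k - j) * \<alpha> + \<beta> / \<rho> ^ j)"
proof -
  define \<psi> where "\<psi> = (bump 1 :: real ^ 'n \<Rightarrow> real)"
  have \<psi>: "bump_function \<psi>" unfolding \<psi>_def by (rule bump_function_bump)
  obtain c where c: "0 < c" "\<And>y. \<bar>\<psi> y\<bar> \<le> c" using bump_function_bounded[OF \<psi>] by blast
  have "\<exists>L>0. \<forall>y. \<bar>partials w \<psi> y\<bar> \<le> L" for w
    using bump_function_bounded[OF bump_function_partials[OF \<psi>]] by metis
  then obtain L where L: "\<And>w. 0 < L w" "\<And>w y. \<bar>partials w \<psi> y\<bar> \<le> L w" by metis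
  \<comment> \<open>Summing over all words of length \<open>j\<close> makes the constant independent
    of the word.\<close>
  define cj where "cj = (\<Sum>w\<in>{w. length w = j}. L w)"
  have cj: "0 \<le> cj" "L w \<le> cj" if "length w = j" for w
    unfolding cj_def using that L(1)
    by (auto intro!: sum_nonneg member_le_sum finite_words simp: less_imp_le)
  have cj0: "0 \<le> cj" unfolding cj_def using L(1) by (auto intro!: sum_nonneg simp: less_imp_le)
  define vol where "vol = measure lborel (ball (0::real^'n) 1)"
  have vol: "0 < vol" unfolding vol_def by (rule content_ball_pos) simp
  define V where "V = 2 ^ CARD('n) * vol"
  have V: "0 < V" using vol by (simp add: V_def)
  define c0 where "c0 = exp (- 2) * (1 / 2) ^ CARD('n) * vol"
  have c0: "0 < c0" using vol by (simp add: c0_def)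
  define m where "m = k - j"
  define N where "N = real (CARD('n) ^ m)"
  define C where "C = (N * (V * c) + 2 ^ m * (V * cj)) / c0"
  have Np: "0 < N" by (simp add: N_def)
  have C: "0 < C"
    unfolding C_def using Np V c cj0 c0 by (intro divide_pos_pos add_pos_nonneg) auto
  have "\<bar>weak_partial w u x\<bar> \<le> C * (\<rho> ^ m * \<alpha> + \<beta> / \<rho> ^ j)"
    if u: "weakly_differentiable k u" and w: "length w = j" and x: "lebesgue_point (weak_partial w u) x"
      and pos: "0 < \<alpha>" "0 < \<beta>" "0 < \<rho>"
      and heavy: "x \<notin> heavy \<alpha> (weak_grad_norm k u)" "x \<notin> heavy \<beta> u"
    for u :: "real ^ 'n \<Rightarrow> real" and w x \<alpha> \<beta> \<rho>
  proof -
    define v where "v w = weak_partial w u" for w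
    have v: "has_weak_partial u w (v w)" if "length w \<le> k" for w
      unfolding v_def using u that by (rule has_weak_partial_weak_partial)
    have vloc: "locally_integrable (v w)" if "length w \<le> k" for w
      using v[OF that] by (simp add: has_weak_partial_def)
    note vm = locally_integrable_measurable[OF vloc]
    have um: "u \<in> borel_measurable lebesgue"
      using u by (intro locally_integrable_measurable) (simp add: weakly_differentiable_def)
    \<comment> \<open>This is the \<open>i\<close>-th derivative in \<tau> of the mollified
      derivative along \<open>w\<close>: each differentiation appends a letter to the word and a
      coordinate to the mollifier.\<close>
    define F where "F i \<tau> = (\<Sum>w'\<in>{w'. length w' = i}. mollify (v (w @ w')) (monomial_mult w' \<psi>) x \<tau>)" for i \<tau>
    have F0: "F 0 \<tau> = mollify (v w) \<psi> x \<tau>" for \<tau>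
      by (simp add: F_def)
    have deriv: "(F i has_real_derivative F (Suc i) \<tau>) (at \<tau>)" if i: "i < m" and \<tau>: "0 < \<tau>" for i \<tau>
    proof -
      have "(F i has_real_derivative (\<Sum>w'\<in>{w'. length w' = i}. \<Sum>l\<in>UNIV.
          mollify (v ((w @ w') @ [l])) (\<lambda>y. y $ l * monomial_mult w' \<psi> y) x \<tau>)) (at \<tau>)"
        unfolding F_def
        using i w \<tau> \<psi> by (intro DERIV_sum DERIV_mollify bump_function_monomial_mult vloc has_weak_partial_snoc[OF v v])
            (auto simp: m_def)
      also have "(\<Sum>w'\<in>{w'. length w' = i}. \<Sum>l\<in>UNIV.
          mollify (v ((w @ w') @ [l])) (\<lambda>y. y $ l * monomial_mult w' \<psi> y) x \<tau>) = F (Suc i) \<tau>"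
        unfolding F_def sum.reindex_bij_betw[OF words_Suc, symmetric]
        by (simp add: sum.cartesian_product monomial_mult_snoc split_beta)
      finally show ?thesis .
    qed
    \<comment> \<open>At order \<open>m = k - j\<close> every word has length \<open>k\<close>, so
      all integrands are controlled by the top gradient.\<close>
    have Fm: "\<bar>F m \<tau>\<bar> \<le> N * (V * c * \<alpha>)" if \<tau>: "0 < \<tau>" for \<tau>
    proof -
      have "\<bar>F m \<tau>\<bar> \<le> (\<Sum>w'\<in>{w' :: 'n list. length w' = m}. V * c * \<alpha>)"
        unfolding F_def
      proof (rule order_trans[OF sum_abs sum_mono])
        fix w' :: "'n list" assume "w' \<in> {w'. length w' = m}"
        then have len: "length (w @ w') = k" using w assms by (simp add: m_def)
        have "(\<integral>\<^sup>+z\<in>ball x (2 * \<tau>). ennreal \<bar>v (w @ w') z\<bar> \<partial>lebesgue)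
            \<le> (\<integral>\<^sup>+z\<in>ball x (2 * \<tau>). ennreal \<bar>weak_grad_norm k u z\<bar> \<partial>lebesgue)"
          using order_trans[OF abs_weak_partial_le[OF len, of u] abs_ge_self]
          by (intro nn_integral_mono mult_right_mono ennreal_leI) (auto simp: v_def)
        also have "\<dots> \<le> ennreal \<alpha> * emeasure lborel (ball x (2 * \<tau>))"
          using \<tau> by (intro not_heavyD heavy) simp
        finally show "\<bar>mollify (v (w @ w')) (monomial_mult w' \<psi>) x \<tau>\<bar> \<le> V * c * \<alpha>"
          unfolding V_def vol_def using len pos \<tau>
          by (intro abs_mollify_le bump_function_monomial_mult \<psi> abs_monomial_mult_le[OF \<psi> c(2)] vm) auto
      qed
      then show ?thesis by (simp add: N_def card_words)
    qed
    \<comment> \<open>At scales above \<rho> all \<open>j\<close> derivatives are moved onto the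
      mollifier; the price s^(-j) is at most \<rho>^(-j).\<close>
    have Fs: "\<bar>F 0 s\<bar> \<le> V * cj * \<beta> / \<rho> ^ j" if s: "\<rho> \<le> s" for s
    proof -
      have s0: "0 < s" using s pos by simp
      have "\<bar>mollify u (partials w \<psi>) x s\<bar> \<le> V * cj * \<beta>"
        unfolding V_def vol_def
        using pos s0 L(2)[of w] cj(2)[OF w] um
        by (intro abs_mollify_le bump_function_partials \<psi> not_heavyD heavy) (auto intro: order_trans)
      then have "\<bar>F 0 s\<bar> \<le> inverse s ^ j * (V * cj * \<beta>)"
        unfolding F0 using mollify_weak_partial[OF v \<psi> s0, of w x] w assms s0
        by (simp add: abs_mult power_abs mult_left_mono)
      also have "\<dots> \<le> inverse \<rho> ^ j * (V * cj * \<beta>)"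
        using s pos V cj0 by (intro mult_right_mono power_mono le_imp_inverse_le) auto
      finally show ?thesis by (simp add: divide_inverse power_inverse mult.commute)
    qed
    define T where "T = \<rho> ^ m * (N * (V * c * \<alpha>)) + 2 ^ m * (V * cj * \<beta> / \<rho> ^ j)"
    \<comment> \<open>The bound \<open>T\<close> is free of \<epsilon>, so the smallest scale may
      tend to 0.\<close>
    have F0T: "\<bar>F 0 \<epsilon>\<bar> \<le> T" if "0 < \<epsilon>" for \<epsilon>
    proof -
      have "\<bar>F 0 \<epsilon>\<bar> \<le> \<bar>((\<lambda>f t. f (t + \<rho>) - f t) ^^ m) (F 0) \<epsilon>\<bar> + 2 ^ m * (V * cj * \<beta> / \<rho> ^ j)"
        using pos that by (intro abs_le_forward_differences Fs) auto
      also have "\<bar>((\<lambda>f t. f (t + \<rho>) - f t) ^^ m) (F 0) \<epsilon>\<bar> \<le> \<rho> ^ m * (N * (V * c * \<alpha>))"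
        by (rule abs_forward_differences_le) (use deriv Fm pos that in auto)
      finally show ?thesis by (simp add: T_def)
    qed
    have "\<bar>v w x\<bar> * c0 \<le> T + e" if e: "0 < e" for e
    proof -
      \<comment> \<open>Chosen so that the bound \<open>V * c * \<eta>\<close> for the mollified
        oscillation equals \<open>e\<close>.\<close>
      define \<eta> where "\<eta> = e / (V * c)"
      have \<eta>: "0 < \<eta>" using e V c by (simp add: \<eta>_def)
      obtain \<delta> where \<delta>: "0 < \<delta>" "\<And>r. 0 < r \<Longrightarrow> r < \<delta> \<Longrightarrow>
        (\<integral>\<^sup>+y\<in>ball x r. ennreal \<bar>v w y - v w x\<bar> \<partial>lebesgue) \<le> ennreal \<eta> * emeasure lborel (ball x r)"
        using x \<eta> unfolding lebesgue_point_def v_def by blast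
      define \<epsilon> where "\<epsilon> = \<delta> / 4"
      have \<epsilon>: "0 < \<epsilon>" "2 * \<epsilon> < \<delta>" using \<delta> by (auto simp: \<epsilon>_def)
      have wk: "length w \<le> k" using w assms by simp
      have "\<bar>mollify (\<lambda>z. v w z - v w x) \<psi> x \<epsilon>\<bar> \<le> V * c * \<eta>"
        unfolding V_def vol_def
        using \<epsilon> \<eta> c vm[OF wk] by (intro abs_mollify_le \<psi> \<delta>) auto
      then have osc: "\<bar>mollify (\<lambda>z. v w z - v w x) \<psi> x \<epsilon>\<bar> \<le> e"
        using V c by (simp add: \<eta>_def)
      have kint: "integrable lebesgue (\<lambda>z. f z * mol_kernel \<psi> x \<epsilon> z)" if "locally_integrable f" for f
        by (rule integrable_mult_compact_support[OF that mol_kernel_measurable[OF \<psi>] _ mol_kernel_support[OF \<psi> \<epsilon>(1)],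
            where L = "inverse \<epsilon> ^ CARD('n) * c"])
          (use c \<epsilon> in \<open>auto simp: mol_kernel_def abs_mult intro!: mult_mono\<close>)
      have one: "locally_integrable (\<lambda>_::real^'n. 1::real)"
        by (rule locally_integrable_one)
      have "mollify (\<lambda>z. v w z - v w x) \<psi> x \<epsilon> = mollify (v w) \<psi> x \<epsilon> - v w x * mollify (\<lambda>_. 1) \<psi> x \<epsilon>"
        unfolding mollify_def left_diff_distrib
        using kint[OF vloc[OF wk]] kint[OF one] by simp
      then have "\<bar>v w x * mollify (\<lambda>_. 1) \<psi> x \<epsilon>\<bar> \<le> T + e"
        using osc F0T[OF \<epsilon>(1)] unfolding F0 by linarith
      moreover have "c0 \<le> mollify (\<lambda>_. 1) \<psi> x \<epsilon>"
        using mollify_bump_ge[OF \<epsilon>(1), of x] by (simp add: c0_def vol_def \<psi>_def)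
      then have "\<bar>v w x\<bar> * c0 \<le> \<bar>v w x * mollify (\<lambda>_. 1) \<psi> x \<epsilon>\<bar>"
        unfolding abs_mult using c0 by (intro mult_left_mono) auto
      ultimately show ?thesis by linarith
    qed
    then have "\<bar>v w x\<bar> * c0 \<le> T" by (rule field_le_epsilon)
    also have "T = N * (V * c) * (\<rho> ^ m * \<alpha>) + 2 ^ m * (V * cj) * (\<beta> / \<rho> ^ j)"
      by (simp add: T_def)
    also have "\<dots> \<le> (N * (V * c) + 2 ^ m * (V * cj)) * (\<rho> ^ m * \<alpha>) + (N * (V * c) + 2 ^ m * (V * cj)) * (\<beta> / \<rho> ^ j)"
      using Np V c cj0 pos by (intro add_mono mult_right_mono) auto
    also have "\<dots> = C * (\<rho> ^ m * \<alpha> + \<beta> / \<rho> ^ j) * c0"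
    proof -
      have "N * (V * c) + 2 ^ m * (V * cj) = C * c0" using c0 by (simp add: C_def)
      then show ?thesis by (simp only:) (simp add: algebra_simps)
    qed
    finally show ?thesis using c0 by (simp add: v_def)
  qed
  then show ?thesis using C unfolding m_def by blast
qed

section \<open>Hoelder's inequality\<close>

lemma ennpowr_top [simp]: "ennpowr top a = top"
  by (simp add: ennpowr_def)

lemma ennpowr_zero [simp]: "ennpowr 0 a = 0"
  by (simp add: ennpowr_def)

lemma ennpowr_one [simp]: "ennpowr x 1 = x"
  by (cases x) (auto simp: ennpowr_def)

lemma ennpowr_ennreal: "0 \<le> x \<Longrightarrow> ennpowr (ennreal x) a = ennreal (x powr a)"
  by (simp add: ennpowr_def)

lemma ennpowr_eq_top_iff [simp]: "ennpowr x a = top \<longleftrightarrow> x = top"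
  by (simp add: ennpowr_def)

lemma ennpowr_eq_0_iff [simp]: "ennpowr x a = 0 \<longleftrightarrow> x = 0"
  by (cases x) (auto simp: ennpowr_ennreal)

lemma ennpowr_mult: "ennpowr (x * y) a = ennpowr x a * ennpowr y a"
proof (cases "x = top \<or> y = top")
  case True
  then show ?thesis
    by (cases "x = 0"; cases "y = 0") (auto simp: ennreal_mult_eq_top_iff ennreal_top_mult ennreal_mult_top)
next
  case False
  then show ?thesis
    by (cases x; cases y) (auto simp: ennpowr_ennreal powr_mult simp flip: ennreal_mult)
qed

lemma ennpowr_ennpowr: "ennpowr (ennpowr x a) b = ennpowr x (a * b)"
  by (cases x) (auto simp: ennpowr_ennreal powr_powr)

lemma ennpowr_add: "ennpowr x (a + b) = ennpowr x a * ennpowr x b"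
  by (cases x) (auto simp: ennpowr_ennreal powr_add ennreal_mult ennreal_top_mult)

lemma ennpowr_mono:
  assumes "x \<le> y" "0 \<le> a" shows "ennpowr x a \<le> ennpowr y a"
proof (cases "y = top")
  case False
  then show ?thesis
    using assms by (cases x; cases y) (auto simp: ennpowr_ennreal powr_mono2 ennreal_leI top_unique)
qed simp

lemma ennpowr_measurable [measurable]:
  assumes [measurable]: "f \<in> borel_measurable M" shows "(\<lambda>x. ennpowr (f x) a) \<in> borel_measurable M"
  unfolding ennpowr_def by measurable

text \<open>After scaling by the two integrals \<open>A\<close> and \<open>B\<close>, the weighted
  inequality of arithmetic and geometric means holds pointwise and is integrated. Zero and infinite
  integrals are separated first.\<close>

lemma nn_integral_Hoelder:
  assumes [measurable]: "f \<in> borel_measurable M" "g \<in> borel_measurable M" and \<alpha>: "0 < \<alpha>" "\<alpha> < 1"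
  shows "(\<integral>\<^sup>+x. ennpowr (f x) \<alpha> * ennpowr (g x) (1 - \<alpha>) \<partial>M)
    \<le> ennpowr (\<integral>\<^sup>+x. f x \<partial>M) \<alpha> * ennpowr (\<integral>\<^sup>+x. g x \<partial>M) (1 - \<alpha>)"
proof -
  consider "(\<integral>\<^sup>+x. f x \<partial>M) = 0 \<or> (\<integral>\<^sup>+x. g x \<partial>M) = 0"
    | "(\<integral>\<^sup>+x. f x \<partial>M) \<noteq> 0" "(\<integral>\<^sup>+x. g x \<partial>M) \<noteq> 0" "(\<integral>\<^sup>+x. f x \<partial>M) = top \<or> (\<integral>\<^sup>+x. g x \<partial>M) = top"
    | "(\<integral>\<^sup>+x. f x \<partial>M) \<noteq> 0" "(\<integral>\<^sup>+x. g x \<partial>M) \<noteq> 0" "(\<integral>\<^sup>+x. f x \<partial>M) \<noteq> top" "(\<integral>\<^sup>+x. g x \<partial>M) \<noteq> top"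
    by blast
  then show ?thesis
  proof cases
    case 1
    then have "AE x in M. f x = 0 \<or> g x = 0"
      by (auto simp: nn_integral_0_iff_AE elim: eventually_mono)
    then have "AE x in M. ennpowr (f x) \<alpha> * ennpowr (g x) (1 - \<alpha>) = 0"
      by eventually_elim auto
    then have "(\<integral>\<^sup>+x. ennpowr (f x) \<alpha> * ennpowr (g x) (1 - \<alpha>) \<partial>M) = 0"
      by (subst nn_integral_0_iff_AE) auto
    then show ?thesis by simp
  next
    case 2
    then show ?thesis by (auto simp: ennreal_top_mult ennreal_mult_top)
  next
    case 3
    obtain A where A: "(\<integral>\<^sup>+x. f x \<partial>M) = ennreal A" "0 < A"
      using 3 by (cases "\<integral>\<^sup>+x. f x \<partial>M") (auto simp: order_le_less)
    obtain B where B: "(\<integral>\<^sup>+x. g x \<partial>M) = ennreal B" "0 < B"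
      using 3 by (cases "\<integral>\<^sup>+x. g x \<partial>M") (auto simp: order_le_less)
    define K where "K = A powr \<alpha> * B powr (1 - \<alpha>)"
    have K: "0 < K" using A B by (simp add: K_def)
    have young: "ennpowr y \<alpha> * ennpowr z (1 - \<alpha>) \<le> ennreal (K * \<alpha> / A) * y + ennreal (K * (1 - \<alpha>) / B) * z" for y z
    proof (cases "y = 0 \<or> z = 0")
      case False
      show ?thesis
      proof (cases "y = top \<or> z = top")
        case True
        have "0 < K * \<alpha> / A" "0 < K * (1 - \<alpha>) / B" using K A B \<alpha> by auto
        then show ?thesis using True by (auto simp: ennreal_mult_top)
      next
        case fin: False
        obtain y' z' where yz: "y = ennreal y'" "z = ennreal z'" "0 < y'" "0 < z'"
          using fin False by (cases y; cases z) (auto simp: order_le_less)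
        have "y' powr \<alpha> * z' powr (1 - \<alpha>) = K * ((y' / A) powr \<alpha> * (z' / B) powr (1 - \<alpha>))"
          using yz A B by (simp add: K_def powr_divide)
        also have "\<dots> \<le> K * (\<alpha> * (y' / A) + (1 - \<alpha>) * (z' / B))"
          using yz A B K \<alpha> by (intro mult_left_mono Youngs_inequality_0) auto
        also have "\<dots> = K * \<alpha> / A * y' + K * (1 - \<alpha>) / B * z'"
          by (simp add: algebra_simps)
        finally have "ennreal (y' powr \<alpha> * z' powr (1 - \<alpha>)) \<le> ennreal (K * \<alpha> / A * y' + K * (1 - \<alpha>) / B * z')"
          by (rule ennreal_leI)
        also have "\<dots> = ennreal (K * \<alpha> / A * y') + ennreal (K * (1 - \<alpha>) / B * z')"
          using yz A B K \<alpha> by (intro ennreal_plus) auto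
        also have "ennreal (K * \<alpha> / A * y') = ennreal (K * \<alpha> / A) * y"
          using yz A B K \<alpha> by (subst ennreal_mult) auto
        also have "ennreal (K * (1 - \<alpha>) / B * z') = ennreal (K * (1 - \<alpha>) / B) * z"
          using yz A B K \<alpha> by (subst ennreal_mult) auto
        finally show ?thesis
          using yz by (simp add: ennpowr_ennreal ennreal_mult)
      qed
    qed auto
    have "(\<integral>\<^sup>+x. ennpowr (f x) \<alpha> * ennpowr (g x) (1 - \<alpha>) \<partial>M)
        \<le> (\<integral>\<^sup>+x. ennreal (K * \<alpha> / A) * f x + ennreal (K * (1 - \<alpha>) / B) * g x \<partial>M)"
      by (intro nn_integral_mono young)
    also have "\<dots> = ennreal (K * \<alpha> / A) * ennreal A + ennreal (K * (1 - \<alpha>) / B) * ennreal B"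
      by (simp add: nn_integral_add nn_integral_cmult A B)
    also have "ennreal (K * \<alpha> / A) * ennreal A = ennreal (K * \<alpha>)"
      using A K \<alpha> by (subst ennreal_mult[symmetric]) auto
    also have "ennreal (K * (1 - \<alpha>) / B) * ennreal B = ennreal (K * (1 - \<alpha>))"
      using B K \<alpha> by (subst ennreal_mult[symmetric]) auto
    also have "ennreal (K * \<alpha>) + ennreal (K * (1 - \<alpha>)) = ennreal K"
      using K \<alpha> by (subst ennreal_plus[symmetric]) (auto simp: algebra_simps)
    finally show ?thesis
      using A B by (simp add: K_def ennpowr_ennreal ennreal_mult)
  qed
qed

text \<open>Hoelder's inequality with exponent 1/r for the splitting g w = (g^r w)^(1/r) w^(1 -
  1/r), raised to the power \<open>r\<close>.\<close>

lemma nn_integral_weighted_Jensen: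
  assumes [measurable]: "g \<in> borel_measurable M" "w \<in> borel_measurable M" and r: "1 \<le> r"
    and w: "\<And>x. w x \<noteq> top"
  shows "ennpowr (\<integral>\<^sup>+x. g x * w x \<partial>M) r \<le> (\<integral>\<^sup>+x. ennpowr (g x) r * w x \<partial>M) * ennpowr (\<integral>\<^sup>+x. w x \<partial>M) (r - 1)"
proof (cases "r = 1")
  case True
  show ?thesis
  \<comment> \<open>For \<open>r = 1\<close> the last factor is \<open>ennpowr W 0\<close>, which is
    0 for \<open>W = 0\<close> and at least 1 otherwise; in the first case the left-hand side
    vanishes as well.\<close>
  proof (cases "(\<integral>\<^sup>+x. w x \<partial>M) = 0")
    case 0: True
    then have "AE x in M. w x = 0" by (simp add: nn_integral_0_iff_AE)
    then have "AE x in M. g x * w x = 0" by eventually_elim auto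
    then have "(\<integral>\<^sup>+x. g x * w x \<partial>M) = 0" by (subst nn_integral_0_iff_AE) auto
    then show ?thesis using True by simp
  next
    case False
    then have "1 \<le> ennpowr (\<integral>\<^sup>+x. w x \<partial>M) 0"
      by (cases "\<integral>\<^sup>+x. w x \<partial>M") (auto simp: ennpowr_ennreal)
    then show ?thesis
      using True mult_left_mono[of 1 "ennpowr (\<integral>\<^sup>+x. w x \<partial>M) 0" "\<integral>\<^sup>+x. g x * w x \<partial>M"] by simp
  qed
next
  case False
  then have \<alpha>: "0 < 1 / r" "1 / r < 1" using r by auto
  have "g x * w x = ennpowr (ennpowr (g x) r * w x) (1 / r) * ennpowr (w x) (1 - 1 / r)" for x
  proof -
    have "ennpowr (ennpowr (g x) r * w x) (1 / r) * ennpowr (w x) (1 - 1 / r)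
        = g x * (ennpowr (w x) (1 / r) * ennpowr (w x) (1 - 1 / r))"
      using r by (simp add: ennpowr_mult ennpowr_ennpowr mult.assoc)
    also have "ennpowr (w x) (1 / r) * ennpowr (w x) (1 - 1 / r) = w x"
      by (simp flip: ennpowr_add)
    finally show ?thesis by simp
  qed
  then have "(\<integral>\<^sup>+x. g x * w x \<partial>M)
      \<le> ennpowr (\<integral>\<^sup>+x. ennpowr (g x) r * w x \<partial>M) (1 / r) * ennpowr (\<integral>\<^sup>+x. w x \<partial>M) (1 - 1 / r)"
    using nn_integral_Hoelder[of "\<lambda>x. ennpowr (g x) r * w x" M w, OF _ _ \<alpha>] by simp
  then have "ennpowr (\<integral>\<^sup>+x. g x * w x \<partial>M) r
      \<le> ennpowr (ennpowr (\<integral>\<^sup>+x. ennpowr (g x) r * w x \<partial>M) (1 / r) * ennpowr (\<integral>\<^sup>+x. w x \<partial>M) (1 - 1 / r)) r"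
    using r by (intro ennpowr_mono) auto
  also have "\<dots> = (\<integral>\<^sup>+x. ennpowr (g x) r * w x \<partial>M) * ennpowr (\<integral>\<^sup>+x. w x \<partial>M) (r - 1)"
    using r by (simp add: ennpowr_mult ennpowr_ennpowr left_diff_distrib)
  finally show ?thesis .
qed

section \<open>The \<open>L^q\<close> functionals on the half-line\<close>

lemma Lq_norm_top_le:
  assumes [measurable]: "f \<in> borel_measurable lborel" and "AE t in lborel. 0 < t \<longrightarrow> f t \<le> z"
  shows "Lq_norm top f \<le> z"
  using assms(2) by (auto simp: Lq_norm_def AE_restrict_space_iff intro!: esssup_I measurable_restrict_space1)

lemma AE_le_Lq_norm_top: "AE t in lborel. 0 < t \<longrightarrow> f t \<le> Lq_norm top f"
  using esssup_AE[of f "restrict_space lborel {0<..}"] by (simp add: Lq_norm_def AE_restrict_space_iff)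

lemma Lq_norm_ennreal:
  assumes "0 \<le> q"
  shows "Lq_norm (ennreal q) f = ennpowr (\<integral>\<^sup>+t\<in>{0<..}. ennpowr (f t) q \<partial>lborel) (1 / q)"
  using assms by (simp add: Lq_norm_def)

lemma ennreal_ge_1_cases:
  assumes "1 \<le> (q::ennreal)"
  obtains "q = top" | q' where "q = ennreal q'" "1 \<le> q'"
  using assms by (cases q) (auto simp: ennreal_le_iff simp flip: ennreal_1)

lemma AE_less_top_of_Lq_norm:
  assumes [measurable]: "f \<in> borel_measurable lborel" and q: "1 \<le> q" and fin: "Lq_norm q f < top"
  shows "AE t in lborel. 0 < t \<longrightarrow> f t < top"
  using q
proof (cases rule: ennreal_ge_1_cases)
  case 1
  show ?thesis using AE_le_Lq_norm_top[of f] fin unfolding 1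
    by (auto elim!: eventually_mono intro: le_less_trans)
next
  case (2 q')
  have "(\<integral>\<^sup>+t\<in>{0<..}. ennpowr (f t) q' \<partial>lborel) \<noteq> top"
    using fin 2 by (auto simp: Lq_norm_ennreal simp flip: less_top)
  then have "AE t in lborel. ennpowr (f t) q' * indicator {0<..} t \<noteq> top"
    using nn_integral_PInf_AE[of "\<lambda>t. ennpowr (f t) q' * indicator {0<..} t" lborel] by simp
  then show ?thesis by eventually_elim (auto simp flip: less_top)
qed

lemma Lq_norm_le_cmult:
  assumes [measurable]: "f \<in> borel_measurable lborel" "g \<in> borel_measurable lborel"
    and q: "1 \<le> q" and c: "0 < c" and le: "\<And>t. 0 < t \<Longrightarrow> f t \<le> ennreal c * g t"
  shows "Lq_norm q f \<le> ennreal c * Lq_norm q g"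
  using q
proof (cases rule: ennreal_ge_1_cases)
  case 1
  have "AE t in lborel. 0 < t \<longrightarrow> f t \<le> ennreal c * Lq_norm top g"
    using AE_le_Lq_norm_top[of g] by eventually_elim (auto intro: order_trans[OF le mult_left_mono])
  then show ?thesis unfolding 1 by (intro Lq_norm_top_le) auto
next
  case (2 q')
  have "(\<integral>\<^sup>+t\<in>{0<..}. ennpowr (f t) q' \<partial>lborel) \<le> (\<integral>\<^sup>+t. ennreal (c powr q') * (ennpowr (g t) q' * indicator {0<..} t) \<partial>lborel)"
  proof (rule nn_integral_mono)
    fix t :: real
    show "ennpowr (f t) q' * indicator {0<..} t \<le> ennreal (c powr q') * (ennpowr (g t) q' * indicator {0<..} t)"
      using ennpowr_mono[OF le[of t], of q'] 2 c
      by (cases "0 < t") (auto simp: ennpowr_mult ennpowr_ennreal)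
  qed
  also have "\<dots> = ennreal (c powr q') * (\<integral>\<^sup>+t\<in>{0<..}. ennpowr (g t) q' \<partial>lborel)"
    by (intro nn_integral_cmult) auto
  finally have "Lq_norm q f \<le> ennpowr (ennreal (c powr q') * (\<integral>\<^sup>+t\<in>{0<..}. ennpowr (g t) q' \<partial>lborel)) (1 / q')"
    using 2 by (simp add: Lq_norm_ennreal ennpowr_mono)
  also have "\<dots> = ennreal c * Lq_norm q g"
    using 2 c by (simp add: Lq_norm_ennreal ennpowr_mult ennpowr_ennreal powr_powr)
  finally show ?thesis .
qed

text \<open>An infinite index is treated by pulling its factor out as an essential supremum almost
  everywhere, after which the index relation fixes the power of the other factor. For finite indices
  the claim reduces to \<open>nn_integral_Hoelder\<close>.\<close>

lemma Lq_norm_Hoelder: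
  assumes [measurable]: "a \<in> borel_measurable lborel" "b \<in> borel_measurable lborel"
    and \<theta>: "0 < \<theta>" "\<theta> < 1" and ge: "1 \<le> p" "1 \<le> q" "1 \<le> r"
    and eq: "1 / p = ennreal \<theta> / r + ennreal (1 - \<theta>) / q"
  shows "Lq_norm p (\<lambda>t. ennpowr (a t) \<theta> * ennpowr (b t) (1 - \<theta>))
    \<le> ennpowr (Lq_norm r a) \<theta> * ennpowr (Lq_norm q b) (1 - \<theta>)"
proof -
  have pos: "0 < ennreal \<theta>" "0 < ennreal (1 - \<theta>)" using \<theta> by auto
  show ?thesis
    using ge(1)
  proof (cases rule: ennreal_ge_1_cases)
    case p: 1
    then have "ennreal \<theta> / r = 0" "ennreal (1 - \<theta>) / q = 0"
      using eq by auto
    then have rq: "r = top" "q = top"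
      using pos by (auto simp: ennreal_divide_eq_0_iff)
    have "AE t in lborel. 0 < t \<longrightarrow> ennpowr (a t) \<theta> * ennpowr (b t) (1 - \<theta>)
        \<le> ennpowr (Lq_norm top a) \<theta> * ennpowr (Lq_norm top b) (1 - \<theta>)"
      using AE_le_Lq_norm_top[of a] AE_le_Lq_norm_top[of b]
      by eventually_elim (use \<theta> in \<open>auto intro!: mult_mono ennpowr_mono\<close>)
    then show ?thesis unfolding p rq by (intro Lq_norm_top_le) auto
  next
    case (2 p')
    note p = this
    define A where "A = Lq_norm r a"
    define B where "B = Lq_norm q b"
    have key: ?thesis if "(\<integral>\<^sup>+t\<in>{0<..}. ennpowr (ennpowr (a t) \<theta> * ennpowr (b t) (1 - \<theta>)) p' \<partial>lborel)
      \<le> ennpowr (ennpowr A \<theta> * ennpowr B (1 - \<theta>)) p'"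
    proof -
      have "Lq_norm p (\<lambda>t. ennpowr (a t) \<theta> * ennpowr (b t) (1 - \<theta>))
          \<le> ennpowr (ennpowr (ennpowr A \<theta> * ennpowr B (1 - \<theta>)) p') (1 / p')"
        using that p by (simp add: Lq_norm_ennreal ennpowr_mono)
      then show ?thesis using p by (simp add: ennpowr_ennpowr A_def B_def)
    qed
    have ip: "1 / p = ennreal (1 / p')" using p by (simp add: divide_ennreal flip: ennreal_1)
    show ?thesis
      using ge(3)
    proof (cases rule: ennreal_ge_1_cases)
      case r: 1
      show ?thesis
        using ge(2)
      proof (cases rule: ennreal_ge_1_cases)
        case q: 1
        then show ?thesis using ip eq r p by simp
      next
        case (2 q')
        have "ennreal (1 / p') = ennreal ((1 - \<theta>) / q')"
          using ip eq r 2 \<theta> by (simp add: divide_ennreal)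
        then have pq: "(1 - \<theta>) * p' = q'"
          using p 2 \<theta> by (simp add: field_simps)
        have "AE t in lborel. ennpowr (ennpowr (a t) \<theta> * ennpowr (b t) (1 - \<theta>)) p' * indicator {0<..} t
          \<le> ennpowr A (\<theta> * p') * (ennpowr (b t) q' * indicator {0<..} t)"
          using AE_le_Lq_norm_top[of a]
        proof eventually_elim
          case (elim t)
          show ?case
          proof (cases "0 < t")
            case True
            then have "ennpowr (a t) (\<theta> * p') \<le> ennpowr A (\<theta> * p')"
              using elim r \<theta> p by (intro ennpowr_mono) (auto simp: A_def)
            then show ?thesis
              using True by (simp add: ennpowr_mult ennpowr_ennpowr pq mult_right_mono)
          qed simp
        qed
        then have "(\<integral>\<^sup>+t\<in>{0<..}. ennpowr (ennpowr (a t) \<theta> * ennpowr (b t) (1 - \<theta>)) p' \<partial>lborel)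
          \<le> (\<integral>\<^sup>+t. ennpowr A (\<theta> * p') * (ennpowr (b t) q' * indicator {0<..} t) \<partial>lborel)"
          by (rule nn_integral_mono_AE)
        also have "\<dots> = ennpowr A (\<theta> * p') * (\<integral>\<^sup>+t\<in>{0<..}. ennpowr (b t) q' \<partial>lborel)"
          by (intro nn_integral_cmult) auto
        also have "\<dots> = ennpowr (ennpowr A \<theta> * ennpowr B (1 - \<theta>)) p'"
          using 2 by (simp add: B_def Lq_norm_ennreal ennpowr_mult ennpowr_ennpowr pq)
        finally show ?thesis by (rule key)
      qed
    next
      case (2 r')
      note r = this
      show ?thesis
        using ge(2)
      proof (cases rule: ennreal_ge_1_cases)
        case q: 1
        have "ennreal (1 / p') = ennreal (\<theta> / r')"
          using ip eq q r \<theta> by (simp add: divide_ennreal)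
        then have pr: "\<theta> * p' = r'"
          using p r \<theta> by (simp add: field_simps)
        have "AE t in lborel. ennpowr (ennpowr (a t) \<theta> * ennpowr (b t) (1 - \<theta>)) p' * indicator {0<..} t
          \<le> ennpowr B ((1 - \<theta>) * p') * (ennpowr (a t) r' * indicator {0<..} t)"
          using AE_le_Lq_norm_top[of b]
        proof eventually_elim
          case (elim t)
          show ?case
          proof (cases "0 < t")
            case True
            then have "ennpowr (b t) ((1 - \<theta>) * p') \<le> ennpowr B ((1 - \<theta>) * p')"
              using elim q \<theta> p by (intro ennpowr_mono) (auto simp: B_def)
            then show ?thesis
              using True by (simp add: ennpowr_mult ennpowr_ennpowr pr mult.commute[of "ennpowr (a t) r'"] mult_right_mono)
          qed simp
        qed
        then have "(\<integral>\<^sup>+t\<in>{0<..}. ennpowr (ennpowr (a t) \<theta> * ennpowr (b t) (1 - \<theta>)) p' \<partial>lborel)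
          \<le> (\<integral>\<^sup>+t. ennpowr B ((1 - \<theta>) * p') * (ennpowr (a t) r' * indicator {0<..} t) \<partial>lborel)"
          by (rule nn_integral_mono_AE)
        also have "\<dots> = ennpowr B ((1 - \<theta>) * p') * (\<integral>\<^sup>+t\<in>{0<..}. ennpowr (a t) r' \<partial>lborel)"
          by (intro nn_integral_cmult) auto
        also have "\<dots> = ennpowr (ennpowr A \<theta> * ennpowr B (1 - \<theta>)) p'"
          using r by (simp add: A_def Lq_norm_ennreal ennpowr_mult ennpowr_ennpowr pr mult.commute)
        finally show ?thesis by (rule key)
      next
        case (2 q')
        note q = this
        have "ennreal (1 / p') = ennreal (\<theta> / r' + (1 - \<theta>) / q')"
          using ip eq q r \<theta> by (simp add: divide_ennreal ennreal_plus)
        then have sum: "1 / p' = \<theta> / r' + (1 - \<theta>) / q'"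
          using p q r \<theta> by (subst (asm) ennreal_inj) auto
        \<comment> \<open>Hoelder exponent for the functions a^r' and b^q'; the index relation makes
          its complement \<open>(1 - \<theta>) * p' / q'\<close>.\<close>
        define \<alpha> where "\<alpha> = \<theta> * p' / r'"
        have \<alpha>': "1 - \<alpha> = (1 - \<theta>) * p' / q'"
        proof -
          have "p' * (1 / p') = p' * (\<theta> / r' + (1 - \<theta>) / q')" using sum by simp
          then show ?thesis using p by (simp add: \<alpha>_def distrib_left mult_ac)
        qed
        have \<alpha>: "0 < \<alpha>" using p q r \<theta> by (simp add: \<alpha>_def)
        have "0 < 1 - \<alpha>" using p q r \<theta> by (simp add: \<alpha>')
        then have \<alpha>1: "\<alpha> < 1" by simp
        have e: "r' * \<alpha> = \<theta> * p'" "q' * (1 - \<alpha>) = (1 - \<theta>) * p'"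
          using q r by (simp_all add: \<alpha>_def \<alpha>'[unfolded \<alpha>_def])
        have "ennpowr (ennpowr (a t) \<theta> * ennpowr (b t) (1 - \<theta>)) p' * indicator {0<..} t
          = ennpowr (ennpowr (a t) r' * indicator {0<..} t) \<alpha> * ennpowr (ennpowr (b t) q' * indicator {0<..} t) (1 - \<alpha>)" for t
          by (cases "0 < t") (auto simp: ennpowr_mult ennpowr_ennpowr e)
        then have "(\<integral>\<^sup>+t\<in>{0<..}. ennpowr (ennpowr (a t) \<theta> * ennpowr (b t) (1 - \<theta>)) p' \<partial>lborel)
          \<le> ennpowr (\<integral>\<^sup>+t\<in>{0<..}. ennpowr (a t) r' \<partial>lborel) \<alpha> * ennpowr (\<integral>\<^sup>+t\<in>{0<..}. ennpowr (b t) q' \<partial>lborel) (1 - \<alpha>)"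
          using nn_integral_Hoelder[OF _ _ \<alpha> \<alpha>1, of "\<lambda>t. ennpowr (a t) r' * indicator {0<..} t" lborel
              "\<lambda>t. ennpowr (b t) q' * indicator {0<..} t"] by simp
        also have "\<dots> = ennpowr (ennpowr A \<theta> * ennpowr B (1 - \<theta>)) p'"
          using q r by (simp add: A_def B_def Lq_norm_ennreal ennpowr_mult ennpowr_ennpowr \<alpha>'[unfolded \<alpha>_def] \<alpha>_def)
        finally show ?thesis by (rule key)
      qed
    qed
  qed
qed

section \<open>Rearrangement of the maximal function\<close>

lemma rearrangement_le:
  assumes "0 < s" "emeasure lebesgue {x. s < norm (f x)} \<le> ennreal t"
  shows "rearrangement f t \<le> ennreal s"
  unfolding rearrangement_def using assms by (intro Inf_lower) auto

lemma superlevel_sets: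
  fixes f :: "real ^ 'n::finite \<Rightarrow> real"
  assumes "f \<in> borel_measurable lebesgue"
  shows "{x. s < norm (f x)} \<in> sets lebesgue"
proof -
  have "{x \<in> space lebesgue. s < norm (f x)} \<in> sets lebesgue"
    using assms by measurable
  then show ?thesis by simp
qed

text \<open>The strict inequality supplies an admissible level below \<open>s\<close>, so the
  infimum need not be attained.\<close>

lemma emeasure_superlevel_le:
  assumes f: "f \<in> borel_measurable lebesgue" and "rearrangement f t < ennreal s"
  shows "emeasure lebesgue {x. s < norm (f x)} \<le> ennreal t"
proof -
  obtain s' where s': "ennreal s' < ennreal s" "0 < s'" "emeasure lebesgue {x. s' < norm (f x)} \<le> ennreal t"
    using assms(2) unfolding rearrangement_def Inf_less_iff by auto
  then have "s' < s" by (simp add: ennreal_less_iff)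
  then have "emeasure lebesgue {x. s < norm (f x)} \<le> emeasure lebesgue {x. s' < norm (f x)}"
    by (intro emeasure_mono superlevel_sets f) auto
  then show ?thesis using s'(3) by (rule order_trans)
qed

lemma rearrangement_antimono: "t \<le> t' \<Longrightarrow> rearrangement f t' \<le> rearrangement f t"
  unfolding rearrangement_def by (intro Inf_superset_mono) (blast intro: order_trans ennreal_leI)

lemma antimono_borel_measurable:
  fixes \<phi> :: "real \<Rightarrow> ennreal"
  assumes "\<And>t t'. t \<le> t' \<Longrightarrow> \<phi> t' \<le> \<phi> t"
  shows "\<phi> \<in> borel_measurable borel"
proof (rule borel_measurableI_less)
  fix y
  have "is_interval {x. \<phi> x < y}"
    unfolding is_interval_1 using assms by (auto intro: le_less_trans)
  then show "{x \<in> space borel. \<phi> x < y} \<in> sets borel"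
    by (simp add: real_interval_borel_measurable)
qed

lemma rearrangement_measurable [measurable]: "rearrangement f \<in> borel_measurable borel"
  by (intro antimono_borel_measurable rearrangement_antimono)

lemma sigma_finite_lebesgue: "sigma_finite_measure (lebesgue :: 'a::euclidean_space measure)"
proof
  show "\<exists>A::'a set set. countable A \<and> A \<subseteq> sets lebesgue \<and> \<Union>A = space lebesgue \<and> (\<forall>a\<in>A. emeasure lebesgue a \<noteq> \<infinity>)"
  proof (intro exI[of _ "range (\<lambda>m. ball 0 (real m))"] conjI)
    show "(\<Union>m. ball (0::'a) (real m)) = space lebesgue"
      using reals_Archimedean2 by auto
    show "\<forall>a\<in>range (\<lambda>m. ball (0::'a) (real m)). emeasure lebesgue a \<noteq> \<infinity>"
      using emeasure_lborel_ball_finite[of "0::'a"] by (auto simp: less_le)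
  qed auto
qed

text \<open>Both sides are computed by the layer cake formula; the second one uses that
  \<open>rearrangement f\<close> is at least \<open>y\<close> on an interval as long as the measure of \<open>{y < \<bar>f\<bar>}\<close>.\<close>

lemma nn_integral_excess_le:
  fixes f :: "real ^ 'n::finite \<Rightarrow> real"
  assumes f [measurable]: "f \<in> borel_measurable lebesgue" and t: "0 < t"
    and s: "0 \<le> s" "rearrangement f t = ennreal s"
  shows "(\<integral>\<^sup>+x. ennreal (max 0 (\<bar>f x\<bar> - s)) \<partial>lebesgue) \<le> (\<integral>\<^sup>+\<tau>\<in>{0<..t}. rearrangement f \<tau> \<partial>lborel)"
proof -
  interpret sigma_finite_measure "lebesgue :: (real^'n) measure" by (rule sigma_finite_lebesgue)
  interpret pair_sigma_finite "lebesgue :: (real^'n) measure" "lborel :: real measure" ..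
  have [measurable]: "rearrangement f \<in> borel_measurable lborel" by simp
  have "(\<integral>\<^sup>+x. ennreal (max 0 (\<bar>f x\<bar> - s)) \<partial>lebesgue)
      = (\<integral>\<^sup>+x. (\<integral>\<^sup>+\<sigma>. (if 0 < \<sigma> \<and> s + \<sigma> < \<bar>f x\<bar> then 1 else 0) \<partial>lborel) \<partial>lebesgue)"
  proof (rule nn_integral_cong)
    fix x
    have "(\<integral>\<^sup>+\<sigma>. (if 0 < \<sigma> \<and> s + \<sigma> < \<bar>f x\<bar> then 1 else 0) \<partial>lborel)
        = (\<integral>\<^sup>+\<sigma>. indicator {0<..<max 0 (\<bar>f x\<bar> - s)} \<sigma> \<partial>lborel)"
      by (intro nn_integral_cong) (auto simp: indicator_def)
    then show "ennreal (max 0 (\<bar>f x\<bar> - s)) = (\<integral>\<^sup>+\<sigma>. (if 0 < \<sigma> \<and> s + \<sigma> < \<bar>f x\<bar> then 1 else 0) \<partial>lborel)"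
      by simp
  qed
  also have "\<dots> = (\<integral>\<^sup>+\<sigma>. (\<integral>\<^sup>+x. (if 0 < \<sigma> \<and> s + \<sigma> < \<bar>f x\<bar> then 1 else 0) \<partial>lebesgue) \<partial>lborel)"
    by (rule Fubini'[symmetric]) measurable
  also have "\<dots> \<le> (\<integral>\<^sup>+\<sigma>. (\<integral>\<^sup>+\<tau>. (if 0 < \<sigma> \<and> 0 < \<tau> \<and> \<tau> \<le> t \<and> ennreal (s + \<sigma>) \<le> rearrangement f \<tau> then 1 else 0) \<partial>lborel) \<partial>lborel)"
  proof (rule nn_integral_mono)
    fix \<sigma> :: real
    show "(\<integral>\<^sup>+x. (if 0 < \<sigma> \<and> s + \<sigma> < \<bar>f x\<bar> then 1 else 0) \<partial>lebesgue)
        \<le> (\<integral>\<^sup>+\<tau>. (if 0 < \<sigma> \<and> 0 < \<tau> \<and> \<tau> \<le> t \<and> ennreal (s + \<sigma>) \<le> rearrangement f \<tau> then 1 else 0) \<partial>lborel)"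
    proof (cases "0 < \<sigma>")
      case True
      define \<mu> where "\<mu> = emeasure lebesgue {x. s + \<sigma> < norm (f x)}"
      have "\<mu> \<le> ennreal t"
        unfolding \<mu>_def using s True by (intro emeasure_superlevel_le f) (simp add: ennreal_less_iff)
      then obtain m where m: "\<mu> = ennreal m" "0 \<le> m" "m \<le> t"
        using t by (cases \<mu>) (auto simp: top_unique)
      have "(\<integral>\<^sup>+x. (if 0 < \<sigma> \<and> s + \<sigma> < \<bar>f x\<bar> then 1 else 0) \<partial>lebesgue)
          = (\<integral>\<^sup>+x. indicator {x. s + \<sigma> < norm (f x)} x \<partial>lebesgue)"
        using True by (intro nn_integral_cong) (auto simp: indicator_def)
      also have "\<dots> = \<mu>"
        unfolding \<mu>_def by (intro nn_integral_indicator superlevel_sets f)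
      also have "\<mu> = (\<integral>\<^sup>+\<tau>. indicator {0<..<m} \<tau> \<partial>lborel)"
        using m by simp
      also have "\<dots> \<le> (\<integral>\<^sup>+\<tau>. (if 0 < \<sigma> \<and> 0 < \<tau> \<and> \<tau> \<le> t \<and> ennreal (s + \<sigma>) \<le> rearrangement f \<tau> then 1 else 0) \<partial>lborel)"
      proof (rule nn_integral_mono)
        fix \<tau> :: real
        have "ennreal (s + \<sigma>) \<le> rearrangement f \<tau>" if "0 < \<tau>" "\<tau> < m"
        proof (rule ccontr)
          assume "\<not> ?thesis"
          then have "\<mu> \<le> ennreal \<tau>"
            unfolding \<mu>_def by (intro emeasure_superlevel_le f) simp
          then show False using that m by simp
        qed
        then show "indicator {0<..<m} \<tau> \<le> (if 0 < \<sigma> \<and> 0 < \<tau> \<and> \<tau> \<le> t \<and> ennreal (s + \<sigma>) \<le> rearrangement f \<tau> then 1 else (0::ennreal))"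
          using m True by (auto simp: indicator_def)
      qed
      finally show ?thesis .
    qed simp
  qed
  also have "\<dots> = (\<integral>\<^sup>+\<tau>. (\<integral>\<^sup>+\<sigma>. (if 0 < \<sigma> \<and> 0 < \<tau> \<and> \<tau> \<le> t \<and> ennreal (s + \<sigma>) \<le> rearrangement f \<tau> then 1 else 0) \<partial>lborel) \<partial>lborel)"
    by (rule lborel_pair.Fubini') measurable
  also have "\<dots> \<le> (\<integral>\<^sup>+\<tau>\<in>{0<..t}. rearrangement f \<tau> \<partial>lborel)"
  proof (rule nn_integral_mono)
    fix \<tau> :: real
    show "(\<integral>\<^sup>+\<sigma>. (if 0 < \<sigma> \<and> 0 < \<tau> \<and> \<tau> \<le> t \<and> ennreal (s + \<sigma>) \<le> rearrangement f \<tau> then 1 else 0) \<partial>lborel)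
        \<le> rearrangement f \<tau> * indicator {0<..t} \<tau>"
    proof (cases "0 < \<tau> \<and> \<tau> \<le> t")
      case True
      show ?thesis
      proof (cases "rearrangement f \<tau>")
        case (real r)
        have "(\<integral>\<^sup>+\<sigma>. (if 0 < \<sigma> \<and> 0 < \<tau> \<and> \<tau> \<le> t \<and> ennreal (s + \<sigma>) \<le> rearrangement f \<tau> then 1 else 0) \<partial>lborel)
            \<le> (\<integral>\<^sup>+\<sigma>. indicator {0..r} \<sigma> \<partial>lborel)"
          using s(1) real by (intro nn_integral_mono) (auto simp: indicator_def)
        then show ?thesis using True real by simp
      qed (use True in simp)
    qed auto
  qed
  finally show ?thesis .
qed

section \<open>The maximal rearrangement and the level sets of the maximal function\<close>

text \<open>The average of f* over (0, t), usually denoted f**.\<close>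

definition rearr_mean :: "(real ^ 'n::finite \<Rightarrow> real) \<Rightarrow> real \<Rightarrow> ennreal" where
  "rearr_mean f t = ennreal (1 / t) * (\<integral>\<^sup>+\<tau>\<in>{0<..t}. rearrangement f \<tau> \<partial>lborel)"

lemma rearr_mean_mult:
  assumes "0 < t"
  shows "ennreal t * rearr_mean f t = (\<integral>\<^sup>+\<tau>\<in>{0<..t}. rearrangement f \<tau> \<partial>lborel)"
  using assms by (simp add: rearr_mean_def mult.assoc[symmetric] flip: ennreal_mult)

lemma rearrangement_le_mean:
  assumes "0 < t" shows "rearrangement f t \<le> rearr_mean f t"
proof -
  have "ennreal t * rearrangement f t = (\<integral>\<^sup>+\<tau>\<in>{0<..t}. rearrangement f t \<partial>lborel)"
    using assms by (simp add: nn_integral_cmult_indicator mult.commute)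
  also have "\<dots> \<le> (\<integral>\<^sup>+\<tau>\<in>{0<..t}. rearrangement f \<tau> \<partial>lborel)"
    by (intro nn_integral_mono) (auto simp: indicator_def intro: rearrangement_antimono)
  finally have "ennreal t * rearrangement f t \<le> ennreal t * rearr_mean f t"
    using assms by (simp add: rearr_mean_mult)
  then show ?thesis
    using assms by (subst (asm) ennreal_mult_le_mult_iff) auto
qed

text \<open>Undoes the halving of \<open>t\<close> caused by two exceptional sets of measure
  \<open>t / 2\<close> each.\<close>

lemma rearr_mean_half_le:
  assumes "0 < t" shows "rearr_mean f (t / 2) \<le> 2 * rearr_mean f t"
proof -
  have "(\<integral>\<^sup>+\<tau>\<in>{0<..t / 2}. rearrangement f \<tau> \<partial>lborel) \<le> (\<integral>\<^sup>+\<tau>\<in>{0<..t}. rearrangement f \<tau> \<partial>lborel)"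
    using assms by (intro nn_integral_mono) (auto simp: indicator_def)
  then have "rearr_mean f (t / 2) \<le> ennreal (2 / t) * (\<integral>\<^sup>+\<tau>\<in>{0<..t}. rearrangement f \<tau> \<partial>lborel)"
    using assms by (simp add: rearr_mean_def mult_left_mono)
  also have "ennreal (2 / t) = 2 * ennreal (1 / t)"
    using assms ennreal_mult[of 2 "1 / t"] by simp
  finally show ?thesis by (simp add: rearr_mean_def mult.assoc)
qed

text \<open>In the usual notation, (M f)*(t) is at most a constant times f**(t). Cutting |f| at the
  height s = f*(t) lowers every average by at most \<open>s\<close> and leaves an excess of integral
  at most t f**(t), to which the weak type bound applies. In the constant,
  \<open>5 ^ CARD('n)\<close> stems from that bound and 1 from \<open>s \<le> G\<close>.\<close>

lemma emeasure_heavy_le_of_rearr_mean: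
  fixes f :: "real ^ 'n::finite \<Rightarrow> real"
  assumes f [measurable]: "f \<in> borel_measurable lebesgue" and t: "0 < t"
    and G: "0 \<le> G" "rearr_mean f t \<le> ennreal G" and a: "0 < a" "(5 ^ CARD('n) + 1) * G \<le> a"
  shows "emeasure lebesgue (heavy a f) \<le> ennreal t"
proof -
  have "rearrangement f t \<le> ennreal G"
    using rearrangement_le_mean[OF t] G(2) by (rule order_trans)
  then obtain s where s: "rearrangement f t = ennreal s" "0 \<le> s" "s \<le> G"
    using G(1) by (cases "rearrangement f t") (auto simp: top_unique)
  have as: "5 ^ CARD('n) * G \<le> a - s" using a s by (simp add: algebra_simps)
  have "0 < a - s"
  proof (cases "G = 0")
    case False
    then have "0 < 5 ^ CARD('n) * G" using G(1) by simp
    then show ?thesis using as by linarith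
  qed (use s a in auto)
  let ?f = "\<lambda>x. max 0 (\<bar>f x\<bar> - s)"
  have "heavy a f \<subseteq> heavy (a - s) ?f"
  proof
    fix x assume "x \<in> heavy a f"
    then obtain y r where x: "x \<in> ball y r" "0 < r"
      and y: "ennreal a * emeasure lborel (ball y r) < (\<integral>\<^sup>+y\<in>ball y r. ennreal \<bar>f y\<bar> \<partial>lebesgue)"
      unfolding heavy_def by auto
    have "(\<integral>\<^sup>+y\<in>ball y r. ennreal \<bar>f y\<bar> \<partial>lebesgue)
        \<le> (\<integral>\<^sup>+z. ennreal \<bar>?f z\<bar> * indicator (ball y r) z + ennreal s * indicator (ball y r) z \<partial>lebesgue)"
      using s(2) by (intro nn_integral_mono)
        (auto simp: indicator_def ennreal_leI simp flip: ennreal_plus)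
    also have "\<dots> = (\<integral>\<^sup>+z\<in>ball y r. ennreal \<bar>?f z\<bar> \<partial>lebesgue) + ennreal s * emeasure lborel (ball y r)"
      by (subst nn_integral_add) (auto simp: nn_integral_cmult_indicator)
    finally have le: "(\<integral>\<^sup>+y\<in>ball y r. ennreal \<bar>f y\<bar> \<partial>lebesgue)
        \<le> (\<integral>\<^sup>+z\<in>ball y r. ennreal \<bar>?f z\<bar> \<partial>lebesgue) + ennreal s * emeasure lborel (ball y r)" .
    have "ennreal (a - s) * emeasure lborel (ball y r) < (\<integral>\<^sup>+z\<in>ball y r. ennreal \<bar>?f z\<bar> \<partial>lebesgue)"
    proof (rule ccontr)
      assume "\<not> ?thesis"
      then have "(\<integral>\<^sup>+z\<in>ball y r. ennreal \<bar>?f z\<bar> \<partial>lebesgue) + ennreal s * emeasure lborel (ball y r)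
          \<le> ennreal (a - s) * emeasure lborel (ball y r) + ennreal s * emeasure lborel (ball y r)"
        by (intro add_mono) auto
      also have "\<dots> = (ennreal (a - s) + ennreal s) * emeasure lborel (ball y r)"
        by (simp add: distrib_right)
      also have "ennreal (a - s) + ennreal s = ennreal a"
        using s(2) \<open>0 < a - s\<close> by (simp flip: ennreal_plus)
      finally show False using le y by (meson order_trans not_le)
    qed
    then show "x \<in> heavy (a - s) ?f"
      using x unfolding heavy_def by auto
  qed
  then have "ennreal (a - s) * emeasure lebesgue (heavy a f) \<le> ennreal (a - s) * emeasure lebesgue (heavy (a - s) ?f)"
    by (intro mult_left_mono emeasure_mono heavy_sets) auto
  also have "\<dots> \<le> ennreal (5 ^ CARD('n)) * (\<integral>\<^sup>+y. ennreal \<bar>?f y\<bar> \<partial>lebesgue)"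
    using emeasure_heavy_le[of ?f "a - s"] \<open>0 < a - s\<close> by simp
  also have "\<dots> \<le> ennreal (5 ^ CARD('n)) * (ennreal t * rearr_mean f t)"
    using nn_integral_excess_le[OF f t s(2,1)] by (intro mult_left_mono) (simp_all add: rearr_mean_mult[OF t])
  also have "\<dots> \<le> ennreal (5 ^ CARD('n)) * (ennreal t * ennreal G)"
    by (intro mult_left_mono G) auto
  also have "\<dots> = ennreal (5 ^ CARD('n) * G * t)"
    using t G by (simp add: ennreal_mult mult_ac)
  also have "\<dots> \<le> ennreal ((a - s) * t)"
    using as t by (intro ennreal_leI mult_right_mono) auto
  also have "\<dots> = ennreal (a - s) * ennreal t"
    using \<open>0 < a - s\<close> t by (simp add: ennreal_mult)
  finally show ?thesis
    using \<open>0 < a - s\<close> by (subst (asm) ennreal_mult_le_mult_iff) auto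
qed

section \<open>Hardy's inequality\<close>

lemma nn_integral_powr_from_0:
  assumes "0 < t" "a < 1"
  shows "(\<integral>\<^sup>+\<tau>. ennreal (\<tau> powr - a) * indicator {0<..t} \<tau> \<partial>lborel) = ennreal (t powr (1 - a) / (1 - a))"
proof -
  have "((\<lambda>x. x powr - a) has_integral (t powr (- a + 1) / (- a + 1))) {0..t}"
    using assms by (intro has_integral_powr_from_0) auto
  then have "(\<integral>\<^sup>+\<tau>. ennreal (\<tau> powr - a) * indicator {0..t} \<tau> \<partial>lborel) = ennreal (t powr (- a + 1) / (- a + 1))"
    by (intro nn_integral_has_integral_lebesgue') auto
  moreover have "(\<integral>\<^sup>+\<tau>. ennreal (\<tau> powr - a) * indicator {0<..t} \<tau> \<partial>lborel)
      = (\<integral>\<^sup>+\<tau>. ennreal (\<tau> powr - a) * indicator {0..t} \<tau> \<partial>lborel)"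
    by (intro nn_integral_cong) (auto simp: indicator_def)
  ultimately show ?thesis by (simp add: add.commute)
qed

lemma nn_integral_powr_to_inf:
  assumes "0 < \<tau>" "1 < a"
  shows "(\<integral>\<^sup>+t. ennreal (t powr - a) * indicator {\<tau>..} t \<partial>lborel) = ennreal (\<tau> powr (1 - a) / (a - 1))"
proof -
  have "((\<lambda>x. x powr - a) has_integral (- (\<tau> powr (- a + 1)) / (- a + 1))) {\<tau>..}"
    using assms by (intro has_integral_powr_to_inf) auto
  then have "(\<integral>\<^sup>+t. ennreal (t powr - a) * indicator {\<tau>..} t \<partial>lborel) = ennreal (- (\<tau> powr (- a + 1)) / (- a + 1))"
    by (intro nn_integral_has_integral_lebesgue') auto
  also have "- (\<tau> powr (- a + 1)) / (- a + 1) = \<tau> powr (1 - a) / (a - 1)"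
    using assms by (simp add: divide_simps algebra_simps)
  finally show ?thesis .
qed

lemma rearr_mean_measurable [measurable]: "rearr_mean f \<in> borel_measurable borel"
proof -
  have "(\<lambda>t. \<integral>\<^sup>+\<tau>. rearrangement f \<tau> * (if 0 < \<tau> \<and> \<tau> \<le> t then 1 else 0) \<partial>lborel) \<in> borel_measurable borel"
    by measurable
  then show ?thesis
    unfolding rearr_mean_def[abs_def] indicator_def by simp
qed

lemma ennpowr_powr_weight:
  assumes "0 < t" shows "ennpowr (ennreal (t powr e) * x) a = ennreal (t powr (e * a)) * ennpowr x a"
  by (simp add: ennpowr_mult ennpowr_ennreal powr_powr)

lemma powr_weight_mult: "0 < t \<Longrightarrow> ennreal (t powr a) * ennreal (t powr b) = ennreal (t powr (a + b))"
  by (simp add: powr_add ennreal_mult)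

text \<open>Jensen's inequality is applied with the weight \<open>\<tau> powr - (1 / R)\<close>, for which both
  resulting power integrals converge exactly because \<open>1 < R\<close>.\<close>

lemma Hardy:
  assumes R: "1 < R" and r: "1 \<le> r"
  shows "Lq_norm r (\<lambda>t. ennreal (t powr (1 / R - enn2real (1 / r))) * rearr_mean f t)
    \<le> ennreal (R / (R - 1)) * lorentz R r f"
proof -
  define R' where "R' = R / (R - 1)"
  have R': "0 < R'" "1 / (1 - 1 / R) = R'" using R by (auto simp: R'_def field_simps)
  have iR: "0 < 1 / R" "1 / R < 1" using R by auto
  have [measurable]: "rearrangement f \<in> borel_measurable lborel" "rearr_mean f \<in> borel_measurable lborel"
    by simp_all
  have int: "(\<integral>\<^sup>+\<tau>. ennreal (\<tau> powr - (1 / R)) * indicator {0<..t} \<tau> \<partial>lborel) = ennreal (R' * t powr (1 - 1 / R))"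
    if "0 < t" for t
    using nn_integral_powr_from_0[OF that iR(2)] R'(2) by (simp add: divide_inverse mult.commute)
  show ?thesis
    using r
  proof (cases rule: ennreal_ge_1_cases)
    case 1
    define N where "N = Lq_norm top (\<lambda>t. ennreal (t powr (1 / R)) * rearrangement f t)"
    \<comment> \<open>For the infinite index, f*(\<tau>) is at most N \<tau>^(-1/R) almost
      everywhere, and this bound is integrated directly.\<close>
    have "ennreal (t powr (1 / R)) * rearr_mean f t \<le> ennreal R' * N" if t: "0 < t" for t
    proof -
      have "AE \<tau> in lborel. rearrangement f \<tau> * indicator {0<..t} \<tau> \<le> N * (ennreal (\<tau> powr - (1 / R)) * indicator {0<..t} \<tau>)"
        using AE_le_Lq_norm_top[of "\<lambda>t. ennreal (t powr (1 / R)) * rearrangement f t"]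
      proof eventually_elim
        case (elim \<tau>)
        show ?case
        proof (cases "0 < \<tau>")
          case True
          then have "ennreal (\<tau> powr - (1 / R)) * (ennreal (\<tau> powr (1 / R)) * rearrangement f \<tau>) \<le> ennreal (\<tau> powr - (1 / R)) * N"
            using elim by (intro mult_left_mono) (auto simp: N_def)
          then show ?thesis
            using True by (simp add: mult.assoc[symmetric] powr_weight_mult mult.commute[of N] mult_right_mono)
        qed simp
      qed
      then have "(\<integral>\<^sup>+\<tau>\<in>{0<..t}. rearrangement f \<tau> \<partial>lborel) \<le> (\<integral>\<^sup>+\<tau>. N * (ennreal (\<tau> powr - (1 / R)) * indicator {0<..t} \<tau>) \<partial>lborel)"
        by (rule nn_integral_mono_AE)
      also have "\<dots> = N * ennreal (R' * t powr (1 - 1 / R))"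
        unfolding int[OF t, symmetric] by (intro nn_integral_cmult) auto
      finally have "ennreal (t powr (1 / R)) * rearr_mean f t
          \<le> ennreal (t powr (1 / R)) * (ennreal (1 / t) * (N * ennreal (R' * t powr (1 - 1 / R))))"
        unfolding rearr_mean_def by (intro mult_left_mono) auto
      also have "\<dots> = N * ennreal (t powr (1 / R) * (1 / t) * (R' * t powr (1 - 1 / R)))"
      proof -
        have "ennreal (t powr (1 / R)) * (ennreal (1 / t) * (N * ennreal (R' * t powr (1 - 1 / R))))
            = N * (ennreal (t powr (1 / R)) * ennreal (1 / t) * ennreal (R' * t powr (1 - 1 / R)))"
          by (simp only: mult_ac)
        also have "ennreal (t powr (1 / R)) * ennreal (1 / t) * ennreal (R' * t powr (1 - 1 / R))
            = ennreal (t powr (1 / R) * (1 / t) * (R' * t powr (1 - 1 / R)))"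
          using t R' by (simp flip: ennreal_mult)
        finally show ?thesis .
      qed
      also have "t powr (1 / R) * (1 / t) * (R' * t powr (1 - 1 / R)) = R'"
        using t by (simp add: powr_diff)
      finally show ?thesis by (simp add: mult.commute)
    qed
    then show ?thesis
      unfolding 1 lorentz_def by (intro Lq_norm_top_le) (auto simp: N_def R'_def)
  next
    case (2 q)
    define e where "e = 1 / R - 1 / q"
    have e: "1 / R - enn2real (1 / r) = e"
      using 2 by (simp add: e_def divide_ennreal flip: ennreal_1)
    \<comment> \<open>The integrand left by Jensen's inequality: (f* \<tau>^(1/R))^q times the
      weight \<tau>^(-1/R).\<close>
    define \<Phi> where "\<Phi> \<tau> = ennpowr (rearrangement f \<tau>) q * ennreal (\<tau> powr ((q - 1) / R))" for \<tau>
    have [measurable]: "\<Phi> \<in> borel_measurable lborel" unfolding \<Phi>_def[abs_def] by measurable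
    define c where "c = ennreal (R' powr (q - 1))"
    have pt: "ennpowr (ennreal (t powr e) * rearr_mean f t) q
        \<le> c * (\<integral>\<^sup>+\<tau>. \<Phi> \<tau> * (if 0 < \<tau> \<and> \<tau> \<le> t then 1 else 0) * ennreal (t powr - (2 - 1 / R)) \<partial>lborel)"
      if t: "0 < t" for t
    proof -
      let ?w = "\<lambda>\<tau>. ennreal (\<tau> powr - (1 / R)) * indicator {0<..t} \<tau>"
      have "(\<integral>\<^sup>+\<tau>\<in>{0<..t}. rearrangement f \<tau> \<partial>lborel)
          = (\<integral>\<^sup>+\<tau>. (rearrangement f \<tau> * ennreal (\<tau> powr (1 / R))) * ?w \<tau> \<partial>lborel)"
        by (intro nn_integral_cong)
          (auto simp: indicator_def mult.assoc powr_weight_mult)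
      then have "ennpowr (\<integral>\<^sup>+\<tau>\<in>{0<..t}. rearrangement f \<tau> \<partial>lborel) q
          \<le> (\<integral>\<^sup>+\<tau>. ennpowr (rearrangement f \<tau> * ennreal (\<tau> powr (1 / R))) q * ?w \<tau> \<partial>lborel) * ennpowr (\<integral>\<^sup>+\<tau>. ?w \<tau> \<partial>lborel) (q - 1)"
        using nn_integral_weighted_Jensen[of "\<lambda>\<tau>. rearrangement f \<tau> * ennreal (\<tau> powr (1 / R))" lborel ?w q] 2
        by (auto simp: indicator_def)
      also have "(\<integral>\<^sup>+\<tau>. ennpowr (rearrangement f \<tau> * ennreal (\<tau> powr (1 / R))) q * ?w \<tau> \<partial>lborel)
          = (\<integral>\<^sup>+\<tau>. \<Phi> \<tau> * (if 0 < \<tau> \<and> \<tau> \<le> t then 1 else 0) \<partial>lborel)"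
      proof (intro nn_integral_cong)
        fix \<tau> :: real
        show "ennpowr (rearrangement f \<tau> * ennreal (\<tau> powr (1 / R))) q * ?w \<tau> = \<Phi> \<tau> * (if 0 < \<tau> \<and> \<tau> \<le> t then 1 else 0)"
        proof (cases "0 < \<tau> \<and> \<tau> \<le> t")
          case True
          have "q / R + - (1 / R) = (q - 1) / R" by (simp add: diff_divide_distrib)
          then show ?thesis
            using True by (simp add: \<Phi>_def ennpowr_mult ennpowr_ennreal powr_powr mult.assoc powr_weight_mult)
        qed (auto simp: indicator_def)
      qed
      also have "ennpowr (\<integral>\<^sup>+\<tau>. ?w \<tau> \<partial>lborel) (q - 1) = c * ennreal (t powr ((1 - 1 / R) * (q - 1)))"
        using R' t by (simp only: int[OF t] c_def) (simp add: ennpowr_mult ennpowr_ennreal powr_powr ennreal_mult)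
      finally have J: "ennpowr (\<integral>\<^sup>+\<tau>\<in>{0<..t}. rearrangement f \<tau> \<partial>lborel) q
          \<le> (\<integral>\<^sup>+\<tau>. \<Phi> \<tau> * (if 0 < \<tau> \<and> \<tau> \<le> t then 1 else 0) \<partial>lborel) * (c * ennreal (t powr ((1 - 1 / R) * (q - 1))))" .
      have m: "ennreal (t powr e) * rearr_mean f t = ennreal (t powr (e - 1)) * (\<integral>\<^sup>+\<tau>\<in>{0<..t}. rearrangement f \<tau> \<partial>lborel)"
        using t by (simp add: rearr_mean_def mult.assoc[symmetric] powr_diff ennreal_mult[symmetric])
      have "ennpowr (ennreal (t powr e) * rearr_mean f t) q
          = ennreal (t powr ((e - 1) * q)) * ennpowr (\<integral>\<^sup>+\<tau>\<in>{0<..t}. rearrangement f \<tau> \<partial>lborel) q"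
        unfolding m by (rule ennpowr_powr_weight[OF t])
      also have "\<dots> \<le> ennreal (t powr ((e - 1) * q)) * ((\<integral>\<^sup>+\<tau>. \<Phi> \<tau> * (if 0 < \<tau> \<and> \<tau> \<le> t then 1 else 0) \<partial>lborel) * (c * ennreal (t powr ((1 - 1 / R) * (q - 1)))))"
        by (intro mult_left_mono J) simp
      also have "\<dots> = c * ((\<integral>\<^sup>+\<tau>. \<Phi> \<tau> * (if 0 < \<tau> \<and> \<tau> \<le> t then 1 else 0) \<partial>lborel) * (ennreal (t powr ((e - 1) * q)) * ennreal (t powr ((1 - 1 / R) * (q - 1)))))"
        by (simp add: mult_ac)
      also have "ennreal (t powr ((e - 1) * q)) * ennreal (t powr ((1 - 1 / R) * (q - 1))) = ennreal (t powr ((e - 1) * q + (1 - 1 / R) * (q - 1)))"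
        by (rule powr_weight_mult[OF t])
      \<comment> \<open>The exponent -(e - 1) q of the averaging prefactor and that of the mass of
        the weight combine to 2 - 1/R up to sign, which exceeds 1 and hence is integrable at
        infinity.\<close>
      also have "(e - 1) * q + (1 - 1 / R) * (q - 1) = - (2 - 1 / R)"
        using 2 R by (simp add: e_def field_simps)
      also have "(\<integral>\<^sup>+\<tau>. \<Phi> \<tau> * (if 0 < \<tau> \<and> \<tau> \<le> t then 1 else 0) \<partial>lborel) * ennreal (t powr - (2 - 1 / R))
          = (\<integral>\<^sup>+\<tau>. \<Phi> \<tau> * (if 0 < \<tau> \<and> \<tau> \<le> t then 1 else 0) * ennreal (t powr - (2 - 1 / R)) \<partial>lborel)"
        by (intro nn_integral_multc[symmetric]) measurable
      finally show ?thesis .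
    qed
    have "(\<integral>\<^sup>+t\<in>{0<..}. ennpowr (ennreal (t powr e) * rearr_mean f t) q \<partial>lborel)
        \<le> (\<integral>\<^sup>+t. c * (\<integral>\<^sup>+\<tau>. \<Phi> \<tau> * (if 0 < \<tau> \<and> \<tau> \<le> t then 1 else 0) * ennreal (t powr - (2 - 1 / R)) \<partial>lborel) \<partial>lborel)"
    proof (rule nn_integral_mono)
      fix t :: real
      show "ennpowr (ennreal (t powr e) * rearr_mean f t) q * indicator {0<..} t
          \<le> c * (\<integral>\<^sup>+\<tau>. \<Phi> \<tau> * (if 0 < \<tau> \<and> \<tau> \<le> t then 1 else 0) * ennreal (t powr - (2 - 1 / R)) \<partial>lborel)"
        using pt[of t] by (cases "0 < t") simp_all
    qed
    also have "\<dots> = c * (\<integral>\<^sup>+t. (\<integral>\<^sup>+\<tau>. \<Phi> \<tau> * (if 0 < \<tau> \<and> \<tau> \<le> t then 1 else 0) * ennreal (t powr - (2 - 1 / R)) \<partial>lborel) \<partial>lborel)"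
      by (intro nn_integral_cmult) measurable
    also have "(\<integral>\<^sup>+t. (\<integral>\<^sup>+\<tau>. \<Phi> \<tau> * (if 0 < \<tau> \<and> \<tau> \<le> t then 1 else 0) * ennreal (t powr - (2 - 1 / R)) \<partial>lborel) \<partial>lborel)
        = (\<integral>\<^sup>+\<tau>. (\<integral>\<^sup>+t. \<Phi> \<tau> * (if 0 < \<tau> \<and> \<tau> \<le> t then 1 else 0) * ennreal (t powr - (2 - 1 / R)) \<partial>lborel) \<partial>lborel)"
      by (rule lborel_pair.Fubini') measurable
    \<comment> \<open>With the order of integration exchanged, the inner integral from \<tau> to
      infinity gives R' \<tau>^(-(1 - 1/R)). This restores the exponent \<open>e * q\<close>, and
      \<open>R'\<close> completes \<open>c\<close> to \<open>R' powr q\<close>.\<close>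
    also have "\<dots> = (\<integral>\<^sup>+\<tau>. ennreal R' * (ennpowr (ennreal (\<tau> powr e) * rearrangement f \<tau>) q * indicator {0<..} \<tau>) \<partial>lborel)"
    proof (intro nn_integral_cong)
      fix \<tau> :: real
      show "(\<integral>\<^sup>+t. \<Phi> \<tau> * (if 0 < \<tau> \<and> \<tau> \<le> t then 1 else 0) * ennreal (t powr - (2 - 1 / R)) \<partial>lborel)
          = ennreal R' * (ennpowr (ennreal (\<tau> powr e) * rearrangement f \<tau>) q * indicator {0<..} \<tau>)"
      proof (cases "0 < \<tau>")
        case True
        have a: "1 - (2 - 1 / R) = - (1 - 1 / R)" "(2 - 1 / R) - 1 = 1 - 1 / R" by auto
        have "(\<integral>\<^sup>+t. \<Phi> \<tau> * (if 0 < \<tau> \<and> \<tau> \<le> t then 1 else 0) * ennreal (t powr - (2 - 1 / R)) \<partial>lborel)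
            = (\<integral>\<^sup>+t. \<Phi> \<tau> * (ennreal (t powr - (2 - 1 / R)) * indicator {\<tau>..} t) \<partial>lborel)"
          using True by (intro nn_integral_cong) (auto simp: indicator_def)
        also have "\<dots> = \<Phi> \<tau> * (\<integral>\<^sup>+t. ennreal (t powr - (2 - 1 / R)) * indicator {\<tau>..} t \<partial>lborel)"
          by (intro nn_integral_cmult) measurable
        also have "\<dots> = \<Phi> \<tau> * ennreal (\<tau> powr - (1 - 1 / R) * R')"
          using nn_integral_powr_to_inf[OF True, of "2 - 1 / R"] iR R'(2) unfolding a by (simp add: divide_inverse)
        also have "\<dots> = ennreal R' * ((ennreal (\<tau> powr ((q - 1) / R)) * ennreal (\<tau> powr - (1 - 1 / R))) * ennpowr (rearrangement f \<tau>) q)"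
          using R' by (simp add: \<Phi>_def ennreal_mult mult_ac)
        also have "ennreal (\<tau> powr ((q - 1) / R)) * ennreal (\<tau> powr - (1 - 1 / R)) = ennreal (\<tau> powr ((q - 1) / R + - (1 - 1 / R)))"
          by (rule powr_weight_mult[OF True])
        also have "(q - 1) / R + - (1 - 1 / R) = e * q"
          using 2 R by (simp add: e_def field_simps)
        finally show ?thesis
          using True by (simp add: ennpowr_powr_weight)
      qed simp
    qed
    also have "\<dots> = ennreal R' * (\<integral>\<^sup>+\<tau>\<in>{0<..}. ennpowr (ennreal (\<tau> powr e) * rearrangement f \<tau>) q \<partial>lborel)"
      by (intro nn_integral_cmult) measurable
    also have "c * (ennreal R' * (\<integral>\<^sup>+\<tau>\<in>{0<..}. ennpowr (ennreal (\<tau> powr e) * rearrangement f \<tau>) q \<partial>lborel))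
        = ennreal (R' powr q) * (\<integral>\<^sup>+\<tau>\<in>{0<..}. ennpowr (ennreal (\<tau> powr e) * rearrangement f \<tau>) q \<partial>lborel)"
    proof -
      have "c * ennreal R' = ennreal (R' powr q)"
        using R' by (simp add: c_def powr_diff flip: ennreal_mult)
      then show ?thesis by (simp add: mult.assoc[symmetric])
    qed
    finally have "Lq_norm r (\<lambda>t. ennreal (t powr e) * rearr_mean f t)
        \<le> ennpowr (ennreal (R' powr q) * (\<integral>\<^sup>+\<tau>\<in>{0<..}. ennpowr (ennreal (\<tau> powr e) * rearrangement f \<tau>) q \<partial>lborel)) (1 / q)"
      using 2 by (simp add: Lq_norm_ennreal ennpowr_mono)
    also have "\<dots> = ennreal R' * lorentz R r f"
      using 2 R' by (simp add: lorentz_def e[unfolded 2] Lq_norm_ennreal ennpowr_mult ennpowr_ennreal powr_powr)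
    finally show ?thesis unfolding e R'_def .
  qed
qed

text \<open>An infinite average at \<open>t\<close> would make all averages beyond \<open>t\<close>
  infinite, on an interval of positive length, whereas Hardy's inequality makes them finite almost
  everywhere.\<close>

lemma rearr_mean_finite:
  assumes R: "1 < R" and r: "1 \<le> r" and fin: "lorentz R r f < top" and t: "0 < t"
  shows "rearr_mean f t < top"
proof (rule ccontr)
  assume "\<not> ?thesis"
  then have top: "ennreal (1 / t) * (\<integral>\<^sup>+\<tau>\<in>{0<..t}. rearrangement f \<tau> \<partial>lborel) = top"
    by (simp add: rearr_mean_def not_less top_unique)
  have "rearr_mean f t' = top" if "t < t'" for t'
  proof -
    have "(\<integral>\<^sup>+\<tau>\<in>{0<..t}. rearrangement f \<tau> \<partial>lborel) \<le> (\<integral>\<^sup>+\<tau>\<in>{0<..t'}. rearrangement f \<tau> \<partial>lborel)"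
      using that by (intro nn_integral_mono) (auto simp: indicator_def)
    then show ?thesis
      using top that t by (auto simp: rearr_mean_def ennreal_mult_eq_top_iff top_unique)
  qed
  moreover have "AE t in lborel. 0 < t \<longrightarrow> ennreal (t powr (1 / R - enn2real (1 / r))) * rearr_mean f t < top"
    using Hardy[OF R r, of f] fin R
    by (intro AE_less_top_of_Lq_norm[OF _ r]) (auto simp: ennreal_mult_less_top elim!: le_less_trans)
  ultimately have "AE x in lborel. x \<notin> {t<..<t + 1}"
    using t by (auto elim!: eventually_mono simp: ennreal_mult_top)
  then have "{t<..<t + 1} \<in> null_sets lborel"
    by (subst (asm) AE_iff_null_sets[symmetric]) auto
  then show False by (simp add: null_sets_def)
qed

section \<open>The interpolation inequality\<close>

lemma weak_grad_norm_measurable: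
  fixes u :: "real ^ 'n::finite \<Rightarrow> real"
  assumes u: "weakly_differentiable k u" and i: "i \<le> k"
  shows "weak_grad_norm i u \<in> borel_measurable lebesgue"
proof -
  have "weak_partial w u \<in> borel_measurable lebesgue" if "length w = i" for w
    using has_weak_partial_weak_partial[OF u, of w] that i
    by (intro locally_integrable_measurable) (simp add: has_weak_partial_def)
  then show ?thesis
    unfolding weak_grad_norm_def[abs_def] L2_set_def
    by (intro measurable_compose[OF _ borel_measurable_sqrt] borel_measurable_sum borel_measurable_power) auto
qed

lemma AE_lebesgue_point_weak_partial:
  fixes u :: "real ^ 'n::finite \<Rightarrow> real"
  assumes u: "weakly_differentiable k u" and j: "j \<le> k"
  shows "AE x in lebesgue. \<forall>w. length w = j \<longrightarrow> lebesgue_point (weak_partial w u) x"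
proof -
  have "AE x in lebesgue. \<forall>w\<in>{w. length w = j}. lebesgue_point (weak_partial w u) x"
    using has_weak_partial_weak_partial[OF u] j
    by (intro AE_finite_allI finite_words AE_lebesgue_point locally_integrable_cball) (simp add: has_weak_partial_def)
  then show ?thesis by (simp add: Ball_def)
qed

text \<open>This \<rho> makes the two summands equal, whence the factor 2.\<close>

lemma balance_powers:
  fixes \<alpha> \<beta> :: real
  assumes "j < k" "0 < \<alpha>" "0 < \<beta>"
  defines "\<theta> \<equiv> real j / real k" and "\<rho> \<equiv> (\<beta> / \<alpha>) powr (1 / real k)"
  shows "\<rho> ^ (k - j) * \<alpha> + \<beta> / \<rho> ^ j = 2 * (\<alpha> powr \<theta> * \<beta> powr (1 - \<theta>))"
proof -
  have pos: "0 < \<rho>" using assms by (simp add: \<rho>_def)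
  have "\<rho> ^ (k - j) = (\<beta> / \<alpha>) powr (1 - \<theta>)"
    using assms pos by (simp add: powr_realpow[symmetric] powr_powr \<rho>_def \<theta>_def of_nat_diff diff_divide_distrib)
  moreover have "\<rho> ^ j = (\<beta> / \<alpha>) powr \<theta>"
    using assms pos by (simp add: powr_realpow[symmetric] powr_powr \<rho>_def \<theta>_def)
  ultimately show ?thesis
    using assms by (simp add: powr_divide powr_diff)
qed

text \<open>Outside the two heavy sets and a null set, the pointwise estimate with balanced \<rho>
  bounds the gradient. The exceptional set has measure at most \<open>t\<close>, which is what an
  admissible level in the rearrangement requires.\<close>

lemma rearrangement_weak_grad_norm_le:
  fixes j k :: nat
  assumes jk: "j < k"
  defines "\<theta> \<equiv> real j / real k"
  shows "\<exists>C>0. \<forall>(u :: real ^ 'n::finite \<Rightarrow> real) t \<alpha> \<beta>. weakly_differentiable k u \<longrightarrow> 0 < t \<longrightarrow> 0 < \<alpha> \<longrightarrow> 0 < \<beta> \<longrightarrow>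
    emeasure lebesgue (heavy \<alpha> (weak_grad_norm k u)) \<le> ennreal (t / 2) \<longrightarrow>
    emeasure lebesgue (heavy \<beta> u) \<le> ennreal (t / 2) \<longrightarrow>
    rearrangement (weak_grad_norm j u) t \<le> ennreal (C * (\<alpha> powr \<theta> * \<beta> powr (1 - \<theta>)))"
proof -
  obtain C where C: "0 < C" and
    pointwise: "\<And>(u :: real ^ 'n \<Rightarrow> real) w x \<alpha> \<beta> \<rho>. weakly_differentiable k u \<Longrightarrow> length w = j \<Longrightarrow>
      lebesgue_point (weak_partial w u) x \<Longrightarrow> 0 < \<alpha> \<Longrightarrow> 0 < \<beta> \<Longrightarrow> 0 < \<rho> \<Longrightarrow>
      x \<notin> heavy \<alpha> (weak_grad_norm k u) \<Longrightarrow> x \<notin> heavy \<beta> u \<Longrightarrow>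
      \<bar>weak_partial w u x\<bar> \<le> C * (\<rho> ^ (k - j) * \<alpha> + \<beta> / \<rho> ^ j)"
    using weak_partial_pointwise_le[OF jk, where 'n = 'n] by blast
  \<comment> \<open>The number of words of length \<open>j\<close> bounds the Euclidean norm through
    the sum of components; the 2 comes from \<open>balance_powers\<close>.\<close>
  define D where "D = real (CARD('n) ^ j) * (C * 2)"
  have D: "0 < D" using C by (simp add: D_def)
  have "rearrangement (weak_grad_norm j u) t \<le> ennreal (D * (\<alpha> powr \<theta> * \<beta> powr (1 - \<theta>)))"
    if u: "weakly_differentiable k u" and pos: "0 < t" "0 < \<alpha>" "0 < \<beta>"
      and hv: "emeasure lebesgue (heavy \<alpha> (weak_grad_norm k u)) \<le> ennreal (t / 2)"
        "emeasure lebesgue (heavy \<beta> u) \<le> ennreal (t / 2)"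
    for u :: "real ^ 'n \<Rightarrow> real" and t \<alpha> \<beta>
  proof (rule rearrangement_le)
    let ?s = "D * (\<alpha> powr \<theta> * \<beta> powr (1 - \<theta>))" and ?H = "heavy \<alpha> (weak_grad_norm k u) \<union> heavy \<beta> u"
    show "0 < ?s" using D pos by simp
    have bound: "weak_grad_norm j u x \<le> ?s"
      if x: "\<forall>w. length w = j \<longrightarrow> lebesgue_point (weak_partial w u) x" "x \<notin> ?H" for x
    proof -
      have "weak_grad_norm j u x \<le> (\<Sum>w\<in>{w. length w = j}. \<bar>weak_partial w u x\<bar>)"
        unfolding weak_grad_norm_def by (rule L2_set_le_sum_abs)
      also have "\<dots> \<le> (\<Sum>w\<in>{w :: 'n list. length w = j}. C * (2 * (\<alpha> powr \<theta> * \<beta> powr (1 - \<theta>))))"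
      proof (rule sum_mono)
        fix w :: "'n list" assume "w \<in> {w. length w = j}"
        then show "\<bar>weak_partial w u x\<bar> \<le> C * (2 * (\<alpha> powr \<theta> * \<beta> powr (1 - \<theta>)))"
          using pointwise[OF u, of w x \<alpha> \<beta> "(\<beta> / \<alpha>) powr (1 / real k)"] x pos jk
          unfolding \<theta>_def by (simp add: balance_powers)
      qed
      also have "\<dots> = ?s" by (simp add: card_words D_def)
      finally show ?thesis .
    qed
    have meas: "?H \<in> sets lebesgue" by auto
    have "AE x in lebesgue. x \<in> {x. ?s < norm (weak_grad_norm j u x)} \<longrightarrow> x \<in> ?H"
      using AE_lebesgue_point_weak_partial[OF u less_imp_le[OF jk]]
    proof eventually_elim
      case (elim x)
      have "0 \<le> weak_grad_norm j u x" by (simp add: weak_grad_norm_def L2_set_nonneg)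
      then show ?case using bound[OF elim] by (auto simp: not_less[symmetric])
    qed
    then have "emeasure lebesgue {x. ?s < norm (weak_grad_norm j u x)} \<le> emeasure lebesgue ?H"
      by (rule emeasure_mono_AE[OF _ meas])
    also have "\<dots> \<le> emeasure lebesgue (heavy \<alpha> (weak_grad_norm k u)) + emeasure lebesgue (heavy \<beta> u)"
      by (intro emeasure_subadditive heavy_sets)
    also have "\<dots> \<le> ennreal (t / 2) + ennreal (t / 2)" by (intro add_mono hv)
    also have "\<dots> = ennreal t" using pos by (simp flip: ennreal_plus)
    finally show "emeasure lebesgue {x. ?s < norm (weak_grad_norm j u x)} \<le> ennreal t" .
  qed
  then show ?thesis using D by blast
qed

text \<open>The averages may vanish while levels must be positive, so the levels are shifted by
  \<epsilon>. Both exponents being positive, the powers are continuous at 0 from the right.\<close>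

lemma le_powr_mult_limit:
  fixes a b C :: real
  assumes "0 < \<theta>" "\<theta> < 1" "0 \<le> a" "0 \<le> b"
    and "\<And>\<epsilon>. 0 < \<epsilon> \<Longrightarrow> x \<le> ennreal (C * ((a + \<epsilon>) powr \<theta> * (b + \<epsilon>) powr (1 - \<theta>)))"
  shows "x \<le> ennreal (C * (a powr \<theta> * b powr (1 - \<theta>)))"
proof (rule tendsto_lowerbound)
  have "((\<lambda>\<epsilon>. C * ((a + \<epsilon>) powr \<theta> * (b + \<epsilon>) powr (1 - \<theta>))) \<longlongrightarrow> C * ((a + 0) powr \<theta> * (b + 0) powr (1 - \<theta>))) (at_right 0)"
    by (intro tendsto_mult tendsto_const tendsto_powr2 tendsto_add tendsto_ident_at)
      (use assms in \<open>auto simp: eventually_at_filter\<close>)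
  then show "((\<lambda>\<epsilon>. ennreal (C * ((a + \<epsilon>) powr \<theta> * (b + \<epsilon>) powr (1 - \<theta>)))) \<longlongrightarrow> ennreal (C * (a powr \<theta> * b powr (1 - \<theta>)))) (at_right 0)"
    by (intro tendsto_ennrealI) simp
  show "\<forall>\<^sub>F \<epsilon> in at_right 0. x \<le> ennreal (C * ((a + \<epsilon>) powr \<theta> * (b + \<epsilon>) powr (1 - \<theta>)))"
    using assms(5) by (auto simp: eventually_at_filter)
qed simp

lemma rearrangement_weak_grad_norm_le_mean:
  fixes j k :: nat
  assumes jk: "1 \<le> j" "j < k"
  defines "\<theta> \<equiv> real j / real k"
  shows "\<exists>C>0. \<forall>(u :: real ^ 'n::finite \<Rightarrow> real) t. weakly_differentiable k u \<longrightarrow> 0 < t \<longrightarrow>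
    rearr_mean (weak_grad_norm k u) (t / 2) < top \<longrightarrow> rearr_mean u (t / 2) < top \<longrightarrow>
    rearrangement (weak_grad_norm j u) t
      \<le> ennreal C * (ennpowr (rearr_mean (weak_grad_norm k u) t) \<theta> * ennpowr (rearr_mean u t) (1 - \<theta>))"
proof -
  have \<theta>: "0 < \<theta>" "\<theta> < 1" using jk by (auto simp: \<theta>_def)
  obtain C where C: "0 < C" and
    rearr: "\<And>(u :: real ^ 'n \<Rightarrow> real) t \<alpha> \<beta>. weakly_differentiable k u \<Longrightarrow> 0 < t \<Longrightarrow> 0 < \<alpha> \<Longrightarrow> 0 < \<beta> \<Longrightarrow>
      emeasure lebesgue (heavy \<alpha> (weak_grad_norm k u)) \<le> ennreal (t / 2) \<Longrightarrow>
      emeasure lebesgue (heavy \<beta> u) \<le> ennreal (t / 2) \<Longrightarrow>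
      rearrangement (weak_grad_norm j u) t \<le> ennreal (C * (\<alpha> powr \<theta> * \<beta> powr (1 - \<theta>)))"
    using rearrangement_weak_grad_norm_le[OF jk(2), where 'n = 'n] unfolding \<theta>_def by blast
  define K where "K = (5 ^ CARD('n) + 1 :: real)"
  have K: "0 < K" by (simp add: K_def add_pos_pos)
  have pp: "x powr \<theta> * x powr (1 - \<theta>) = x" if "0 < x" for x :: real
    using that by (simp flip: powr_add)
  have "rearrangement (weak_grad_norm j u) t
      \<le> ennreal (C * K * 2) * (ennpowr (rearr_mean (weak_grad_norm k u) t) \<theta> * ennpowr (rearr_mean u t) (1 - \<theta>))"
    if u: "weakly_differentiable k u" and t: "0 < t"
      and fin: "rearr_mean (weak_grad_norm k u) (t / 2) < top" "rearr_mean u (t / 2) < top"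
    for u :: "real ^ 'n \<Rightarrow> real" and t
  proof -
    obtain G where G: "rearr_mean (weak_grad_norm k u) (t / 2) = ennreal G" "0 \<le> G"
      using fin(1) by (cases "rearr_mean (weak_grad_norm k u) (t / 2)") auto
    obtain U where U: "rearr_mean u (t / 2) = ennreal U" "0 \<le> U"
      using fin(2) by (cases "rearr_mean u (t / 2)") auto
    have um: "u \<in> borel_measurable lebesgue"
      using u by (intro locally_integrable_measurable) (simp add: weakly_differentiable_def)
    have gm: "weak_grad_norm k u \<in> borel_measurable lebesgue"
      by (rule weak_grad_norm_measurable[OF u]) simp
    have "rearrangement (weak_grad_norm j u) t \<le> ennreal (C * ((K * G) powr \<theta> * (K * U) powr (1 - \<theta>)))"
    proof (rule le_powr_mult_limit[OF \<theta>])
      fix \<epsilon> :: real assume \<epsilon>: "0 < \<epsilon>"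
      have "0 < K * G + \<epsilon>" "0 < K * U + \<epsilon>" using K G U \<epsilon> by (auto intro: add_nonneg_pos)
      then show "rearrangement (weak_grad_norm j u) t \<le> ennreal (C * ((K * G + \<epsilon>) powr \<theta> * (K * U + \<epsilon>) powr (1 - \<theta>)))"
        using t G U \<epsilon>
        by (intro rearr[OF u t] emeasure_heavy_le_of_rearr_mean[OF gm, of _ G] emeasure_heavy_le_of_rearr_mean[OF um, of _ U])
          (auto simp: K_def)
    qed (use K G U in auto)
    \<comment> \<open>The exponents add up to 1, so the common factor \<open>K\<close> leaves the
      product to the first power; the same happens to the factor 2 from halving
      \<open>t\<close>.\<close>
    also have "C * ((K * G) powr \<theta> * (K * U) powr (1 - \<theta>)) = C * K * (G powr \<theta> * U powr (1 - \<theta>))"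
      using K G U pp[OF K] by (simp add: powr_mult mult_ac)
    also have "ennreal (C * K * (G powr \<theta> * U powr (1 - \<theta>)))
        = ennreal (C * K) * (ennpowr (ennreal G) \<theta> * ennpowr (ennreal U) (1 - \<theta>))"
      using C K G U by (simp add: ennpowr_ennreal ennreal_mult)
    also have "\<dots> \<le> ennreal (C * K) * (ennpowr (2 * rearr_mean (weak_grad_norm k u) t) \<theta> * ennpowr (2 * rearr_mean u t) (1 - \<theta>))"
      unfolding G(1)[symmetric] U(1)[symmetric]
      using \<theta> t by (intro mult_left_mono mult_mono ennpowr_mono rearr_mean_half_le) auto
    also have "\<dots> = ennreal (C * K) * ((ennpowr 2 \<theta> * ennpowr 2 (1 - \<theta>))
        * (ennpowr (rearr_mean (weak_grad_norm k u) t) \<theta> * ennpowr (rearr_mean u t) (1 - \<theta>)))"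
      by (simp add: ennpowr_mult mult_ac)
    also have "ennpowr 2 \<theta> * ennpowr 2 (1 - \<theta>) = 2"
      by (simp flip: ennpowr_add)
    also have "ennreal (C * K) * (2 * (ennpowr (rearr_mean (weak_grad_norm k u) t) \<theta> * ennpowr (rearr_mean u t) (1 - \<theta>)))
        = ennreal (C * K * 2) * (ennpowr (rearr_mean (weak_grad_norm k u) t) \<theta> * ennpowr (rearr_mean u t) (1 - \<theta>))"
      using C K by (simp add: ennreal_mult mult.assoc)
    finally show ?thesis .
  qed
  moreover have "0 < C * K * 2" using C K by simp
  ultimately show ?thesis by blast
qed

theorem corollary1p3:
  fixes j k :: nat and P Q R :: real and p q r :: ennreal
  assumes "1 \<le> j" and "j < k"
    and "1 < P" and "1 < Q" and "1 < R"
    and "1 \<le> p" and "1 \<le> q" and "1 \<le> r"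
    and "1 / P = (real j / real k) / R + (1 - real j / real k) / Q"
    and "1 / p = ennreal (real j / real k) / r + ennreal (1 - real j / real k) / q"
  shows "\<exists>C::real. C > 0 \<and>
    (\<forall>u :: real ^ 'n::finite \<Rightarrow> real. weakly_differentiable k u \<longrightarrow>
       lorentz P p (weak_grad_norm j u)
         \<le> ennreal C * mult_top (ennpowr (lorentz R r (weak_grad_norm k u)) (real j / real k))
                                 (ennpowr (lorentz Q q u) (1 - real j / real k)))"
proof -
  define \<theta> where "\<theta> = real j / real k"
  have \<theta>: "0 < \<theta>" "\<theta> < 1" using assms(1,2) by (auto simp: \<theta>_def)
  obtain C where C: "0 < C" and
    rearr: "\<And>(u :: real ^ 'n \<Rightarrow> real) t. weakly_differentiable k u \<Longrightarrow> 0 < t \<Longrightarrow>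
      rearr_mean (weak_grad_norm k u) (t / 2) < top \<Longrightarrow> rearr_mean u (t / 2) < top \<Longrightarrow>
      rearrangement (weak_grad_norm j u) t
        \<le> ennreal C * (ennpowr (rearr_mean (weak_grad_norm k u) t) \<theta> * ennpowr (rearr_mean u t) (1 - \<theta>))"
    using rearrangement_weak_grad_norm_le_mean[OF assms(1,2), where 'n = 'n] unfolding \<theta>_def by blast
  define R' where "R' = R / (R - 1)"
  define Q' where "Q' = Q / (Q - 1)"
  have RQ: "0 < R'" "0 < Q'" using assms by (auto simp: R'_def Q'_def)
  define D where "D = C * (R' powr \<theta> * Q' powr (1 - \<theta>))"
  have D: "0 < D" using C RQ by (simp add: D_def)
  have fin: "1 / q \<noteq> top" "1 / r \<noteq> top"
    using assms by (auto simp: ennreal_divide_eq_top_iff)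
  have "1 / p = ennreal \<theta> * (1 / r) + ennreal (1 - \<theta>) * (1 / q)"
    using assms(10) by (simp add: \<theta>_def ennreal_times_divide)
  then have ep: "enn2real (1 / p) = \<theta> * enn2real (1 / r) + (1 - \<theta>) * enn2real (1 / q)"
    using \<theta> fin by (simp add: enn2real_plus enn2real_mult ennreal_mult_less_top less_top)
  define eP where "eP = 1 / P - enn2real (1 / p)"
  define eR where "eR = 1 / R - enn2real (1 / r)"
  define eQ where "eQ = 1 / Q - enn2real (1 / q)"
  \<comment> \<open>Both index relations combine to interpolate the weight exponents, so the weight
    on the left splits into exactly the two weights of Hardy's inequality.\<close>
  have e: "eP = eR * \<theta> + eQ * (1 - \<theta>)"
    using assms(9) unfolding eP_def eR_def eQ_def ep \<theta>_def[symmetric] by (simp add: algebra_simps)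
  have "lorentz P p (weak_grad_norm j u)
      \<le> ennreal D * mult_top (ennpowr (lorentz R r (weak_grad_norm k u)) \<theta>) (ennpowr (lorentz Q q u) (1 - \<theta>))"
    if u: "weakly_differentiable k u" for u :: "real ^ 'n \<Rightarrow> real"
  proof (cases "lorentz R r (weak_grad_norm k u) = top \<or> lorentz Q q u = top")
    case True
    \<comment> \<open>By the convention of \<open>mult_top\<close> the right-hand side is infinite
      even if the other factor is 0.\<close>
    then show ?thesis using D by (auto simp: mult_top_def ennreal_mult_top)
  next
    case False
    then have lfin: "lorentz R r (weak_grad_norm k u) < top" "lorentz Q q u < top"
      by (auto simp: less_top)
    define a where "a t = ennreal (t powr eR) * rearr_mean (weak_grad_norm k u) t" for t
    define b where "b t = ennreal (t powr eQ) * rearr_mean u t" for t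
    have [measurable]: "a \<in> borel_measurable lborel" "b \<in> borel_measurable lborel"
      unfolding a_def[abs_def] b_def[abs_def] by measurable
    have ha: "Lq_norm r a \<le> ennreal R' * lorentz R r (weak_grad_norm k u)"
      unfolding a_def[abs_def] eR_def R'_def by (rule Hardy) (use assms in auto)
    have hb: "Lq_norm q b \<le> ennreal Q' * lorentz Q q u"
      unfolding b_def[abs_def] eQ_def Q'_def by (rule Hardy) (use assms in auto)
    have "lorentz P p (weak_grad_norm j u) \<le> ennreal C * Lq_norm p (\<lambda>t. ennpowr (a t) \<theta> * ennpowr (b t) (1 - \<theta>))"
      unfolding lorentz_def eP_def[symmetric]
    proof (rule Lq_norm_le_cmult[OF _ _ assms(6) C])
      fix t :: real assume t: "0 < t"
      have "rearrangement (weak_grad_norm j u) t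
          \<le> ennreal C * (ennpowr (rearr_mean (weak_grad_norm k u) t) \<theta> * ennpowr (rearr_mean u t) (1 - \<theta>))"
        \<comment> \<open>Finiteness of both Lorentz functionals makes the averages at
          \<open>t / 2\<close> finite, as the estimate demands.\<close>
        using t assms lfin by (intro rearr u rearr_mean_finite) auto
      then have "ennreal (t powr eP) * rearrangement (weak_grad_norm j u) t
          \<le> ennreal (t powr eP) * (ennreal C * (ennpowr (rearr_mean (weak_grad_norm k u) t) \<theta> * ennpowr (rearr_mean u t) (1 - \<theta>)))"
        by (rule mult_left_mono) simp
      also have "\<dots> = ennreal C * (ennpowr (a t) \<theta> * ennpowr (b t) (1 - \<theta>))"
        unfolding e a_def b_def ennpowr_powr_weight[OF t] powr_weight_mult[OF t, symmetric] by (simp only: mult_ac)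
      finally show "ennreal (t powr eP) * rearrangement (weak_grad_norm j u) t
          \<le> ennreal C * (ennpowr (a t) \<theta> * ennpowr (b t) (1 - \<theta>))" .
    qed measurable
    also have "\<dots> \<le> ennreal C * (ennpowr (Lq_norm r a) \<theta> * ennpowr (Lq_norm q b) (1 - \<theta>))"
      using assms(6-8,10) \<theta> by (intro mult_left_mono Lq_norm_Hoelder) (auto simp: \<theta>_def)
    also have "\<dots> \<le> ennreal C * (ennpowr (ennreal R' * lorentz R r (weak_grad_norm k u)) \<theta>
        * ennpowr (ennreal Q' * lorentz Q q u) (1 - \<theta>))"
      using \<theta> ha hb by (intro mult_left_mono mult_mono ennpowr_mono) auto
    also have "\<dots> = ennreal D * (ennpowr (lorentz R r (weak_grad_norm k u)) \<theta> * ennpowr (lorentz Q q u) (1 - \<theta>))"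
      using RQ C by (simp add: D_def ennpowr_mult ennpowr_ennreal ennreal_mult mult_ac)
    also have "\<dots> = ennreal D * mult_top (ennpowr (lorentz R r (weak_grad_norm k u)) \<theta>) (ennpowr (lorentz Q q u) (1 - \<theta>))"
      using False by (simp add: mult_top_def)
    finally show ?thesis .
  qed
  then show ?thesis using D unfolding \<theta>_def by blast
qed

end
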